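(* Let $\alpha_0,\alpha_1\in\mathbb{R}$ and let $f,c$ be (real) analytic on $[0,1]$ with $c(x)\ge c_{\min}>0$ for all $x\in I=(0,1)$. For $0<\delta<1$ let $u_\delta$ be the solution of $-\delta^2u_\delta''+cu_\delta=f$ in $I$, $u_\delta(0)=\alpha_0$, $u_\delta(1)=\alpha_1$, and let $u_{\delta,p}$ ($p\in\mathbb{N}$) be the high-order approximations of $u_\delta$ fixed in the context. For $L\in\mathbb{N}$ write $u_{\delta,L}$ for $u_{\delta,p}$ with $p=L$, and $h=1/(2^L+1)$. Then there exist $C_1,b_1>0$ such that for all $0<\delta<1$ and all $L\in\mathbb{N}$ $$\|\Pi_L^{L^2}u_{\delta,L}-u_\delta\|_\delta\le C_1\left(e^{-b_1L}+\min\left(\sqrt h,\frac{h}{\sqrt\delta}\right)\right).$$ Furthermore, $\Pi_L^{L^2}u_{\delta,L}$ admits a QTT decomposition with respect to $\mathcal{T}_L^{\mathrm{int}}$ with QTT-ranks of order $\mathcal{O}(L)$ and with number of parameters $N_{\mathrm{dof}}=\mathcal{O}(L^3)$, where the implied constants are independent of $\delta$ and $L$. With respect to the number of parameters $N_{\mathrm{dof}}$ of this QTT representation, the inequality $\|\Pi_L^{L^2}u_{\delta,L}-u_\delta\|_\delta\le C_1\left(e^{-b_1L}+\min\left(\sqrt h,\frac{h}{\sqrt\delta}\right)\right)$ reads $$\|\Pi_L^{L^2}u_{\delta,L}-u_\delta\|_\delta\le C_2\exp\left(-b_2N_{\mathrm{dof}}^{1/3}\right),$$ with $C_2,b_2>0$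 independent of $\delta$ and $L$.
   Context: $\mathbb{N}=\{1,2,\dots\}$, $I=(0,1)$. The solution $u_\delta\in H^1(I)$ is the unique weak solution: $u_\delta(0)=\alpha_0$, $u_\delta(1)=\alpha_1$ and $\int_I\delta^2u_\delta'v'+\int_Icu_\delta v=\int_Ifv$ for all $v\in H^1_0(I)$. The $\delta$-dependent norm on $H^1(I)$ is $\|v\|_\delta=(\delta^2\|v'\|_{L^2(I)}^2+\|v\|_{L^2(I)}^2)^{1/2}$. Piecewise polynomial spaces. $\mathbb{P}_p(\Omega)$ is the space of polynomials of degree at most $p$ on $\Omega$. For $\mathcal{T}=\{0=\xi_0<\xi_1<\dots<\xi_N=1\}$ and $p\in\mathbb{N}_0$, $V(I,p,\mathcal{T})$ is the set of $v\in C([0,1])$ with $v|_{[\xi_{i-1},\xi_i]}\in\mathbb{P}_p([\xi_{i-1},\xi_i])$ for $i=1,\dots,N$ and $v(0)=\alpha_0$, $v(1)=\alpha_1$; $V_0(I,p,\mathcal{T})$ is the analogous space with $v(0)=v(1)=0$. High-order approximation. For $\kappa>0$ let $\mathcal{T}^{\mathrm{hp}}_\kappa=\{0,\ \min\{0.25,\kappa\},\ 1-\min\{0.25,\kappa\},\ 1\}$. It is known (Melenk) that there are $\lambda_0>0$ such that for $\lambda\in(0,\lambda_0)$ there are constants $C_0,b_0>0$ independent of $\delta$ and, for all $0<\delta<1$ and $p\in\mathbb{N}$, a function $u_{\delta,p}\in V(I,p,\mathcal{T}^{\mathrm{hp}}_{\lambda p\delta})$ with $\|u_\delta-u_{\delta,p}\|_\delta\le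 C_0e^{-b_0p}$. Such $\lambda,C_0,b_0$ and functions $u_{\delta,p}$ are fixed. Low-order space. $\mathcal{T}_L=\{j/(2^L+1):j=0,\dots,2^L+1\}$, $\mathcal{T}_L^{\mathrm{int}}=\{j/(2^L+1):j=1,\dots,2^L\}$, $V^L=V(I,1,\mathcal{T}_L)$, $V^L_0=V_0(I,1,\mathcal{T}_L)$. The $L^2$ projection $\Pi_L^{L^2}:L^2(I)\to V^L$ is defined by $\int_I(\Pi_L^{L^2}v-v)v_L=0$ for all $v_L\in V_0^L$. QTT. A vector $u\in\mathbb{R}^{2^L}$, indexed by $i=0,\dots,2^L-1$, admits a QTT decomposition with QTT-ranks $r_1,\dots,r_{L-1}\in\mathbb{N}$ (and $r_0=r_L=1$) if there are maps $V^j:\{0,1\}\to\mathbb{R}^{r_{j-1}\times r_j}$, $j=1,\dots,L$, with $u(i)=V^1(i_1)\cdots V^L(i_L)$ for all $i=\sum_{j=1}^L2^{L-j}i_j$, $i_j\in\{0,1\}$. Its number of parameters is the total number of entries of the cores, $\sum_{j=1}^L2r_{j-1}r_j$. A function $g$ defined at the points $x_1<\dots<x_{2^L}$ of a grid $\mathcal{T}$ admits a QTT decomposition with respect to $\mathcal{T}$ if the vector $(g(x_1),\dots,g(x_{2^L}))$ does, the QTT-ranks and parameters being those of the vector. *)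

theory Defs
  imports
    "HOL-Analysis.Analysis"
    "HOL-Computational_Algebra.Polynomial"
    "Jordan_Normal_Form.Matrix"
begin

text \<open>
  A real function on a set \<open>S\<close> that is locally the sum of a power series. The series is only compared
  with the function inside \<open>S\<close>; at the endpoints of \<open>[0,1]\<close> this still gives an analytic extension to
  a two-sided neighbourhood, because the series converges on a symmetric interval.
\<close>

definition real_analytic_on :: "(real \<Rightarrow> real) \<Rightarrow> real set \<Rightarrow> bool" where
  "real_analytic_on g S \<longleftrightarrow>
     (\<forall>x\<in>S. \<exists>r>0. \<exists>a :: nat \<Rightarrow> real.
        \<forall>y\<in>S. \<bar>y - x\<bar> < r \<longrightarrow> (\<lambda>n. a n * (y - x) ^ n) sums g y)"


section \<open>Sobolev spaces on the unit interval\<close>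

abbreviation unit_I :: "real set" where
  "unit_I \<equiv> {0<..<1}"

definition L2_I :: "(real \<Rightarrow> real) set" where
  "L2_I = {v. set_borel_measurable lebesgue unit_I v \<and>
              set_integrable lebesgue unit_I (\<lambda>x. (v x)\<^sup>2)}"

definition L2_norm_I :: "(real \<Rightarrow> real) \<Rightarrow> real" where
  "L2_norm_I v = sqrt (LINT x:unit_I|lebesgue. (v x)\<^sup>2)"

text \<open>
  Test functions are of class \<open>C\<^sup>1\<close> with compact support in \<open>(0,1)\<close>, as in the definition of
  \<open>W\<^sup>1\<^sup>,\<^sup>p\<close> of an interval in Brezis, Functional Analysis, Sobolev Spaces and Partial Differential
  Equations, Section 8.2.
\<close>

definition test_functions :: "(real \<Rightarrow> real) set" where
  "test_functions = {\<phi>. \<phi> C1_differentiable_on UNIV \<and>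
      compact (closure {x. \<phi> x \<noteq> 0}) \<and> closure {x. \<phi> x \<noteq> 0} \<subseteq> unit_I}"

definition is_weak_deriv :: "(real \<Rightarrow> real) \<Rightarrow> (real \<Rightarrow> real) \<Rightarrow> bool" where
  "is_weak_deriv v g \<longleftrightarrow> g \<in> L2_I \<and>
     (\<forall>\<phi>\<in>test_functions.
        (LINT x:unit_I|lebesgue. v x * deriv \<phi> x) = - (LINT x:unit_I|lebesgue. g x * \<phi> x))"

text \<open>
  Elements of \<open>H\<^sup>1(0,1)\<close> are represented by their continuous representatives on \<open>[0,1]\<close>, so that
  boundary values are point values; the values outside \<open>[0,1]\<close> are irrelevant.
\<close>

definition H1_I :: "(real \<Rightarrow> real) set" where
  "H1_I = {v \<in> L2_I. continuous_on {0..1} v \<and> (\<exists>g. is_weak_deriv v g)}"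

definition H1_0_I :: "(real \<Rightarrow> real) set" where
  "H1_0_I = {v \<in> H1_I. v 0 = 0 \<and> v 1 = 0}"

text \<open>The weak derivative is unique up to a null set, so no integral below depends on the choice.\<close>

definition weak_deriv :: "(real \<Rightarrow> real) \<Rightarrow> real \<Rightarrow> real" where
  "weak_deriv v = (SOME g. is_weak_deriv v g)"

definition delta_norm :: "real \<Rightarrow> (real \<Rightarrow> real) \<Rightarrow> real" where
  "delta_norm \<delta> v = sqrt (\<delta>\<^sup>2 * (L2_norm_I (weak_deriv v))\<^sup>2 + (L2_norm_I v)\<^sup>2)"

definition weak_solution ::
  "real \<Rightarrow> (real \<Rightarrow> real) \<Rightarrow> (real \<Rightarrow> real) \<Rightarrow> real \<Rightarrow> real \<Rightarrow> (real \<Rightarrow> real) \<Rightarrow> bool" where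
  "weak_solution \<delta> c f \<alpha>0 \<alpha>1 u \<longleftrightarrow>
     u \<in> H1_I \<and> u 0 = \<alpha>0 \<and> u 1 = \<alpha>1 \<and>
     (\<forall>v\<in>H1_0_I.
        (LINT x:unit_I|lebesgue. \<delta>\<^sup>2 * weak_deriv u x * weak_deriv v x)
          + (LINT x:unit_I|lebesgue. c x * u x * v x)
        = (LINT x:unit_I|lebesgue. f x * v x))"


section \<open>Piecewise polynomial spaces\<close>

text \<open>A partition is the strictly increasing list of its points.\<close>

definition pw_poly_space :: "nat \<Rightarrow> real list \<Rightarrow> real \<Rightarrow> real \<Rightarrow> (real \<Rightarrow> real) set" where
  "pw_poly_space p T \<alpha>0 \<alpha>1 =
     {v. continuous_on {0..1} v \<and>
         (\<forall>i. Suc i < length T \<longrightarrow>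
            (\<exists>q :: real poly. degree q \<le> p \<and> (\<forall>x\<in>{T ! i..T ! Suc i}. v x = poly q x))) \<and>
         v 0 = \<alpha>0 \<and> v 1 = \<alpha>1}"

definition T_hp :: "real \<Rightarrow> real list" where
  "T_hp \<kappa> = [0, min (1/4) \<kappa>, 1 - min (1/4) \<kappa>, 1]"

definition mesh_h :: "nat \<Rightarrow> real" where
  "mesh_h L = 1 / (2 ^ L + 1)"

definition T_grid :: "nat \<Rightarrow> real list" where
  "T_grid L = map (\<lambda>j. real j / (2 ^ L + 1)) [0..<2 ^ L + 2]"

definition T_int :: "nat \<Rightarrow> real list" where
  "T_int L = map (\<lambda>j. real j / (2 ^ L + 1)) [1..<2 ^ L + 1]"

text \<open>
  The projection is onto the affine space with boundary values \<open>\<alpha>0\<close>, \<open>\<alpha>1\<close>, tested with the space with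
  zero boundary values. The conditions determine it on \<open>[0,1]\<close>; only its values there matter.
\<close>

definition L2_proj :: "real \<Rightarrow> real \<Rightarrow> nat \<Rightarrow> (real \<Rightarrow> real) \<Rightarrow> real \<Rightarrow> real" where
  "L2_proj \<alpha>0 \<alpha>1 L v =
     (SOME w. w \<in> pw_poly_space 1 (T_grid L) \<alpha>0 \<alpha>1 \<and>
        (\<forall>z\<in>pw_poly_space 1 (T_grid L) 0 0.
           (LINT x:unit_I|lebesgue. (w x - v x) * z x) = 0))"


section \<open>Quantized tensor trains\<close>

text \<open>
  \<open>r j\<close> is the rank \<open>r\<^sub>j\<close> and \<open>V j b\<close> is the slice of the \<open>j\<close>-th core for the bit \<open>b \<in> {0,1}\<close>. The
  binary digits of the index are \<open>d 1, \<dots>, d L\<close>, most significant first. The matrix product is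
  a \<open>1 \<times> 1\<close> matrix.
\<close>

definition is_qtt ::
  "nat \<Rightarrow> (nat \<Rightarrow> real) \<Rightarrow> (nat \<Rightarrow> nat) \<Rightarrow> (nat \<Rightarrow> nat \<Rightarrow> real mat) \<Rightarrow> bool" where
  "is_qtt L w r V \<longleftrightarrow>
     r 0 = 1 \<and> r L = 1 \<and> (\<forall>j\<in>{1..<L}. 1 \<le> r j) \<and>
     (\<forall>j\<in>{1..L}. \<forall>b\<in>{0,1}. V j b \<in> carrier_mat (r (j - 1)) (r j)) \<and>
     (\<forall>d. (\<forall>j\<in>{1..L}. d j \<in> {0,1}) \<longrightarrow>
        w (\<Sum>j=1..L. 2 ^ (L - j) * d j)
          = foldr (\<lambda>j A. V j (d j) * A) [1..<L + 1] (1\<^sub>m 1) $$ (0, 0))"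

definition qtt_params :: "nat \<Rightarrow> (nat \<Rightarrow> nat) \<Rightarrow> nat" where
  "qtt_params L r = (\<Sum>j=1..L. 2 * r (j - 1) * r j)"

definition is_qtt_wrt ::
  "nat \<Rightarrow> real list \<Rightarrow> (real \<Rightarrow> real) \<Rightarrow> (nat \<Rightarrow> nat) \<Rightarrow> (nat \<Rightarrow> nat \<Rightarrow> real mat) \<Rightarrow> bool" where
  "is_qtt_wrt L T g r V \<longleftrightarrow>
     length T = 2 ^ L \<and> sorted_wrt (<) T \<and> is_qtt L (\<lambda>i. g (T ! i)) r V"

end

(*
  Everything is measured in the square E(v) of the energy norm. The weak solution is of class C^2 by the
  lemma of du Bois-Reymond. Let w = f/c be the reduced solution and B a pair of hat functions of width s,
  delta <= s <= 1, correcting the boundary values. Testing the equation with z = u - w - B gives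
  E(z) <= C s.
    If delta <= h, take s = h: then w + B is approximated in V^L by interpolating w, and the error is O(h).
    If h <= delta, take s = delta: this bounds the L2 norm of u - w, hence that of u'' = c (u - w) / delta^2
    by C delta^(-3/2), and nodal interpolation of u has error E = O(h^2 / delta).
  The L2 projection is stable in E (compare with the nodal interpolant, use the inverse estimate), so the
  projection of u_{delta,L} inherits these bounds up to the error of u_{delta,L}.

  The nodal values of the projection satisfy (X^2 + 4X + 1) y = b with b polynomial of degree <= L in the
  index away from the two breakpoints of the hp mesh, hence a linear recurrence of order L + 3. On dyadic
  blocks without a breakpoint the values therefore lie in the shift-invariant span of L + 3 fundamental
  solutions, and the at most two remaining blocks of each level add two more functions: the ranks are L + 5.
*)

theory Submission
  imports Defs
begin

section \<open>Bounded measurable functions and weak derivatives\<close>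

text \<open>Every function in the argument is handled as a pair \<open>has_bdd_deriv w w'\<close>;
  weak derivatives occur only where the given solution and \<open>delta_norm\<close> enter. No
  asymptotic expansion of the boundary layers is used. A corrector of width s costs
  \<open>\<delta>^2 / s\<close> through its derivative and s through its mass, and for
  \<open>\<delta> \<le> s\<close> both are at most s. This crude bound suffices: the target min(sqrt
  h, h / sqrt \<delta>) is the root of min(h, h^2 / \<delta>), whose branches meet at
  \<open>\<delta> = h\<close>. Hats serve as correctors because at width h they already lie in the
  discrete space. For the ranks the obstacle is that the inverse of the mass matrix is full: the
  projection of a polynomial piece is not polynomial at the nodes, and a breakpoint influences all
  nodal values. What stays local is the three-term equation. Differencing it removes the polynomial
  right-hand side, and the ranks count solutions of the resulting recurrence: order 2 from X^2 + 4X
  + 1, and L + 1 more from the differences.\<close>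

abbreviation I01 :: "(real \<Rightarrow> real) \<Rightarrow> real" where
  "I01 f \<equiv> integral {0..1} f"

abbreviation L2sq :: "(real \<Rightarrow> real) \<Rightarrow> real" where
  "L2sq f \<equiv> I01 (\<lambda>x. (f x)\<^sup>2)"

text \<open>An algebra of integrable functions: products stay inside, so integrability of any
  integrand built from such functions follows by introduction rules alone. Measurability rather than
  continuity is asked because derivatives of piecewise linear functions jump.\<close>

definition bdd_meas :: "(real \<Rightarrow> real) \<Rightarrow> bool" where
  "bdd_meas g \<longleftrightarrow> g \<in> borel_measurable (lebesgue_on {0..1}) \<and> (\<exists>B. \<forall>x\<in>{0..1}. \<bar>g x\<bar> \<le> B)"

lemma bdd_meas_continuous: "continuous_on {0..1} g \<Longrightarrow> bdd_meas g"
proof -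
  assume g: "continuous_on {0..1} g"
  then have "bounded (g ` {0..1})" by (intro compact_imp_bounded compact_continuous_image) auto
  then obtain B where "\<forall>y\<in>g ` {0..1}. norm y \<le> B"
    unfolding bounded_iff by metis
  moreover have "g \<in> borel_measurable (lebesgue_on {0..1})"
    using g by (intro continuous_imp_measurable_on_sets_lebesgue) auto
  ultimately show ?thesis unfolding bdd_meas_def by auto
qed

lemma bdd_meas_const [simp, intro]: "bdd_meas (\<lambda>x. k)"
  by (rule bdd_meas_continuous) auto

lemma bdd_meas_add [intro]: "bdd_meas f \<Longrightarrow> bdd_meas g \<Longrightarrow> bdd_meas (\<lambda>x. f x + g x)"
  unfolding bdd_meas_def
  apply (intro conjI borel_measurable_add, simp_all, elim conjE exE)
  subgoal for B C by (rule exI[of _ "B + C"]) (auto intro!: order_trans[OF abs_triangle_ineq] add_mono)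
  done

lemma bdd_meas_mult [intro]: "bdd_meas f \<Longrightarrow> bdd_meas g \<Longrightarrow> bdd_meas (\<lambda>x. f x * g x)"
  unfolding bdd_meas_def
  apply (intro conjI borel_measurable_times, simp_all, elim conjE exE)
  subgoal for B C
    by (rule exI[of _ "B * C"], intro ballI, unfold abs_mult, rule mult_mono)
       (auto intro: order_trans[OF abs_ge_zero])
  done

lemma bdd_meas_cmult: "bdd_meas f \<Longrightarrow> bdd_meas (\<lambda>x. k * f x)"
  by (intro bdd_meas_mult bdd_meas_const)

lemma bdd_meas_uminus [intro]: "bdd_meas f \<Longrightarrow> bdd_meas (\<lambda>x. - f x)"
  using bdd_meas_cmult[of f "-1"] by simp

lemma bdd_meas_diff [intro]: "bdd_meas f \<Longrightarrow> bdd_meas g \<Longrightarrow> bdd_meas (\<lambda>x. f x - g x)"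
  using bdd_meas_add[of f "\<lambda>x. - g x"] bdd_meas_uminus[of g] by simp

lemma bdd_meas_power2 [intro]: "bdd_meas f \<Longrightarrow> bdd_meas (\<lambda>x. (f x)\<^sup>2)"
  using bdd_meas_mult[of f f] by (simp add: power2_eq_square)

lemma bdd_meas_abs_integrable:
  assumes "bdd_meas g" shows "g absolutely_integrable_on {0..1}"
proof -
  obtain B where "\<forall>x\<in>{0..1}. \<bar>g x\<bar> \<le> B" using assms unfolding bdd_meas_def by blast
  then show ?thesis
    using assms unfolding bdd_meas_def
    by (intro measurable_bounded_by_integrable_imp_absolutely_integrable[where g="\<lambda>x. B"]) auto
qed

lemma bdd_meas_integrable:
  assumes "bdd_meas g" "0 \<le> a" "b \<le> 1" shows "g integrable_on {a..b}"
proof (rule integrable_on_subinterval)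
  show "g integrable_on {0..1}"
    by (rule set_lebesgue_integral_eq_integral(1)[OF bdd_meas_abs_integrable[OF assms(1)]])
qed (use assms in auto)

lemma abs_integrable_Ioo:
  assumes "g absolutely_integrable_on {0..1::real}" shows "(g :: real \<Rightarrow> real) absolutely_integrable_on unit_I"
  using assms by (rule set_integrable_subset) auto

lemma abs_integrable_integrable_Icc:
  "(g :: real \<Rightarrow> real) absolutely_integrable_on unit_I \<Longrightarrow> g integrable_on {0..1}"
  using set_lebesgue_integral_eq_integral(1)[of unit_I g] by (simp add: integrable_on_Icc_iff_Ioo)

text \<open>The definitions use Lebesgue integrals over the open interval, the estimates gauge
  integrals over the closed one; the endpoints form a null set.\<close>

lemma lint_eq_integral:
  fixes g :: "real \<Rightarrow> real"
  assumes "g absolutely_integrable_on unit_I"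
  shows "(LINT x:unit_I|lebesgue. g x) = I01 g"
  using set_lebesgue_integral_eq_integral(2)[OF assms] by (simp add: integral_open_interval_real)

lemma bdd_meas_lint: "bdd_meas g \<Longrightarrow> (LINT x:unit_I|lebesgue. g x) = I01 g"
  by (intro lint_eq_integral abs_integrable_Ioo bdd_meas_abs_integrable)

lemma abs_integrable_measurable_Ioo:
  fixes g :: "real \<Rightarrow> real"
  assumes "g absolutely_integrable_on unit_I"
  shows "set_borel_measurable lebesgue unit_I g"
  using assms unfolding set_integrable_def set_borel_measurable_def by auto

lemma bdd_meas_L2: assumes "bdd_meas g" shows "g \<in> L2_I"
  unfolding L2_I_def using assms
  by (auto intro!: abs_integrable_Ioo bdd_meas_abs_integrable abs_integrable_measurable_Ioo)

lemma L2_abs_integrable: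
  assumes "g \<in> L2_I" shows "g absolutely_integrable_on unit_I"
proof -
  have m: "set_borel_measurable lebesgue unit_I g" and i: "set_integrable lebesgue unit_I (\<lambda>x. (g x)\<^sup>2)"
    using assms unfolding L2_I_def by auto
  have one: "set_integrable lebesgue unit_I (\<lambda>x. 1::real)"
    by (intro abs_integrable_Ioo bdd_meas_abs_integrable) auto
  have "set_integrable lebesgue unit_I (\<lambda>x. 1 + (g x)\<^sup>2)"
    using one i by (rule set_integral_add)
  moreover have "norm (g x) \<le> norm (1 + (g x)\<^sup>2)" for x
  proof -
    \<comment> \<open>This is \<open>2 * \<bar>g x\<bar> \<le> 1 + (g x)^2\<close>, the reason why
      L2 is contained in L1 on a set of finite measure.\<close>
    have "0 \<le> (\<bar>g x\<bar> - 1)\<^sup>2" "0 \<le> (g x)\<^sup>2" by simp_all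
    then show ?thesis by (simp add: power2_diff)
  qed
  then have "AE x in lebesgue. x \<in> unit_I \<longrightarrow> norm (g x) \<le> norm (1 + (g x)\<^sup>2)"
    by (intro AE_I2 impI)
  ultimately show ?thesis
    by (rule set_integrable_bound[OF _ m])
qed

text \<open>The weak derivative of the given solution is merely in L2, so it is not known to be in
  \<open>bdd_meas\<close>; its products with test functions are covered here.\<close>

lemma abs_integrable_mult_bdd_meas:
  fixes g :: "real \<Rightarrow> real"
  assumes "g absolutely_integrable_on unit_I" "bdd_meas f"
  shows "(\<lambda>x. g x * f x) absolutely_integrable_on unit_I"
proof -
  have f: "f \<in> borel_measurable (lebesgue_on unit_I)"
    by (rule absolutely_integrable_imp_borel_measurable[OF abs_integrable_Ioo[OF bdd_meas_abs_integrable[OF assms(2)]]]) auto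
  have "bounded (f ` unit_I)"
    using assms(2) unfolding bdd_meas_def bounded_iff
    by (metis (no_types, lifting) atLeastAtMost_iff greaterThanLessThan_iff imageE less_imp_le real_norm_def)
  then have "(\<lambda>x. f x * g x) absolutely_integrable_on unit_I"
    using f assms by (intro absolutely_integrable_bounded_measurable_product_real) auto
  then show ?thesis by (simp add: mult.commute)
qed

text \<open>The explicit derivative \<open>w'\<close> replaces the choice made by
  \<open>weak_deriv\<close>. Its values at the finitely many exceptional points are arbitrary;
  continuity of \<open>w\<close> keeps the fundamental theorem of calculus valid across
  them.\<close>

definition has_bdd_deriv :: "(real \<Rightarrow> real) \<Rightarrow> (real \<Rightarrow> real) \<Rightarrow> bool" where
  "has_bdd_deriv w w' \<longleftrightarrow> continuous_on {0..1} w \<and> bdd_meas w' \<and>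
     (\<exists>S. finite S \<and> (\<forall>x\<in>{0<..<1} - S. (w has_real_derivative w' x) (at x)))"

lemma has_bdd_derivD: 
  assumes "has_bdd_deriv w w'"
  shows "continuous_on {0..1} w" "bdd_meas w'" "bdd_meas w"
  using assms bdd_meas_continuous unfolding has_bdd_deriv_def by auto

lemma has_bdd_deriv_add:
  assumes "has_bdd_deriv v v'" "has_bdd_deriv w w'"
  shows "has_bdd_deriv (\<lambda>x. v x + w x) (\<lambda>x. v' x + w' x)"
proof -
  obtain S T where "finite S" "\<forall>x\<in>{0<..<1} - S. (v has_real_derivative v' x) (at x)"
    "finite T" "\<forall>x\<in>{0<..<1} - T. (w has_real_derivative w' x) (at x)"
    using assms unfolding has_bdd_deriv_def by blast
  then have "\<exists>S. finite S \<and> (\<forall>x\<in>{0<..<1} - S. ((\<lambda>x. v x + w x) has_real_derivative v' x + w' x) (at x))"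
    by (intro exI[of _ "S \<union> T"]) (auto intro!: DERIV_add)
  then show ?thesis
    using assms unfolding has_bdd_deriv_def by (auto intro!: continuous_intros)
qed

lemma has_bdd_deriv_mult:
  assumes "has_bdd_deriv v v'" "has_bdd_deriv w w'"
  shows "has_bdd_deriv (\<lambda>x. v x * w x) (\<lambda>x. v' x * w x + w' x * v x)"
proof -
  obtain S T where "finite S" "\<forall>x\<in>{0<..<1} - S. (v has_real_derivative v' x) (at x)"
    "finite T" "\<forall>x\<in>{0<..<1} - T. (w has_real_derivative w' x) (at x)"
    using assms unfolding has_bdd_deriv_def by blast
  then have "\<exists>S. finite S \<and> (\<forall>x\<in>{0<..<1} - S. ((\<lambda>x. v x * w x) has_real_derivative v' x * w x + w' x * v x) (at x))"
    by (intro exI[of _ "S \<union> T"]) (auto intro!: DERIV_mult)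
  then show ?thesis
    using assms has_bdd_derivD[OF assms(1)] has_bdd_derivD[OF assms(2)]
    unfolding has_bdd_deriv_def by (auto intro!: continuous_intros)
qed

lemma has_bdd_deriv_const: "has_bdd_deriv (\<lambda>x. k) (\<lambda>x. 0)"
  unfolding has_bdd_deriv_def by (auto intro!: exI[of _ "{}"])

lemma has_bdd_deriv_cmult:
  assumes "has_bdd_deriv v v'"
  shows "has_bdd_deriv (\<lambda>x. k * v x) (\<lambda>x. k * v' x)"
  using has_bdd_deriv_mult[OF has_bdd_deriv_const[of k] assms] by (simp add: mult.commute)

lemma has_bdd_deriv_diff:
  assumes "has_bdd_deriv v v'" "has_bdd_deriv w w'"
  shows "has_bdd_deriv (\<lambda>x. v x - w x) (\<lambda>x. v' x - w' x)"
  using has_bdd_deriv_add[OF assms(1) has_bdd_deriv_cmult[OF assms(2), of "-1"]] by simp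

lemma has_bdd_deriv_sum:
  assumes "\<And>i. i \<in> A \<Longrightarrow> has_bdd_deriv (v i) (v' i)"
  shows "has_bdd_deriv (\<lambda>x. \<Sum>i\<in>A. v i x) (\<lambda>x. \<Sum>i\<in>A. v' i x)"
  using assms
  by (induction A rule: infinite_finite_induct) (auto intro: has_bdd_deriv_const has_bdd_deriv_add)

lemma has_bdd_deriv_FTC:
  assumes "has_bdd_deriv w w'" "0 \<le> a" "a \<le> b" "b \<le> 1"
  shows "(w' has_integral (w b - w a)) {a..b}"
proof -
  obtain S where S: "finite S" "\<forall>x\<in>{0<..<1} - S. (w has_real_derivative w' x) (at x)"
    using assms(1) unfolding has_bdd_deriv_def by blast
  show ?thesis
  proof (rule fundamental_theorem_of_calculus_interior_strong[OF S(1) assms(3)])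
    show "continuous_on {a..b} w"
      using assms unfolding has_bdd_deriv_def by (auto intro: continuous_on_subset)
    show "(w has_vector_derivative w' x) (at x)" if "x \<in> {a<..<b} - S" for x
      using that S(2) assms by (auto simp: has_real_derivative_iff_has_vector_derivative)
  qed
qed

lemmas bdd_meas_intros = bdd_meas_const bdd_meas_add bdd_meas_diff bdd_meas_mult bdd_meas_power2 bdd_meas_uminus

lemma bdd_meas_integrable': "bdd_meas g \<Longrightarrow> g integrable_on {0..1}"
  by (rule bdd_meas_integrable) auto

lemma integration_by_parts_bdd_deriv:
  assumes v: "has_bdd_deriv v v'" and w: "has_bdd_deriv w w'"
  shows "I01 (\<lambda>x. v' x * w x) + I01 (\<lambda>x. w' x * v x) = v 1 * w 1 - v 0 * w 0"
proof -
  have "((\<lambda>x. v' x * w x + w' x * v x) has_integral v 1 * w 1 - v 0 * w 0) {0..1}"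
    by (rule has_bdd_deriv_FTC[OF has_bdd_deriv_mult[OF v w]]) auto
  moreover have "I01 (\<lambda>x. v' x * w x + w' x * v x)
      = I01 (\<lambda>x. v' x * w x) + I01 (\<lambda>x. w' x * v x)"
    by (intro Henstock_Kurzweil_Integration.integral_add bdd_meas_integrable' bdd_meas_intros
        has_bdd_derivD[OF v] has_bdd_derivD[OF w])
  ultimately show ?thesis by (simp add: integral_unique)
qed

lemma has_bdd_deriv_C1:
  assumes "\<And>x. x \<in> {0<..<1} \<Longrightarrow> (w has_real_derivative w' x) (at x)"
    "continuous_on {0..1} w" "continuous_on {0..1} w'"
  shows "has_bdd_deriv w w'"
  using assms bdd_meas_continuous unfolding has_bdd_deriv_def by (auto intro!: exI[of _ "{}"])

section \<open>Test functions and vanishing almost everywhere\<close>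

lemma test_functionI:
  assumes d: "\<And>x. (\<phi> has_real_derivative \<phi>' x) (at x)" and c: "continuous_on UNIV \<phi>'"
    and z: "\<And>x. x \<notin> {s..t} \<Longrightarrow> \<phi> x = 0" and st: "0 < s" "t < 1"
  shows "\<phi> \<in> test_functions"
proof -
  have "{x. \<phi> x \<noteq> 0} \<subseteq> {s..t}" using z by blast
  then have cl: "closure {x. \<phi> x \<noteq> 0} \<subseteq> {s..t}" by (intro closure_minimal) auto
  then have "compact (closure {x. \<phi> x \<noteq> 0})"
    by (metis bounded_closed_interval bounded_subset closed_closure compact_eq_bounded_closed)
  moreover have "\<phi> C1_differentiable_on UNIV"
    unfolding C1_differentiable_on_def using d c
    by (auto simp: has_real_derivative_iff_has_vector_derivative)
  ultimately show ?thesis using cl st unfolding test_functions_def by force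
qed

lemma test_functionD:
  assumes "\<phi> \<in> test_functions"
  shows "(\<phi> has_real_derivative deriv \<phi> x) (at x)" "continuous_on UNIV (deriv \<phi>)"
proof -
  obtain D where D: "\<forall>x. (\<phi> has_vector_derivative D x) (at x)" "continuous_on UNIV D"
    using assms unfolding test_functions_def C1_differentiable_on_def by blast
  then have "(\<phi> has_real_derivative D x) (at x)" for x
    by (auto simp: has_real_derivative_iff_has_vector_derivative)
  then have "deriv \<phi> = D" by (auto intro: DERIV_imp_deriv)
  then show "(\<phi> has_real_derivative deriv \<phi> x) (at x)" "continuous_on UNIV (deriv \<phi>)"
    using D by (auto simp: has_real_derivative_iff_has_vector_derivative)
qed

lemma test_function_support:
  assumes "\<phi> \<in> test_functions"
  obtains s t where "0 < s" "s \<le> t" "t < 1" "\<And>x. x \<notin> {s..t} \<Longrightarrow> \<phi> x = 0"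
proof -
  let ?K = "closure {x. \<phi> x \<noteq> 0}"
  have K: "compact ?K" "?K \<subseteq> unit_I"
    using assms unfolding test_functions_def by simp_all
  have nz: "x \<in> ?K" if "\<phi> x \<noteq> 0" for x
    using that closure_subset[of "{x. \<phi> x \<noteq> 0}"] by auto
  show thesis
  proof (cases "?K = {}")
    case True
    then have "\<phi> x = 0" for x using nz[of x] by auto
    then show ?thesis by (intro that[of "1/2" "1/2"]) auto
  next
    case False
    obtain s where s: "s \<in> ?K" "\<forall>x\<in>?K. s \<le> x" using compact_attains_inf[OF K(1) False] by blast
    obtain t where t: "t \<in> ?K" "\<forall>x\<in>?K. x \<le> t" using compact_attains_sup[OF K(1) False] by blast
    show ?thesis
    proof (rule that[of s t])
      show "\<phi> x = 0" if "x \<notin> {s..t}" for x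
        using that s(2) t(2) nz[of x] by (meson atLeastAtMost_iff)
      show "0 < s" using s(1) K(2) by (meson greaterThanLessThan_iff subsetD)
      show "t < 1" using t(1) K(2) by (meson greaterThanLessThan_iff subsetD)
      show "s \<le> t" using s t by meson
    qed
  qed
qed

lemma test_function_bdd_deriv:
  assumes "\<phi> \<in> test_functions"
  shows "has_bdd_deriv \<phi> (deriv \<phi>)" "\<phi> 0 = 0" "\<phi> 1 = 0"
proof -
  show "has_bdd_deriv \<phi> (deriv \<phi>)"
  proof (rule has_bdd_deriv_C1)
    show "continuous_on {0..1} \<phi>"
      using test_functionD(1)[OF assms] by (meson DERIV_isCont continuous_at_imp_continuous_on)
    show "continuous_on {0..1} (deriv \<phi>)"
      using test_functionD(2)[OF assms] by (rule continuous_on_subset) auto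
  qed (rule test_functionD(1)[OF assms])
  obtain s t where "0 < s" "s \<le> t" "t < 1" "\<And>x. x \<notin> {s..t} \<Longrightarrow> \<phi> x = 0"
    using test_function_support[OF assms] by blast
  then show "\<phi> 0 = 0" "\<phi> 1 = 0" by auto
qed

lemma is_weak_deriv_bdd_deriv:
  assumes "has_bdd_deriv w w'" shows "is_weak_deriv w w'"
  unfolding is_weak_deriv_def
proof (intro conjI ballI)
  note w = has_bdd_derivD[OF assms]
  show "w' \<in> L2_I" using w by (intro bdd_meas_L2)
  fix \<phi> assume \<phi>: "\<phi> \<in> test_functions"
  note p = test_function_bdd_deriv[OF \<phi>]
  note p' = has_bdd_derivD[OF p(1)]
  have "I01 (\<lambda>x. w x * deriv \<phi> x) = - I01 (\<lambda>x. w' x * \<phi> x)"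
    using integration_by_parts_bdd_deriv[OF assms p(1)] p(2,3) by (simp add: mult.commute)
  then show "(LINT x:unit_I|lebesgue. w x * deriv \<phi> x) = - (LINT x:unit_I|lebesgue. w' x * \<phi> x)"
    by (simp add: bdd_meas_lint[OF bdd_meas_mult] w p')
qed

lemma has_bdd_deriv_H1: "has_bdd_deriv w w' \<Longrightarrow> w \<in> H1_I"
  unfolding H1_I_def using is_weak_deriv_bdd_deriv has_bdd_derivD bdd_meas_L2 by blast


text \<open>Lebesgue differentiation: outside a null set \<open>h x\<close> is the limit of the
  averages of \<open>h\<close> over short intervals to the right of \<open>x\<close>, and these
  averages are zero.\<close>

lemma null_of_integral_Icc_zero:
  fixes h :: "real \<Rightarrow> real"
  assumes h: "h absolutely_integrable_on unit_I"
    and z: "\<And>a b. 0 < a \<Longrightarrow> a < b \<Longrightarrow> b < 1 \<Longrightarrow> integral {a..b} h = 0"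
  shows "\<exists>N. negligible N \<and> (\<forall>x\<in>unit_I - N. h x = 0)"
proof -
  \<comment> \<open>Extension by zero, since the differentiation theorem wants integrability on
    every interval of the line.\<close>
  define f where "f x = (if x \<in> unit_I then h x else 0)" for x
  have "h integrable_on unit_I" using h by (rule set_lebesgue_integral_eq_integral(1))
  then have "f integrable_on UNIV" unfolding f_def by (subst integrable_restrict_UNIV)
  then have "f integrable_on cbox a b" for a b by (rule integrable_on_subcbox) simp
  note int = this
  obtain N where N: "negligible N"
    "\<And>x e. \<lbrakk>x \<notin> N; 0 < e\<rbrakk> \<Longrightarrow> \<exists>d>0. \<forall>h. 0 < h \<and> h < d \<longrightarrow>
        norm (integral (cbox x (x + h *\<^sub>R One)) f /\<^sub>R h ^ DIM(real) - f x) < e"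
    using integrable_ccontinuous_explicit[of f, OF int] by blast
  have "h x = 0" if x: "x \<in> unit_I - N" for x
  proof (rule ccontr)
    assume "h x \<noteq> 0"
    then obtain d where d: "d > 0" "\<And>k. 0 < k \<Longrightarrow> k < d \<Longrightarrow>
        norm (integral (cbox x (x + k *\<^sub>R One)) f /\<^sub>R k ^ DIM(real) - f x) < \<bar>h x\<bar>"
      using N(2)[of x "\<bar>h x\<bar>"] x by auto
    define k where "k = min (d/2) ((1 - x)/2)"
    have k: "0 < k" "k < d" "x + k < 1" using d(1) x by (auto simp: k_def min_def field_simps)
    have "integral {x..x + k} f = integral {x..x + k} h"
      using x k by (intro integral_cong) (auto simp: f_def)
    also have "\<dots> = 0" using x k by (intro z) auto
    finally show False using d(2)[OF k(1,2)] x by (simp add: f_def)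
  qed
  then show ?thesis using N(1) by blast
qed

text \<open>The \<open>C\<^sup>1\<close> plateau functions \<open>ramp (n (x - a) - 1) * ramp (n (b - x) - 1)\<close> increase to the indicator of \<open>(a,b)\<close>.\<close>

definition ramp :: "real \<Rightarrow> real" where
  "ramp t = (max 0 t)\<^sup>2 / (1 + (max 0 t)\<^sup>2)"

lemma DERIV_max0_square: "((\<lambda>t::real. (max 0 t)\<^sup>2) has_real_derivative 2 * max 0 t) (at t)"
proof (cases "t = 0")
  case True
  have "((\<lambda>h::real. (max 0 h)\<^sup>2 / h) \<longlongrightarrow> 0) (at 0)"
  proof (rule tendsto_rabs_zero_cancel, rule tendsto_sandwich[of "\<lambda>_. 0" _ _ "\<lambda>h. \<bar>h\<bar>"])
    have "\<bar>(max 0 h)\<^sup>2 / h\<bar> \<le> \<bar>h\<bar>" for h :: real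
      by (cases "h > 0") (simp_all add: max_def power2_eq_square)
    then show "\<forall>\<^sub>F h in at (0::real). \<bar>(max 0 h)\<^sup>2 / h\<bar> \<le> \<bar>h\<bar>" by simp
    show "((\<lambda>h::real. \<bar>h\<bar>) \<longlongrightarrow> 0) (at 0)" by (rule tendsto_rabs_zero) (rule tendsto_ident_at)
  qed simp_all
  then show ?thesis by (simp add: True DERIV_def)
next
  case False
  show ?thesis
  proof (cases "t > 0")
    case True
    have "((\<lambda>t::real. t\<^sup>2) has_real_derivative 2 * max 0 t) (at t)"
      using True by (auto intro!: derivative_eq_intros)
    then show ?thesis
      by (rule has_field_derivative_transform_within_open[where S="{0<..}"]) (use True in auto)
  next
    case neg: False
    have "((\<lambda>t::real. 0) has_real_derivative 2 * max 0 t) (at t)"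
      using False neg by (auto intro!: derivative_eq_intros)
    then show ?thesis
      by (rule has_field_derivative_transform_within_open[where S="{..<0}"]) (use False neg in auto)
  qed
qed

lemma one_plus_square_nz: "1 + (a::real)\<^sup>2 \<noteq> 0"
  by (smt (verit) zero_le_power2)

lemma DERIV_ramp:
  "(ramp has_real_derivative 2 * max 0 t / (1 + (max 0 t)\<^sup>2)\<^sup>2) (at t)"
proof -
  have "((\<lambda>t. (max 0 t)\<^sup>2 / (1 + (max 0 t)\<^sup>2)) has_real_derivative
      (2 * max 0 t * (1 + (max 0 t)\<^sup>2) - (max 0 t)\<^sup>2 * (0 + 2 * max 0 t))
        / ((1 + (max 0 t)\<^sup>2) * (1 + (max 0 t)\<^sup>2))) (at t)"
    by (intro DERIV_divide DERIV_add DERIV_const DERIV_max0_square one_plus_square_nz)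
  then show ?thesis
    unfolding ramp_def[abs_def] by (simp add: algebra_simps power2_eq_square)
qed

lemma continuous_ramp: "continuous_on S ramp"
  using DERIV_ramp by (meson DERIV_isCont continuous_at_imp_continuous_on)

lemma ramp_bounds: "0 \<le> ramp t" "ramp t \<le> 1"
proof -
  have "0 < 1 + (max 0 t)\<^sup>2" by (intro add_pos_nonneg) auto
  then show "0 \<le> ramp t" "ramp t \<le> 1" by (auto simp: ramp_def)
qed

lemma ramp_nonpos: "t \<le> 0 \<Longrightarrow> ramp t = 0"
  by (simp add: ramp_def max_def)

lemma ramp_limit: "(ramp \<longlongrightarrow> 1) at_top"
proof -
  have "filterlim (\<lambda>t::real. 1 + t\<^sup>2) at_infinity at_top"
    by (intro filterlim_at_top_imp_at_infinity filterlim_tendsto_add_at_top[OF tendsto_const] filterlim_pow_at_top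
        filterlim_ident) simp
  then have "((\<lambda>t::real. 1 - 1 / (1 + t\<^sup>2)) \<longlongrightarrow> 1 - 0) at_top"
    by (intro tendsto_diff tendsto_const tendsto_divide_0[OF tendsto_const])
  moreover have "\<forall>\<^sub>F t in at_top. 1 - 1 / (1 + t\<^sup>2) = ramp t"
    using eventually_gt_at_top[of 0]
  proof eventually_elim
    case (elim t)
    then show ?case using one_plus_square_nz[of t] by (simp add: ramp_def max_def field_simps)
  qed
  ultimately show ?thesis by (simp add: tendsto_cong)
qed

definition plateau :: "real \<Rightarrow> real \<Rightarrow> nat \<Rightarrow> real \<Rightarrow> real" where
  "plateau a b n x = ramp (real (Suc n) * (x - a) - 1) * ramp (real (Suc n) * (b - x) - 1)"

lemma plateau_bounds: "0 \<le> plateau a b n x" "plateau a b n x \<le> 1"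
  unfolding plateau_def using ramp_bounds by (auto intro!: mult_le_one)

text \<open>The \<open>- 1\<close> in the arguments of \<open>ramp\<close> keeps the support at
  distance \<open>1 / real (Suc n)\<close> from \<open>a\<close> and \<open>b\<close>, so that it is
  compact in (0,1) even for \<open>a = 0\<close> and \<open>b = 1\<close>.\<close>

lemma plateau_outside:
  assumes "x \<notin> {a + 1 / real (Suc n)..b - 1 / real (Suc n)}"
  shows "plateau a b n x = 0"
proof -
  have "x < a + 1 / real (Suc n) \<or> b - 1 / real (Suc n) < x" using assms by auto
  then have "real (Suc n) * (x - a) - 1 \<le> 0 \<or> real (Suc n) * (b - x) - 1 \<le> 0"
    by (auto simp: field_simps)
  then show ?thesis unfolding plateau_def using ramp_nonpos by auto
qed

lemma plateau_test:
  assumes "0 \<le> a" "b \<le> 1"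
  shows "plateau a b n \<in> test_functions"
proof -
  let ?N = "real (Suc n)"
  define r' where "r' t = 2 * max 0 t / (1 + (max 0 t)\<^sup>2)\<^sup>2" for t :: real
  have r'c: "continuous_on UNIV r'"
    unfolding r'_def by (intro continuous_intros) (simp add: one_plus_square_nz)
  have r': "(ramp has_real_derivative r' t) (at t)" for t unfolding r'_def by (rule DERIV_ramp)
  have c: "continuous_on UNIV (\<lambda>x. r' (?N * (x - a) - 1))" "continuous_on UNIV (\<lambda>x. r' (?N * (b - x) - 1))"
    "continuous_on UNIV (\<lambda>x. ramp (?N * (x - a) - 1))" "continuous_on UNIV (\<lambda>x. ramp (?N * (b - x) - 1))"
    by (rule continuous_on_compose2[OF r'c] continuous_on_compose2[OF continuous_ramp[of UNIV]];
        auto intro!: continuous_intros)+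
  have l: "((\<lambda>x. ramp (?N * (x - a) - 1)) has_real_derivative r' (?N * (x - a) - 1) * ?N) (at x)" for x
    by (rule DERIV_chain2[OF r']) (auto intro!: derivative_eq_intros)
  have r: "((\<lambda>x. ramp (?N * (b - x) - 1)) has_real_derivative r' (?N * (b - x) - 1) * (- ?N)) (at x)" for x
    by (rule DERIV_chain2[OF r']) (auto intro!: derivative_eq_intros)
  show ?thesis
  proof (rule test_functionI)
    show "(plateau a b n has_real_derivative
       (r' (?N * (x - a) - 1) * ?N) * ramp (?N * (b - x) - 1)
        + (r' (?N * (b - x) - 1) * (- ?N)) * ramp (?N * (x - a) - 1)) (at x)" for x
      unfolding plateau_def[abs_def] by (rule DERIV_mult[OF l r])
    show "continuous_on UNIV (\<lambda>x. (r' (?N * (x - a) - 1) * ?N) * ramp (?N * (b - x) - 1)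
        + (r' (?N * (b - x) - 1) * (- ?N)) * ramp (?N * (x - a) - 1))"
      by (intro continuous_on_add continuous_on_mult c continuous_on_const)
    show "plateau a b n x = 0" if "x \<notin> {a + 1 / ?N..b - 1 / ?N}" for x
      using that by (rule plateau_outside)
    have "0 < 1 / ?N" by simp
    then show "0 < a + 1 / ?N" "b - 1 / ?N < 1" using assms by linarith+
  qed
qed

lemma plateau_limit:
  assumes "a < x" "x < b"
  shows "(\<lambda>n. plateau a b n x) \<longlonglongrightarrow> 1"
proof -
  have lim: "(\<lambda>n. ramp (real (Suc n) * d - 1)) \<longlonglongrightarrow> 1" if "d > 0" for d
  proof (rule filterlim_compose[OF ramp_limit])
    have "filterlim (\<lambda>n. real n) at_top sequentially" by (rule filterlim_real_sequentially)
    then have "filterlim (\<lambda>n. real (Suc n)) at_top sequentially"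
      by (subst filterlim_sequentially_Suc)
    then have "filterlim (\<lambda>n. d * real (Suc n)) at_top sequentially"
      by (rule filterlim_tendsto_pos_mult_at_top[OF tendsto_const that])
    then have "filterlim (\<lambda>n. -1 + d * real (Suc n)) at_top sequentially"
      by (rule filterlim_tendsto_add_at_top[OF tendsto_const])
    then show "filterlim (\<lambda>n. real (Suc n) * d - 1) at_top sequentially"
      by (simp add: algebra_simps)
  qed
  have "(\<lambda>n. plateau a b n x) \<longlonglongrightarrow> 1 * 1"
    unfolding plateau_def using assms by (intro tendsto_mult lim) auto
  then show ?thesis by simp
qed

lemma test_function_bdd_meas: "\<phi> \<in> test_functions \<Longrightarrow> bdd_meas \<phi>"
  using test_function_bdd_deriv has_bdd_derivD(3) by meson

text \<open>Plateau functions are bounded by 1 and tend to the indicator of (a,b), so dominated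
  convergence with majorant \<open>\<bar>h x\<bar>\<close> turns orthogonality to test functions
  into vanishing integrals over intervals.\<close>

lemma null_of_test_functions:
  fixes h :: "real \<Rightarrow> real"
  assumes h: "h absolutely_integrable_on unit_I"
    and z: "\<And>\<phi>. \<phi> \<in> test_functions \<Longrightarrow> (LINT x:unit_I|lebesgue. h x * \<phi> x) = 0"
  shows "\<exists>N. negligible N \<and> (\<forall>x\<in>unit_I - N. h x = 0)"
proof (rule null_of_integral_Icc_zero[OF h])
  fix a b :: real assume ab: "0 < a" "a < b" "b < 1"
  let ?g = "\<lambda>x. if x \<in> {a<..<b} then h x else 0"
  have i: "(\<lambda>x. h x * plateau a b n x) absolutely_integrable_on unit_I" for n
    using ab by (intro abs_integrable_mult_bdd_meas h test_function_bdd_meas plateau_test) auto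
  have "integral unit_I (\<lambda>x. h x * plateau a b n x) = 0" for n
    using z[OF plateau_test[of a b n]] ab set_lebesgue_integral_eq_integral(2)[OF i[of n]] by simp
  moreover have "(\<lambda>n. integral unit_I (\<lambda>x. h x * plateau a b n x)) \<longlonglongrightarrow> integral unit_I ?g"
  proof (rule dominated_convergence(2)[where h="\<lambda>x. \<bar>h x\<bar>"])
    show "(\<lambda>x. h x * plateau a b n x) integrable_on unit_I" for n
      by (rule set_lebesgue_integral_eq_integral(1)[OF i])
    show "(\<lambda>x. \<bar>h x\<bar>) integrable_on unit_I"
      using h by (intro set_lebesgue_integral_eq_integral(1) set_integrable_abs)
    show "norm (h x * plateau a b n x) \<le> \<bar>h x\<bar>" for x n
      using plateau_bounds[of a b n x] by (simp add: abs_mult mult_left_le)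
    show "(\<lambda>n. h x * plateau a b n x) \<longlonglongrightarrow> ?g x" for x
    proof (cases "x \<in> {a<..<b}")
      case True
      then have "(\<lambda>n. h x * plateau a b n x) \<longlonglongrightarrow> h x * 1"
        by (intro tendsto_mult tendsto_const plateau_limit) auto
      then show ?thesis using True by simp
    next
      case False
      have "plateau a b n x = 0" for n
      proof (rule plateau_outside)
        have "0 < 1 / real (Suc n)" by simp
        then show "x \<notin> {a + 1 / real (Suc n)..b - 1 / real (Suc n)}"
          using False by (simp only: atLeastAtMost_iff greaterThanLessThan_iff) linarith
      qed
      moreover have "?g x = 0" using False by (rule if_not_P)
      ultimately show ?thesis by (simp only: mult_zero_right tendsto_const)
    qed
  qed
  ultimately have "integral unit_I ?g = 0" by (simp add: LIMSEQ_const_iff)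
  moreover have "integral unit_I ?g = integral {a<..<b} h"
  proof -
    have "integral unit_I ?g = integral ({a<..<b} \<inter> unit_I) h"
      by (subst integral_restrict_Int) (rule refl)
    moreover have "{a<..<b} \<inter> unit_I = {a<..<b}" using ab by auto
    ultimately show ?thesis by simp
  qed
  ultimately show "integral {a..b} h = 0" by (simp add: integral_open_interval_real)
qed

lemma weak_deriv_unique:
  assumes "is_weak_deriv v g" "is_weak_deriv v k"
  shows "\<exists>N. negligible N \<and> (\<forall>x\<in>unit_I - N. g x = k x)"
proof -
  have g: "g absolutely_integrable_on unit_I" and k: "k absolutely_integrable_on unit_I"
    using assms L2_abs_integrable unfolding is_weak_deriv_def by auto
  have "\<exists>N. negligible N \<and> (\<forall>x\<in>unit_I - N. g x - k x = 0)"
  proof (rule null_of_test_functions)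
    show "(\<lambda>x. g x - k x) absolutely_integrable_on unit_I" by (rule set_integral_diff(1)[OF g k])
    fix \<phi> assume \<phi>: "\<phi> \<in> test_functions"
    have "(LINT x:unit_I|lebesgue. g x * \<phi> x) = (LINT x:unit_I|lebesgue. k x * \<phi> x)"
      using assms \<phi> unfolding is_weak_deriv_def by fastforce
    then show "(LINT x:unit_I|lebesgue. (g x - k x) * \<phi> x) = 0"
      using set_integral_diff(2)[OF abs_integrable_mult_bdd_meas[OF g] abs_integrable_mult_bdd_meas[OF k], of \<phi> \<phi>]
        test_function_bdd_meas[OF \<phi>] by (simp add: algebra_simps)
  qed
  then show ?thesis by auto
qed

section \<open>Regularity of weak solutions\<close>

text \<open>Gauge integrals ignore null sets with no measurability condition, so facts that hold
  almost everywhere are transferred in terms of \<open>I01\<close> where possible.\<close>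

lemma integral_eq_if_AE_eq:
  fixes F G :: "real \<Rightarrow> real"
  assumes "negligible N" "\<And>x. x \<in> unit_I - N \<Longrightarrow> F x = G x"
  shows "I01 F = I01 G"
proof (rule integral_spike[of "N \<union> {0,1}"])
  show "negligible (N \<union> {0,1})" using assms(1) by (intro negligible_Un) auto
  show "G x = F x" if "x \<in> {0..1} - (N \<union> {0,1})" for x
    using that assms(2)[of x] by auto
qed

lemma is_weak_deriv_weak_deriv: "is_weak_deriv w g \<Longrightarrow> is_weak_deriv w (weak_deriv w)"
  unfolding weak_deriv_def by (rule someI[where P="is_weak_deriv w"])

text \<open>\<open>weak_deriv\<close> is a choice; uniqueness up to a null set ties it to an
  explicit derivative.\<close>

lemma weak_deriv_AE:
  assumes "has_bdd_deriv w w'"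
  obtains N where "negligible N" "\<And>x. x \<in> unit_I - N \<Longrightarrow> weak_deriv w x = w' x"
proof -
  have "is_weak_deriv w (weak_deriv w)"
    by (rule is_weak_deriv_weak_deriv[OF is_weak_deriv_bdd_deriv[OF assms]])
  then show thesis
    using weak_deriv_unique[OF _ is_weak_deriv_bdd_deriv[OF assms]] that by blast
qed

lemma L2_norm_square:
  assumes "g \<in> L2_I"
  shows "(L2_norm_I g)\<^sup>2 = L2sq g"
proof -
  have i: "(\<lambda>x. (g x)\<^sup>2) absolutely_integrable_on unit_I" using assms unfolding L2_I_def by auto
  have "0 \<le> integral unit_I (\<lambda>x. (g x)\<^sup>2)"
    by (rule integral_nonneg[OF set_lebesgue_integral_eq_integral(1)[OF i]]) simp
  then show ?thesis
    unfolding L2_norm_I_def lint_eq_integral[OF i] by (simp add: integral_open_interval_real)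
qed

definition energy :: "real \<Rightarrow> (real \<Rightarrow> real) \<Rightarrow> (real \<Rightarrow> real) \<Rightarrow> real" where
  "energy \<delta> w w' = \<delta>\<^sup>2 * L2sq w' + L2sq w"

lemma delta_norm_eq:
  assumes "has_bdd_deriv w w'"
  shows "delta_norm \<delta> w = sqrt (energy \<delta> w w')"
proof -
  obtain N where N: "negligible N" "\<And>x. x \<in> unit_I - N \<Longrightarrow> weak_deriv w x = w' x"
    using weak_deriv_AE[OF assms] by blast
  have "is_weak_deriv w (weak_deriv w)"
    by (rule is_weak_deriv_weak_deriv[OF is_weak_deriv_bdd_deriv[OF assms]])
  then have "weak_deriv w \<in> L2_I" unfolding is_weak_deriv_def by blast
  moreover have "w \<in> L2_I" by (rule bdd_meas_L2[OF has_bdd_derivD(3)[OF assms]])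
  moreover have "L2sq (weak_deriv w) = L2sq w'"
    by (rule integral_eq_if_AE_eq[OF N(1)]) (simp add: N(2))
  ultimately show ?thesis unfolding delta_norm_def energy_def by (simp add: L2_norm_square)
qed

text \<open>The primitive from 0 vanishes to the left of the support trivially, and to the right of
  it because the total integral is zero.\<close>

lemma primitive_test_function:
  assumes \<phi>: "\<phi> \<in> test_functions" and z: "I01 \<phi> = 0"
  shows "\<exists>\<psi>\<in>test_functions. deriv \<psi> = \<phi>"
proof -
  obtain s t where st: "0 < s" "s \<le> t" "t < 1" "\<And>x. x \<notin> {s..t} \<Longrightarrow> \<phi> x = 0"
    using test_function_support[OF \<phi>] by blast
  have c: "continuous_on S \<phi>" for S
    using test_functionD(1)[OF \<phi>] by (meson DERIV_isCont continuous_at_imp_continuous_on)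
  have int: "\<phi> integrable_on {a..b}" for a b by (rule integrable_continuous_interval[OF c])
  define \<psi> where "\<psi> x = integral {0..x} \<phi>" for x
  have low: "\<psi> x = 0" if "x < s" for x
  proof -
    have "integral {0..x} \<phi> = integral {0..x} (\<lambda>_. 0)"
      using that st(4) by (intro integral_cong) auto
    then show ?thesis by (simp add: \<psi>_def)
  qed
  have high: "\<psi> x = 0" if "t < x" for x
  proof -
    have zero: "integral {a..b} \<phi> = 0" if "t < a" for a b
    proof -
      have "integral {a..b} \<phi> = integral {a..b} (\<lambda>_. 0)"
        using that st(4) by (intro integral_cong) auto
      then show ?thesis by simp
    qed
    show ?thesis
    proof (cases "x \<le> 1")
      case True
      have "integral {0..x} \<phi> + integral {x..1} \<phi> = I01 \<phi>"
        using that st True by (intro Henstock_Kurzweil_Integration.integral_combine int) auto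
      then show ?thesis using z zero[of x 1] that by (simp add: \<psi>_def)
    next
      case False
      have "I01 \<phi> + integral {1..x} \<phi> = integral {0..x} \<phi>"
        using False by (intro Henstock_Kurzweil_Integration.integral_combine int) auto
      then show ?thesis using z zero[of 1 x] st(3) by (simp add: \<psi>_def)
    qed
  qed
  \<comment> \<open>Differentiating the integral function is available only on intervals that start
    at 0, so points left of the support are treated by comparison with the zero function.\<close>
  have d: "(\<psi> has_real_derivative \<phi> x) (at x)" for x
  proof (cases "x < s")
    case True
    have "((\<lambda>_. 0) has_real_derivative \<phi> x) (at x)" using st(4)[of x] True by simp
    then show ?thesis
      by (rule has_field_derivative_transform_within_open[where S="{..<s}"]) (use True low in auto)
  next
    case False
    then have x: "x \<in> {0<..<x + 1}" using st by auto
    have "(\<psi> has_real_derivative \<phi> x) (at x within {0..x + 1})"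
      unfolding \<psi>_def[abs_def] using x by (intro integral_has_real_derivative c) auto
    then have "(\<psi> has_real_derivative \<phi> x) (at x within {0<..<x + 1})"
      by (rule DERIV_subset) auto
    moreover have "at x within {0<..<x + 1} = at x" using x by (intro at_within_open) auto
    ultimately show ?thesis by (simp only:)
  qed
  have "\<psi> \<in> test_functions"
  proof (rule test_functionI[OF d c _ st(1,3)])
    show "\<psi> x = 0" if "x \<notin> {s..t}" for x
      using that low[of x] high[of x] by (cases "x < s") auto
  qed
  moreover have "deriv \<psi> = \<phi>" using d by (auto intro: DERIV_imp_deriv)
  ultimately show ?thesis by blast
qed

lemma test_functions_diff_cmult:
  assumes "\<phi> \<in> test_functions" "\<eta> \<in> test_functions"
  shows "(\<lambda>x. \<phi> x - k * \<eta> x) \<in> test_functions"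
proof -
  obtain s t where st: "0 < s" "s \<le> t" "t < 1" "\<And>x. x \<notin> {s..t} \<Longrightarrow> \<phi> x = 0"
    using test_function_support[OF assms(1)] by blast
  obtain s' t' where st': "0 < s'" "s' \<le> t'" "t' < 1" "\<And>x. x \<notin> {s'..t'} \<Longrightarrow> \<eta> x = 0"
    using test_function_support[OF assms(2)] by blast
  show ?thesis
  proof (rule test_functionI)
    show "((\<lambda>x. \<phi> x - k * \<eta> x) has_real_derivative deriv \<phi> x - k * deriv \<eta> x) (at x)" for x
      by (intro DERIV_diff DERIV_cmult test_functionD(1) assms)
    show "continuous_on UNIV (\<lambda>x. deriv \<phi> x - k * deriv \<eta> x)"
      by (intro continuous_on_diff continuous_on_mult continuous_on_const test_functionD(2) assms)
    show "\<phi> x - k * \<eta> x = 0" if "x \<notin> {min s s'..max t t'}" for x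
    proof -
      have "x \<notin> {s..t}" "x \<notin> {s'..t'}" using that by auto
      then show ?thesis using st(4) st'(4) by simp
    qed
    show "0 < min s s'" "max t t' < 1" using st st' by auto
  qed
qed

text \<open>The lemma of du Bois-Reymond: subtracting a multiple of a fixed test function of nonzero mean
  turns any test function into the derivative of one.\<close>

lemma const_of_weak_deriv_zero:
  fixes h :: "real \<Rightarrow> real"
  assumes h: "h absolutely_integrable_on unit_I"
    and z: "\<And>\<phi>. \<phi> \<in> test_functions \<Longrightarrow> I01 (\<lambda>x. h x * deriv \<phi> x) = 0"
  shows "\<exists>k N. negligible N \<and> (\<forall>x\<in>unit_I - N. h x = k)"
proof -
  \<comment> \<open>If all test functions had mean zero, the constant 1 would vanish almost
    everywhere.\<close>
  have "\<exists>\<eta>\<in>test_functions. I01 \<eta> \<noteq> 0"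
  proof (rule ccontr)
    assume "\<not> ?thesis"
    then have "(LINT x:unit_I|lebesgue. 1 * \<phi> x) = 0" if "\<phi> \<in> test_functions" for \<phi>
      using that bdd_meas_lint[OF test_function_bdd_meas[OF that]] by simp
    then obtain N where "negligible N" "\<forall>x\<in>unit_I - N. (1::real) = 0"
      using null_of_test_functions[of "\<lambda>_. 1", OF abs_integrable_Ioo[OF bdd_meas_abs_integrable[OF bdd_meas_const]]]
      by blast
    then have "unit_I \<subseteq> N" by auto
    then have "negligible unit_I" by (rule negligible_subset[OF \<open>negligible N\<close>])
    then show False using open_not_negligible[of unit_I] by auto
  qed
  then obtain \<eta> where \<eta>: "\<eta> \<in> test_functions" "I01 \<eta> \<noteq> 0" by blast
  \<comment> \<open>The only possible constant: if \<open>h\<close> equals \<open>k\<close> almost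
    everywhere, integrating against \<open>\<eta>\<close> yields this quotient.\<close>
  define k where "k = I01 (\<lambda>x. h x * \<eta> x) / I01 \<eta>"
  have "\<exists>N. negligible N \<and> (\<forall>x\<in>unit_I - N. h x - k = 0)"
  proof (rule null_of_test_functions)
    show i: "(\<lambda>x. h x - k) absolutely_integrable_on unit_I"
      by (intro set_integral_diff(1) h abs_integrable_Ioo bdd_meas_abs_integrable bdd_meas_const)
    fix \<phi> assume \<phi>: "\<phi> \<in> test_functions"
    have b: "bdd_meas \<phi>" "bdd_meas \<eta>" by (intro test_function_bdd_meas \<phi> \<eta>(1))+
    \<comment> \<open>Chosen so that \<open>\<phi> - m * \<eta>\<close> has mean zero and is
      therefore the derivative of a test function.\<close>
    define m where "m = I01 \<phi> / I01 \<eta>"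
    have "I01 (\<lambda>x. \<phi> x - m * \<eta> x) = I01 \<phi> - m * I01 \<eta>"
      by (subst Henstock_Kurzweil_Integration.integral_diff)
         (intro bdd_meas_integrable' bdd_meas_intros b | simp)+
    also have "\<dots> = 0" using \<eta>(2) by (simp add: m_def)
    finally obtain \<psi> where \<psi>: "\<psi> \<in> test_functions" "deriv \<psi> = (\<lambda>x. \<phi> x - m * \<eta> x)"
      using primitive_test_function[OF test_functions_diff_cmult[OF \<phi> \<eta>(1)]] by blast
    have "0 = I01 (\<lambda>x. h x * \<phi> x - m * (h x * \<eta> x))"
      using z[OF \<psi>(1)] unfolding \<psi>(2) by (simp add: algebra_simps)
    also have "\<dots> = I01 (\<lambda>x. h x * \<phi> x) - m * I01 (\<lambda>x. h x * \<eta> x)"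
      by (subst Henstock_Kurzweil_Integration.integral_diff)
         (intro abs_integrable_integrable_Icc abs_integrable_mult_bdd_meas h b integrable_on_mult_right | simp)+
    also have "m * I01 (\<lambda>x. h x * \<eta> x) = k * I01 \<phi>"
      by (simp add: m_def k_def)
    also have "I01 (\<lambda>x. h x * \<phi> x) - k * I01 \<phi>
        = I01 (\<lambda>x. h x * \<phi> x - k * \<phi> x)"
      by (subst Henstock_Kurzweil_Integration.integral_diff)
         (intro abs_integrable_integrable_Icc abs_integrable_mult_bdd_meas h b bdd_meas_integrable' bdd_meas_intros | simp)+
    also have "\<dots> = (LINT x:unit_I|lebesgue. (h x - k) * \<phi> x)"
      using lint_eq_integral[OF abs_integrable_mult_bdd_meas[OF i b(1)]] by (simp add: algebra_simps)
    finally show "(LINT x:unit_I|lebesgue. (h x - k) * \<phi> x) = 0" by simp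
  qed
  then show ?thesis by auto
qed

lemma has_bdd_deriv_integral:
  assumes "continuous_on {0..1} q"
  shows "has_bdd_deriv (\<lambda>x. integral {0..x} q) q"
    "x \<in> unit_I \<Longrightarrow> ((\<lambda>x. integral {0..x} q) has_real_derivative q x) (at x)"
proof -
  have d: "((\<lambda>x. integral {0..x} q) has_real_derivative q x) (at x within {0..1})" if "x \<in> {0..1}" for x
    by (rule integral_has_real_derivative[OF assms that])
  show *: "((\<lambda>x. integral {0..x} q) has_real_derivative q x) (at x)" if x: "x \<in> unit_I" for x
  proof -
    have "((\<lambda>x. integral {0..x} q) has_real_derivative q x) (at x within unit_I)"
      using d[of x] x by (intro DERIV_subset[OF d]) auto
    moreover have "at x within unit_I = at x" using x by (intro at_within_open) auto
    ultimately show ?thesis by (simp only:)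
  qed
  show "has_bdd_deriv (\<lambda>x. integral {0..x} q) q"
    by (rule has_bdd_deriv_C1[OF * DERIV_continuous_on[OF d] assms])
qed

lemma continuous_eq_of_AE_eq:
  fixes v w :: "real \<Rightarrow> real"
  assumes "continuous_on {0..1} v" "continuous_on {0..1} w" "negligible N"
    "\<And>x. x \<in> unit_I - N \<Longrightarrow> v x = w x" "x \<in> {0..1}"
  shows "v x = w x"
proof -
  have c: "continuous_on {0..1} (\<lambda>x. (v x - w x)\<^sup>2)"
    by (intro continuous_intros assms(1,2))
  have "I01 (\<lambda>x. (v x - w x)\<^sup>2) = I01 (\<lambda>x::real. 0)"
    using assms(3,4) by (intro integral_eq_if_AE_eq[of N]) auto
  then have "\<forall>x\<in>{0..1}. (v x - w x)\<^sup>2 = 0"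
    using integral_eq_0_iff[OF c] by simp
  then show ?thesis using assms(5) by simp
qed

text \<open>Du Bois-Reymond is used twice: on \<open>g - Q\<close> it identifies the weak derivative
  with a continuous \<open>G\<close> almost everywhere, on \<open>u - R\<close> it identifies
  \<open>u\<close> with a primitive of \<open>G\<close>, and continuity then removes the null set.
  Differentiability at every interior point is stated separately because
  \<open>has_bdd_deriv\<close> admits exceptional points and the mean value theorem does
  not.\<close>

lemma weak_solution_classical:
  assumes u: "weak_solution \<delta> c f \<alpha>0 \<alpha>1 u" and \<delta>: "\<delta> > 0"
    and c: "continuous_on {0..1} c" and f: "continuous_on {0..1} f"
  obtains u' where "has_bdd_deriv u u'" "continuous_on {0..1} u'"
    "\<And>x. x \<in> unit_I \<Longrightarrow> (u has_real_derivative u' x) (at x)"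
    "has_bdd_deriv u' (\<lambda>x. (c x * u x - f x) / \<delta>\<^sup>2)"
proof -
  have uc: "continuous_on {0..1} u" and "\<exists>g. is_weak_deriv u g"
    using u unfolding weak_solution_def H1_I_def by auto
  then have g: "is_weak_deriv u (weak_deriv u)" using is_weak_deriv_weak_deriv by blast
  define g where "g = weak_deriv u"
  have ga: "g absolutely_integrable_on unit_I"
    using g L2_abs_integrable unfolding g_def is_weak_deriv_def by auto
  \<comment> \<open>By the equation \<open>q\<close> must be the second derivative of
    \<open>u\<close>, which makes its primitive \<open>Q\<close> the candidate for the first
    derivative up to a constant.\<close>
  define q where "q x = (c x * u x - f x) / \<delta>\<^sup>2" for x
  have qc: "continuous_on {0..1} q" unfolding q_def using \<delta> by (intro continuous_intros c uc f) auto
  define Q where "Q x = integral {0..x} q" for x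
  have Q: "has_bdd_deriv Q q" unfolding Q_def by (rule has_bdd_deriv_integral(1)[OF qc])
  note Qb = has_bdd_derivD[OF Q]
  have "\<exists>k N. negligible N \<and> (\<forall>x\<in>unit_I - N. g x - Q x = k)"
  proof (rule const_of_weak_deriv_zero)
    show "(\<lambda>x. g x - Q x) absolutely_integrable_on unit_I"
      by (intro set_integral_diff(1) ga abs_integrable_Ioo bdd_meas_abs_integrable Qb(3))
    fix \<phi> assume \<phi>: "\<phi> \<in> test_functions"
    note p = test_function_bdd_deriv[OF \<phi>]
    note pb = has_bdd_derivD[OF p(1)]
    have fb: "bdd_meas f" "bdd_meas c" "bdd_meas u" by (intro bdd_meas_continuous f c uc)+
    have "\<phi> \<in> H1_0_I" unfolding H1_0_I_def using has_bdd_deriv_H1[OF p(1)] p by auto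
    then have weak: "(LINT x:unit_I|lebesgue. \<delta>\<^sup>2 * g x * weak_deriv \<phi> x)
          + (LINT x:unit_I|lebesgue. c x * u x * \<phi> x) = (LINT x:unit_I|lebesgue. f x * \<phi> x)"
      using u unfolding weak_solution_def g_def by blast
    obtain N where N: "negligible N" "\<And>x. x \<in> unit_I - N \<Longrightarrow> weak_deriv \<phi> x = deriv \<phi> x"
      using weak_deriv_AE[OF p(1)] by blast
    \<comment> \<open>\<open>weak_deriv \<phi>\<close> is known only almost everywhere, and
      replacing it under the Lebesgue integral requires measurability of both integrands.\<close>
    have "(LINT x:unit_I|lebesgue. \<delta>\<^sup>2 * g x * weak_deriv \<phi> x)
        = (LINT x:unit_I|lebesgue. \<delta>\<^sup>2 * (g x * deriv \<phi> x))"
      unfolding set_lebesgue_integral_def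
    proof (rule integral_cong_AE)
      have wd: "weak_deriv \<phi> \<in> L2_I"
        using is_weak_deriv_weak_deriv[OF is_weak_deriv_bdd_deriv[OF p(1)]]
        unfolding is_weak_deriv_def by blast
      have "N \<in> null_sets lebesgue" using N(1) by (simp add: negligible_iff_null_sets)
      then show "AE x in lebesgue. indicat_real unit_I x *\<^sub>R (\<delta>\<^sup>2 * g x * weak_deriv \<phi> x)
          = indicat_real unit_I x *\<^sub>R (\<delta>\<^sup>2 * (g x * deriv \<phi> x))"
        by (rule AE_I') (use N(2) in \<open>auto simp: indicator_def\<close>)
      have m: "set_borel_measurable lebesgue unit_I (\<lambda>x. k x * l x)"
        if "k absolutely_integrable_on unit_I" "l absolutely_integrable_on unit_I" for k l :: "real \<Rightarrow> real"
      proof -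
        have "(\<lambda>x. (indicator unit_I x *\<^sub>R k x) * (indicator unit_I x *\<^sub>R l x)) \<in> borel_measurable lebesgue"
          using abs_integrable_measurable_Ioo[OF that(1)] abs_integrable_measurable_Ioo[OF that(2)]
          unfolding set_borel_measurable_def by (rule borel_measurable_times)
        moreover have "(\<lambda>x. (indicator unit_I x *\<^sub>R k x) * (indicator unit_I x *\<^sub>R l x))
            = (\<lambda>x. indicator unit_I x *\<^sub>R (k x * l x))"
          by (auto simp: indicator_def)
        ultimately show ?thesis unfolding set_borel_measurable_def by simp
      qed
      have dg: "(\<lambda>x. \<delta>\<^sup>2 * g x) absolutely_integrable_on unit_I"
        using ga by (simp add: set_integrable_mult_right)
      have "set_borel_measurable lebesgue unit_I (\<lambda>x. (\<delta>\<^sup>2 * g x) * weak_deriv \<phi> x)"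
        by (intro m dg L2_abs_integrable wd)
      then show "(\<lambda>x. indicat_real unit_I x *\<^sub>R (\<delta>\<^sup>2 * g x * weak_deriv \<phi> x)) \<in> borel_measurable lebesgue"
        by (simp add: set_borel_measurable_def)
      have "set_borel_measurable lebesgue unit_I (\<lambda>x. (\<delta>\<^sup>2 * g x) * deriv \<phi> x)"
        by (intro m dg abs_integrable_Ioo bdd_meas_abs_integrable pb(2))
      then show "(\<lambda>x. indicat_real unit_I x *\<^sub>R (\<delta>\<^sup>2 * (g x * deriv \<phi> x))) \<in> borel_measurable lebesgue"
        by (simp add: set_borel_measurable_def mult.assoc)
    qed
    also have "\<dots> = \<delta>\<^sup>2 * I01 (\<lambda>x. g x * deriv \<phi> x)"
      by (simp add: lint_eq_integral[OF abs_integrable_mult_bdd_meas[OF ga pb(2)]])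
    finally have "\<delta>\<^sup>2 * I01 (\<lambda>x. g x * deriv \<phi> x)
        + I01 (\<lambda>x. c x * u x * \<phi> x) = I01 (\<lambda>x. f x * \<phi> x)"
      using weak bdd_meas_lint[OF bdd_meas_mult[OF bdd_meas_mult[OF fb(2,3)] pb(3)]]
        bdd_meas_lint[OF bdd_meas_mult[OF fb(1) pb(3)]] by simp
    moreover have "I01 (\<lambda>x. c x * u x * \<phi> x) - I01 (\<lambda>x. f x * \<phi> x)
        = I01 (\<lambda>x. c x * u x * \<phi> x - f x * \<phi> x)"
      by (intro Henstock_Kurzweil_Integration.integral_diff[symmetric] bdd_meas_integrable' bdd_meas_intros fb pb)
    moreover have "(\<lambda>x. c x * u x * \<phi> x - f x * \<phi> x) = (\<lambda>x. \<delta>\<^sup>2 * (q x * \<phi> x))"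
      using \<delta> by (auto simp: q_def field_simps)
    moreover have "I01 (\<lambda>x. \<delta>\<^sup>2 * (q x * \<phi> x)) = \<delta>\<^sup>2 * I01 (\<lambda>x. q x * \<phi> x)"
      by simp
    ultimately have "\<delta>\<^sup>2 * (I01 (\<lambda>x. g x * deriv \<phi> x) + I01 (\<lambda>x. q x * \<phi> x)) = 0"
      unfolding distrib_left by (simp only:)
    then have "I01 (\<lambda>x. g x * deriv \<phi> x) + I01 (\<lambda>x. q x * \<phi> x) = 0"
      using \<delta> by simp
    moreover have "I01 (\<lambda>x. Q x * deriv \<phi> x) = - I01 (\<lambda>x. q x * \<phi> x)"
      using integration_by_parts_bdd_deriv[OF Q p(1)] p(2,3) by (simp add: mult.commute)
    moreover have "I01 (\<lambda>x. g x * deriv \<phi> x - Q x * deriv \<phi> x)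
        = I01 (\<lambda>x. g x * deriv \<phi> x) - I01 (\<lambda>x. Q x * deriv \<phi> x)"
      by (intro Henstock_Kurzweil_Integration.integral_diff abs_integrable_integrable_Icc abs_integrable_mult_bdd_meas ga pb
          bdd_meas_integrable' bdd_meas_mult Qb)
    ultimately show "I01 (\<lambda>x. (g x - Q x) * deriv \<phi> x) = 0"
      by (simp add: algebra_simps)
  qed
  then obtain k N where N: "negligible N" "\<And>x. x \<in> unit_I - N \<Longrightarrow> g x - Q x = k" by blast
  define G where "G x = Q x + k" for x
  have Gc: "continuous_on {0..1} G" unfolding G_def by (intro continuous_intros Qb)
  define R where "R x = integral {0..x} G" for x
  have R: "has_bdd_deriv R G" unfolding R_def by (rule has_bdd_deriv_integral(1)[OF Gc])
  note Rb = has_bdd_derivD[OF R]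
  have "\<exists>k N. negligible N \<and> (\<forall>x\<in>unit_I - N. u x - R x = k)"
  proof (rule const_of_weak_deriv_zero)
    have ub: "bdd_meas u" by (rule bdd_meas_continuous[OF uc])
    show "(\<lambda>x. u x - R x) absolutely_integrable_on unit_I"
      by (intro set_integral_diff(1) abs_integrable_Ioo bdd_meas_abs_integrable Rb(3) ub)
    fix \<phi> assume \<phi>: "\<phi> \<in> test_functions"
    note p = test_function_bdd_deriv[OF \<phi>]
    note pb = has_bdd_derivD[OF p(1)]
    have "(LINT x:unit_I|lebesgue. u x * deriv \<phi> x) = - (LINT x:unit_I|lebesgue. g x * \<phi> x)"
      using g \<phi> unfolding is_weak_deriv_def g_def by blast
    then have "I01 (\<lambda>x. u x * deriv \<phi> x) = - I01 (\<lambda>x. g x * \<phi> x)"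
      using bdd_meas_lint[OF bdd_meas_mult[OF ub pb(2)]] lint_eq_integral[OF abs_integrable_mult_bdd_meas[OF ga pb(3)]]
      by simp
    also have "I01 (\<lambda>x. g x * \<phi> x) = I01 (\<lambda>x. G x * \<phi> x)"
    proof (rule integral_eq_if_AE_eq[OF N(1)])
      show "g x * \<phi> x = G x * \<phi> x" if "x \<in> unit_I - N" for x
        using N(2)[OF that] by (simp add: G_def algebra_simps)
    qed
    also have "- \<dots> = I01 (\<lambda>x. R x * deriv \<phi> x)"
      using integration_by_parts_bdd_deriv[OF R p(1)] p(2,3) by (simp add: mult.commute)
    finally show "I01 (\<lambda>x. (u x - R x) * deriv \<phi> x) = 0"
      unfolding left_diff_distrib
      by (subst Henstock_Kurzweil_Integration.integral_diff)
         (intro bdd_meas_integrable' bdd_meas_mult ub pb Rb | simp)+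
  qed
  then obtain k2 N2 where N2: "negligible N2" "\<And>x. x \<in> unit_I - N2 \<Longrightarrow> u x - R x = k2" by blast
  have eq: "u x = R x + k2" if "x \<in> {0..1}" for x
  proof (rule continuous_eq_of_AE_eq[OF uc _ N2(1) _ that])
    show "continuous_on {0..1} (\<lambda>x. R x + k2)" by (intro continuous_intros Rb)
    show "u x = R x + k2" if "x \<in> unit_I - N2" for x using N2(2)[OF that] by simp
  qed
  have d: "(u has_real_derivative G x) (at x)" if x: "x \<in> unit_I" for x
  proof -
    have "((\<lambda>x. R x + k2) has_real_derivative G x + 0) (at x)"
      unfolding R_def by (intro DERIV_add DERIV_const has_bdd_deriv_integral(2)[OF Gc x])
    then have "((\<lambda>x. R x + k2) has_real_derivative G x) (at x)" by simp
    then show ?thesis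
      by (rule has_field_derivative_transform_within_open[where S=unit_I]) (use x eq in auto)
  qed
  show thesis
  proof (rule that[of G])
    show "has_bdd_deriv u G" by (rule has_bdd_deriv_C1[OF d uc Gc])
    show "has_bdd_deriv G (\<lambda>x. (c x * u x - f x) / \<delta>\<^sup>2)"
      using has_bdd_deriv_add[OF Q has_bdd_deriv_const[of k]] by (simp add: G_def[abs_def] q_def[abs_def])
  qed (use d Gc in auto)
qed

section \<open>Piecewise linear interpolation and projection\<close>

lemma I01_add: "bdd_meas f \<Longrightarrow> bdd_meas g \<Longrightarrow> I01 (\<lambda>x. f x + g x) = I01 f + I01 g"
  by (intro Henstock_Kurzweil_Integration.integral_add bdd_meas_integrable')

lemma I01_diff: "bdd_meas f \<Longrightarrow> bdd_meas g \<Longrightarrow> I01 (\<lambda>x. f x - g x) = I01 f - I01 g"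
  by (intro Henstock_Kurzweil_Integration.integral_diff bdd_meas_integrable')

lemma I01_cmult: "I01 (\<lambda>x. k * f x) = k * I01 f"
  by simp

lemma I01_mono: "bdd_meas f \<Longrightarrow> bdd_meas g \<Longrightarrow> (\<And>x. x \<in> {0..1} \<Longrightarrow> f x \<le> g x) \<Longrightarrow> I01 f \<le> I01 g"
  by (intro integral_le bdd_meas_integrable')

lemma I01_square_nonneg: "bdd_meas f \<Longrightarrow> 0 \<le> L2sq f"
  by (intro integral_nonneg bdd_meas_integrable' bdd_meas_power2) simp_all

lemma I01_square_add_le:
  assumes "bdd_meas f" "bdd_meas g"
  shows "I01 (\<lambda>x. (f x + g x)\<^sup>2) \<le> 2 * L2sq f + 2 * L2sq g"
proof -
  have "I01 (\<lambda>x. (f x + g x)\<^sup>2) \<le> I01 (\<lambda>x. 2 * (f x)\<^sup>2 + 2 * (g x)\<^sup>2)"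
  proof (rule I01_mono)
    show "(f x + g x)\<^sup>2 \<le> 2 * (f x)\<^sup>2 + 2 * (g x)\<^sup>2" for x
      using sum_squares_bound[of "f x" "g x"] by (simp add: power2_sum)
  qed (intro bdd_meas_intros assms)+
  also have "\<dots> = 2 * L2sq f + 2 * L2sq g"
    by (subst I01_add) (intro bdd_meas_intros assms | simp)+
  finally show ?thesis .
qed

lemma I01_square_diff_le:
  assumes "bdd_meas f" "bdd_meas g"
  shows "I01 (\<lambda>x. (f x - g x)\<^sup>2) \<le> 2 * L2sq f + 2 * L2sq g"
  using I01_square_add_le[OF assms(1) bdd_meas_uminus[OF assms(2)]] by simp

lemma I01_square_diff:
  assumes "bdd_meas f" "bdd_meas g"
  shows "I01 (\<lambda>x. (f x - g x)\<^sup>2) = L2sq f - 2 * I01 (\<lambda>x. f x * g x) + L2sq g"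
proof -
  have "I01 (\<lambda>x. (f x - g x)\<^sup>2) = I01 (\<lambda>x. ((f x)\<^sup>2 - 2 * (f x * g x)) + (g x)\<^sup>2)"
    by (simp add: power2_diff algebra_simps)
  also have "\<dots> = I01 (\<lambda>x. (f x)\<^sup>2 - 2 * (f x * g x)) + L2sq g"
    by (intro I01_add bdd_meas_intros assms)
  also have "I01 (\<lambda>x. (f x)\<^sup>2 - 2 * (f x * g x)) = L2sq f - I01 (\<lambda>x. 2 * (f x * g x))"
    by (intro I01_diff bdd_meas_intros assms)
  finally show ?thesis by simp
qed

text \<open>Non-negativity of the integral of \<open>(g - m)^2\<close>, where \<open>m\<close> is
  the mean of \<open>g\<close> over the interval.\<close>

lemma integral_Cauchy_Schwarz:
  assumes g: "bdd_meas g" and ab: "0 \<le> a" "a < b" "b \<le> 1"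
  shows "(integral {a..b} g)\<^sup>2 \<le> (b - a) * integral {a..b} (\<lambda>x. (g x)\<^sup>2)"
proof -
  let ?J = "integral {a..b} g" and ?S = "integral {a..b} (\<lambda>x. (g x)\<^sup>2)"
  define m where "m = ?J / (b - a)"
  have i: "f integrable_on {a..b}" if "bdd_meas f" for f using that ab by (intro bdd_meas_integrable)
  have "0 \<le> integral {a..b} (\<lambda>x. (g x - m)\<^sup>2)"
    by (intro integral_nonneg i bdd_meas_intros g) simp
  also have "integral {a..b} (\<lambda>x. (g x - m)\<^sup>2) = integral {a..b} (\<lambda>x. ((g x)\<^sup>2 - (2 * m) * g x) + m\<^sup>2)"
    by (simp add: power2_diff algebra_simps)
  also have "\<dots> = integral {a..b} (\<lambda>x. (g x)\<^sup>2 - (2 * m) * g x) + integral {a..b} (\<lambda>x. m\<^sup>2)"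
    by (intro Henstock_Kurzweil_Integration.integral_add i bdd_meas_intros g)
  also have "integral {a..b} (\<lambda>x. (g x)\<^sup>2 - (2 * m) * g x) = ?S - integral {a..b} (\<lambda>x. (2 * m) * g x)"
    by (intro Henstock_Kurzweil_Integration.integral_diff i bdd_meas_intros g)
  finally have "0 \<le> ?S - 2 * m * ?J + m\<^sup>2 * (b - a)" using ab by (simp add: mult.commute)
  then have "0 \<le> (b - a) * (?S - 2 * m * ?J + m\<^sup>2 * (b - a))" using ab by (intro mult_nonneg_nonneg) auto
  also have "\<dots> = (b - a) * ?S - 2 * ?J * (m * (b - a)) + (m * (b - a))\<^sup>2"
    by (simp add: algebra_simps power2_eq_square)
  also have "m * (b - a) = ?J" using ab by (simp add: m_def)
  finally show ?thesis by (simp add: power2_eq_square)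
qed

text \<open>\<open>e x\<close> is the integral of \<open>e'\<close> from \<open>a\<close> to
  \<open>x\<close>, so Cauchy-Schwarz bounds its square by \<open>b - a\<close> times the full
  integral of the square of \<open>e'\<close>; integrating over \<open>x\<close> gives the second
  factor \<open>b - a\<close>.\<close>

lemma poincare_left:
  assumes e: "has_bdd_deriv e e'" and ab: "0 \<le> a" "a < b" "b \<le> 1" and z: "e a = 0"
  shows "integral {a..b} (\<lambda>x. (e x)\<^sup>2) \<le> (b - a)\<^sup>2 * integral {a..b} (\<lambda>x. (e' x)\<^sup>2)"
proof -
  note eb = has_bdd_derivD[OF e]
  let ?S = "integral {a..b} (\<lambda>x. (e' x)\<^sup>2)"
  have i: "f integrable_on {a..c}" if "bdd_meas f" "c \<le> b" for f c using that ab by (intro bdd_meas_integrable) auto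
  have "(e x)\<^sup>2 \<le> (b - a) * ?S" if x: "x \<in> {a..b}" for x
  proof (cases "x = a")
    case True
    have "0 \<le> ?S" by (intro integral_nonneg i bdd_meas_power2 eb order_refl) simp
    then show ?thesis using True z ab by simp
  next
    case False
    then have ax: "a < x" "x \<le> b" using x by auto
    have "(e' has_integral (e x - e a)) {a..x}"
      using ax ab by (intro has_bdd_deriv_FTC[OF e]) auto
    then have "(e x)\<^sup>2 = (integral {a..x} e')\<^sup>2" using z by (simp add: integral_unique)
    also have "\<dots> \<le> (x - a) * integral {a..x} (\<lambda>x. (e' x)\<^sup>2)"
      using ax ab by (intro integral_Cauchy_Schwarz eb) auto
    also have "\<dots> \<le> (b - a) * ?S"
    proof (rule mult_mono)
      show "integral {a..x} (\<lambda>x. (e' x)\<^sup>2) \<le> ?S"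
        using ax by (intro integral_subset_le i bdd_meas_power2 eb) auto
      show "0 \<le> integral {a..x} (\<lambda>x. (e' x)\<^sup>2)"
        using ax by (intro integral_nonneg i bdd_meas_power2 eb) auto
    qed (use ax in auto)
    finally show ?thesis .
  qed
  then have "integral {a..b} (\<lambda>x. (e x)\<^sup>2) \<le> integral {a..b} (\<lambda>x. (b - a) * ?S)"
    by (intro integral_le i bdd_meas_power2 eb bdd_meas_const) auto
  also have "\<dots> = (b - a)\<^sup>2 * ?S" using ab by (simp add: power2_eq_square)
  finally show ?thesis .
qed

abbreviation element :: "nat \<Rightarrow> nat \<Rightarrow> real set" where
  "element N j \<equiv> {real j / real N..real (Suc j) / real N}"

lemma node_Suc_le: "j < N \<Longrightarrow> real (Suc j) / real N \<le> 1"
  by simp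

lemma node_less_Suc: "j < N \<Longrightarrow> real j / real N < real (Suc j) / real N"
  by (simp add: divide_strict_right_mono)

lemma integral_elements:
  assumes "bdd_meas f" "N \<ge> 1"
  shows "I01 f = (\<Sum>j<N. integral (element N j) f)"
proof -
  have "integral {0..real k / real N} f = (\<Sum>j<k. integral (element N j) f)"
    if "k \<le> N" for k
    using that
  proof (induction k)
    case (Suc k)
    have "integral {0..real k / real N} f + integral (element N k) f
        = integral {0..real (Suc k) / real N} f"
      using Suc.prems node_less_Suc[of k N] node_Suc_le[of k N]
      by (intro Henstock_Kurzweil_Integration.integral_combine bdd_meas_integrable assms(1)) auto
    then show ?case using Suc by simp
  qed simp
  from this[of N] show ?thesis using assms(2) by simp
qed

lemma I01_le_elements:
  assumes "bdd_meas f" "bdd_meas g" "N \<ge> 1"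
    "\<And>j. j < N \<Longrightarrow> integral (element N j) f
       \<le> k * integral (element N j) g"
  shows "I01 f \<le> k * I01 g"
  unfolding integral_elements[OF assms(1,3)] integral_elements[OF assms(2,3)] sum_distrib_left
  by (intro sum_mono assms(4)) simp

lemma poincare_nodes:
  assumes e: "has_bdd_deriv e e'" and N: "N \<ge> 1" and z: "\<And>j. j < N \<Longrightarrow> e (real j / real N) = 0"
  shows "L2sq e \<le> (1 / real N)\<^sup>2 * L2sq e'"
proof (rule I01_le_elements[OF _ _ N])
  fix j assume j: "j < N"
  have "integral (element N j) (\<lambda>x. (e x)\<^sup>2)
      \<le> (real (Suc j) / real N - real j / real N)\<^sup>2 * integral (element N j) (\<lambda>x. (e' x)\<^sup>2)"
    by (rule poincare_left[OF e _ node_less_Suc[OF j] node_Suc_le[OF j] z[OF j]]) simp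
  also have "real (Suc j) / real N - real j / real N = 1 / real N"
    by (simp add: diff_divide_distrib[symmetric])
  finally show "integral (element N j) (\<lambda>x. (e x)\<^sup>2)
      \<le> (1 / real N)\<^sup>2 * integral (element N j) (\<lambda>x. (e' x)\<^sup>2)" .
qed (intro bdd_meas_power2 has_bdd_derivD[OF e])+

section \<open>Hat functions and nodal vectors\<close>

definition hat :: "real \<Rightarrow> real" where
  "hat t = max 0 (1 - \<bar>t\<bar>)"

definition hat' :: "real \<Rightarrow> real" where
  "hat' t = (if -1 < t \<and> t < 0 then 1 else if 0 < t \<and> t < 1 then -1 else 0)"

lemma DERIV_hat:
  assumes "t \<notin> {-1, 0, 1}"
  shows "(hat has_real_derivative hat' t) (at t)"
proof -
  consider "t < -1" | "-1 < t" "t < 0" | "0 < t" "t < 1" | "1 < t" using assms by force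
  then show ?thesis
  proof cases
    case 1
    have "((\<lambda>t. 0) has_real_derivative hat' t) (at t)" using 1 by (simp add: hat'_def)
    then show ?thesis
      by (rule has_field_derivative_transform_within_open[where S="{..<-1}"]) (use 1 in \<open>auto simp: hat_def\<close>)
  next
    case 2
    have "((\<lambda>t. 1 + t) has_real_derivative hat' t) (at t)"
      using 2 by (auto simp: hat'_def intro!: derivative_eq_intros)
    then show ?thesis
      by (rule has_field_derivative_transform_within_open[where S="{-1<..<0}"]) (use 2 in \<open>auto simp: hat_def\<close>)
  next
    case 3
    have "((\<lambda>t. 1 - t) has_real_derivative hat' t) (at t)"
      using 3 by (auto simp: hat'_def intro!: derivative_eq_intros)
    then show ?thesis
      by (rule has_field_derivative_transform_within_open[where S="{0<..<1}"]) (use 3 in \<open>auto simp: hat_def\<close>)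
  next
    case 4
    have "((\<lambda>t. 0) has_real_derivative hat' t) (at t)" using 4 by (simp add: hat'_def)
    then show ?thesis
      by (rule has_field_derivative_transform_within_open[where S="{1<..}"]) (use 4 in \<open>auto simp: hat_def\<close>)
  qed
qed

text \<open>The scale \<open>k\<close> is real because one lemma serves both the mesh hats, with
  \<open>k = N\<close>, and the boundary correctors, whose width 1 / k need not match a
  mesh.\<close>

lemma has_bdd_deriv_hat:
  assumes "k > 0"
  shows "has_bdd_deriv (\<lambda>x. hat (x * k - b)) (\<lambda>x. k * hat' (x * k - b))"
  unfolding has_bdd_deriv_def
proof (intro conjI)
  show "continuous_on {0..1} (\<lambda>x. hat (x * k - b))" unfolding hat_def by (intro continuous_intros)
  have "hat' \<in> borel_measurable borel" unfolding hat'_def[abs_def] by measurable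
  then have "(\<lambda>x. k * hat' (x * k - b)) \<in> borel_measurable borel" by measurable
  then have "(\<lambda>x. k * hat' (x * k - b)) \<in> borel_measurable (lebesgue_on {0..1})"
    by (intro measurable_restrict_space1 measurable_completion) simp
  moreover have "\<bar>k * hat' t\<bar> \<le> k" for t using assms by (auto simp: hat'_def abs_mult)
  ultimately show "bdd_meas (\<lambda>x. k * hat' (x * k - b))" unfolding bdd_meas_def by blast
  show "\<exists>S. finite S \<and> (\<forall>x\<in>unit_I - S. ((\<lambda>x. hat (x * k - b)) has_real_derivative k * hat' (x * k - b)) (at x))"
  proof (intro exI[of _ "{(b - 1) / k, b / k, (b + 1) / k}"] conjI ballI)
    fix x assume x: "x \<in> unit_I - {(b - 1) / k, b / k, (b + 1) / k}"
    then have "x * k - b \<notin> {-1, 0, 1}" using assms by (auto simp: field_simps)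
    then have "(hat has_real_derivative hat' (x * k - b)) (at (x * k - b))" by (rule DERIV_hat)
    moreover have "((\<lambda>x. x * k - b) has_real_derivative k) (at x)" by (auto intro!: derivative_eq_intros)
    ultimately have "((\<lambda>x. hat (x * k - b)) has_real_derivative hat' (x * k - b) * k) (at x)"
      by (rule DERIV_chain2)
    then show "((\<lambda>x. hat (x * k - b)) has_real_derivative k * hat' (x * k - b)) (at x)" by (simp only: mult.commute)
  qed simp
qed

text \<open>Discrete functions are represented by nodal vectors, with \<open>N = 2 ^ L + 1\<close>
  elements for the grid of level \<open>L\<close>. Both end nodes are kept, so boundary values are
  ordinary coefficients, and hats that reach beyond [0,1] do no harm.\<close>

definition pl :: "nat \<Rightarrow> (nat \<Rightarrow> real) \<Rightarrow> real \<Rightarrow> real" where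
  "pl N y x = (\<Sum>i\<le>N. y i * hat (x * real N - real i))"

definition pl' :: "nat \<Rightarrow> (nat \<Rightarrow> real) \<Rightarrow> real \<Rightarrow> real" where
  "pl' N y x = (\<Sum>i\<le>N. y i * (real N * hat' (x * real N - real i)))"

lemma has_bdd_deriv_pl: "N \<ge> 1 \<Longrightarrow> has_bdd_deriv (pl N y) (pl' N y)"
  unfolding pl_def[abs_def] pl'_def[abs_def]
  by (intro has_bdd_deriv_sum has_bdd_deriv_cmult has_bdd_deriv_hat) auto

lemma pl_element:
  assumes "j < N" "x \<in> element N j"
  shows "pl N y x = y j + (y (Suc j) - y j) * (x * real N - real j)"
proof -
  have x: "real j \<le> x * real N" "x * real N \<le> real (Suc j)" using assms by (auto simp: field_simps)
  have "pl N y x = (\<Sum>i\<in>{j, Suc j}. y i * hat (x * real N - real i))"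
    unfolding pl_def
  proof (rule sum.mono_neutral_right)
    show "\<forall>i\<in>{..N} - {j, Suc j}. y i * hat (x * real N - real i) = 0"
    proof
      fix i assume "i \<in> {..N} - {j, Suc j}"
      then have "i + 1 \<le> j \<or> j + 2 \<le> i" by auto
      then have "real i + 1 \<le> real j \<or> real j + 2 \<le> real i" by linarith
      then have "1 \<le> \<bar>x * real N - real i\<bar>" using x by auto
      then show "y i * hat (x * real N - real i) = 0" by (simp add: hat_def)
    qed
  qed (use assms in auto)
  also have "\<dots> = y j + (y (Suc j) - y j) * (x * real N - real j)"
    using x by (simp add: hat_def max_def algebra_simps)
  finally show ?thesis .
qed

lemma pl'_element:
  assumes "j < N" "x \<in> {real j / real N<..<real (Suc j) / real N}"
  shows "pl' N y x = real N * (y (Suc j) - y j)"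
proof -
  have x: "real j < x * real N" "x * real N < real (Suc j)" using assms by (auto simp: field_simps)
  have "pl' N y x = (\<Sum>i\<in>{j, Suc j}. y i * (real N * hat' (x * real N - real i)))"
    unfolding pl'_def
  proof (rule sum.mono_neutral_right)
    show "\<forall>i\<in>{..N} - {j, Suc j}. y i * (real N * hat' (x * real N - real i)) = 0"
    proof
      fix i assume "i \<in> {..N} - {j, Suc j}"
      then have "i + 1 \<le> j \<or> j + 2 \<le> i" by auto
      then have "real i + 1 \<le> real j \<or> real j + 2 \<le> real i" by linarith
      then have "1 \<le> \<bar>x * real N - real i\<bar>" using x by auto
      then show "y i * (real N * hat' (x * real N - real i)) = 0" by (auto simp: hat'_def)
    qed
  qed (use assms in auto)
  also have "\<dots> = real N * (y (Suc j) - y j)"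
    using x by (simp add: hat'_def algebra_simps)
  finally show ?thesis .
qed

lemma pl_node: "j \<le> N \<Longrightarrow> N \<ge> 1 \<Longrightarrow> pl N y (real j / real N) = y j"
proof -
  assume j: "j \<le> N" "N \<ge> 1"
  have "pl N y (real j / real N) = (\<Sum>i\<in>{j}. y i * hat (real j / real N * real N - real i))"
    unfolding pl_def
  proof (rule sum.mono_neutral_right)
    show "\<forall>i\<in>{..N} - {j}. y i * hat (real j / real N * real N - real i) = 0"
    proof
      fix i assume "i \<in> {..N} - {j}"
      then have "1 \<le> \<bar>real j - real i\<bar>" by auto
      then show "y i * hat (real j / real N * real N - real i) = 0" using j by (simp add: hat_def)
    qed
  qed (use j in auto)
  then show ?thesis using j by (simp add: hat_def)
qed

lemma pl_0: "N \<ge> 1 \<Longrightarrow> pl N y 0 = y 0"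
  using pl_node[of 0 N y] by simp

lemma pl_1: "N \<ge> 1 \<Longrightarrow> pl N y 1 = y N"
  using pl_node[of N N y] by simp

lemma pl_diff: "pl N (\<lambda>i. y i - z i) x = pl N y x - pl N z x"
  by (simp add: pl_def sum_subtractf algebra_simps)

lemma pl'_diff: "pl' N (\<lambda>i. y i - z i) x = pl' N y x - pl' N z x"
  by (simp add: pl'_def sum_subtractf algebra_simps)

lemma pl_add: "pl N (\<lambda>i. y i + z i) x = pl N y x + pl N z x"
  by (simp add: pl_def sum.distrib algebra_simps)

lemma integral_pl'_square_element:
  assumes "j < N"
  shows "integral (element N j) (\<lambda>x. (pl' N y x)\<^sup>2) = real N * (y (Suc j) - y j)\<^sup>2"
proof -
  let ?K = "element N j"
  have "integral ?K (\<lambda>x. (pl' N y x)\<^sup>2) = integral ?K (\<lambda>x. (real N * (y (Suc j) - y j))\<^sup>2)"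
  proof (rule integral_spike[of "{real j / real N, real (Suc j) / real N}"])
    show "(real N * (y (Suc j) - y j))\<^sup>2 = (pl' N y x)\<^sup>2"
      if "x \<in> ?K - {real j / real N, real (Suc j) / real N}" for x
      using that pl'_element[OF assms, of x y] by auto
  qed simp
  also have "\<dots> = (real (Suc j) / real N - real j / real N) * (real N * (y (Suc j) - y j))\<^sup>2"
    using node_less_Suc[OF assms] by simp
  also have "real (Suc j) / real N - real j / real N = 1 / real N"
    by (simp add: diff_divide_distrib[symmetric])
  finally show ?thesis using assms by (simp add: power2_eq_square)
qed

text \<open>The element mass matrix with rows (2, 1) and (1, 2), divided by \<open>6 * N\<close>,
  obtained from an antiderivative in the local coordinate.\<close>

lemma integral_pl_mult_element:
  assumes "j < N"
  shows "integral (element N j) (\<lambda>x. pl N y x * pl N z x)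
    = (2 * y j * z j + y j * z (Suc j) + y (Suc j) * z j + 2 * y (Suc j) * z (Suc j)) / (6 * real N)"
proof -
  let ?K = "element N j"
  define p where "p = y (Suc j) - y j"
  define q where "q = z (Suc j) - z j"
  define F where "F x = (let s = x * real N - real j in
     (y j * z j * s + (y j * q + z j * p) * s\<^sup>2 / 2 + p * q * s ^ 3 / 3) / real N)" for x
  have N: "real N > 0" using assms by simp
  have "((\<lambda>x. (y j + p * (x * real N - real j)) * (z j + q * (x * real N - real j)))
      has_integral (F (real (Suc j) / real N) - F (real j / real N))) ?K"
  proof (rule fundamental_theorem_of_calculus)
    show "real j / real N \<le> real (Suc j) / real N" using node_less_Suc[OF assms] by simp
    fix x
    have "(F has_real_derivative
        (y j + p * (x * real N - real j)) * (z j + q * (x * real N - real j))) (at x within ?K)"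
      unfolding F_def Let_def
      using N by (auto intro!: derivative_eq_intros simp: field_simps power2_eq_square power3_eq_cube)
    then show "(F has_vector_derivative
        (y j + p * (x * real N - real j)) * (z j + q * (x * real N - real j))) (at x within ?K)"
      by (simp add: has_real_derivative_iff_has_vector_derivative)
  qed
  moreover have "integral ?K (\<lambda>x. pl N y x * pl N z x)
      = integral ?K (\<lambda>x. (y j + p * (x * real N - real j)) * (z j + q * (x * real N - real j)))"
    by (intro integral_cong) (simp add: pl_element[OF assms] p_def q_def)
  ultimately have "integral ?K (\<lambda>x. pl N y x * pl N z x) = F (real (Suc j) / real N) - F (real j / real N)"
    by (simp add: integral_unique)
  also have "\<dots> = (y j * z j + (y j * q + z j * p) / 2 + p * q / 3) / real N"
    using N by (simp add: F_def)
  also have "\<dots> = (2 * y j * z j + y j * z (Suc j) + y (Suc j) * z j + 2 * y (Suc j) * z (Suc j)) / (6 * real N)"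
    using N by (simp add: p_def q_def field_simps)
  finally show ?thesis .
qed

text \<open>With end values a and b on an element the claim is (b - a)^2 \<le> 4 (a^2 + ab + b^2),
  and the difference of the two sides is 3 (a + b)^2. The constant 12 is attained for opposite end
  values.\<close>

lemma pl_inverse_estimate:
  assumes "N \<ge> 1"
  shows "L2sq (pl' N y) \<le> 12 * (real N)\<^sup>2 * L2sq (pl N y)"
proof (rule I01_le_elements[OF _ _ assms])
  fix j assume j: "j < N"
  let ?a = "y j" and ?b = "y (Suc j)"
  have "12 * (real N)\<^sup>2 * integral (element N j) (\<lambda>x. (pl N y x)\<^sup>2)
     = real N * (4 * ?a\<^sup>2 + 4 * ?a * ?b + 4 * ?b\<^sup>2)"
  proof -
    have "integral (element N j) (\<lambda>x. (pl N y x)\<^sup>2)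
        = (2 * ?a * ?a + ?a * ?b + ?b * ?a + 2 * ?b * ?b) / (6 * real N)"
      using integral_pl_mult_element[OF j, of y y] by (simp add: power2_eq_square)
    then show ?thesis using j by (simp only:) (simp add: power2_eq_square field_simps)
  qed
  moreover have "(?b - ?a)\<^sup>2 \<le> 4 * ?a\<^sup>2 + 4 * ?a * ?b + 4 * ?b\<^sup>2"
  proof -
    have "0 \<le> 3 * (?a + ?b)\<^sup>2" by simp
    then show ?thesis by (simp add: power2_eq_square algebra_simps)
  qed
  ultimately show "integral (element N j) (\<lambda>x. (pl' N y x)\<^sup>2)
    \<le> 12 * (real N)\<^sup>2 * integral (element N j) (\<lambda>x. (pl N y x)\<^sup>2)"
    using integral_pl'_square_element[OF j, of y] by (simp add: mult_left_mono)
qed (intro bdd_meas_power2 has_bdd_derivD[OF has_bdd_deriv_pl[OF assms]])+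

abbreviation nodal :: "nat \<Rightarrow> (real \<Rightarrow> real) \<Rightarrow> nat \<Rightarrow> real" where
  "nodal N e \<equiv> (\<lambda>i. e (real i / real N))"

text \<open>On each element the slope of the interpolant is the mean of \<open>e'\<close>, and the
  square of a mean is at most the mean of the squares.\<close>

lemma pl_interp_deriv_le:
  assumes e: "has_bdd_deriv e e'" and N: "N \<ge> 1"
  shows "L2sq (pl' N (nodal N e)) \<le> L2sq e'"
proof -
  note eb = has_bdd_derivD[OF e]
  have "L2sq (pl' N (nodal N e)) \<le> 1 * L2sq e'"
  proof (rule I01_le_elements[OF _ _ N])
    fix j assume j: "j < N"
    let ?a = "real j / real N" and ?b = "real (Suc j) / real N"
    have "(e' has_integral (e ?b - e ?a)) {?a..?b}"
      using node_less_Suc[OF j] node_Suc_le[OF j] by (intro has_bdd_deriv_FTC[OF e]) auto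
    then have "(e ?b - e ?a)\<^sup>2 = (integral {?a..?b} e')\<^sup>2" by (simp add: integral_unique)
    also have "\<dots> \<le> (?b - ?a) * integral {?a..?b} (\<lambda>x. (e' x)\<^sup>2)"
      using node_less_Suc[OF j] node_Suc_le[OF j] by (intro integral_Cauchy_Schwarz eb) auto
    also have "?b - ?a = 1 / real N" by (simp add: diff_divide_distrib[symmetric])
    finally show "integral {?a..?b} (\<lambda>x. (pl' N (nodal N e) x)\<^sup>2) \<le> 1 * integral {?a..?b} (\<lambda>x. (e' x)\<^sup>2)"
      unfolding integral_pl'_square_element[OF j] using j by (simp add: field_simps)
  qed (intro bdd_meas_power2 eb has_bdd_derivD[OF has_bdd_deriv_pl[OF N]])+
  then show ?thesis by simp
qed

lemma interp_error_L2:
  assumes e: "has_bdd_deriv e e'" and N: "N \<ge> 1"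
  shows "I01 (\<lambda>x. (e x - pl N (nodal N e) x)\<^sup>2)
    \<le> (1 / real N)\<^sup>2 * I01 (\<lambda>x. (e' x - pl' N (nodal N e) x)\<^sup>2)"
  by (rule poincare_nodes[OF has_bdd_deriv_diff[OF e has_bdd_deriv_pl[OF N]] N])
     (use N in \<open>simp add: pl_node\<close>)

lemma interp_error_H1:
  assumes e: "has_bdd_deriv e e'" and N: "N \<ge> 1"
  shows "I01 (\<lambda>x. (e' x - pl' N (nodal N e) x)\<^sup>2) \<le> 4 * L2sq e'"
  using I01_square_diff_le[OF has_bdd_derivD(2)[OF e] has_bdd_derivD(2)[OF has_bdd_deriv_pl[OF N]], of "nodal N e"]
    pl_interp_deriv_le[OF e N] by linarith

text \<open>Pythagoras: \<open>p\<close> is orthogonal to \<open>e - p\<close>, so the squares of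
  the two parts add up to that of \<open>e\<close>.\<close>

lemma L2_projection_le:
  assumes "bdd_meas e" "bdd_meas p" "I01 (\<lambda>x. (p x - e x) * p x) = 0"
  shows "I01 (\<lambda>x. (e x - p x)\<^sup>2) \<le> L2sq e" "L2sq p \<le> L2sq e"
proof -
  have "I01 (\<lambda>x. (p x - e x) * p x) = I01 (\<lambda>x. (p x)\<^sup>2 - e x * p x)"
    by (simp add: power2_eq_square algebra_simps)
  also have "\<dots> = L2sq p - I01 (\<lambda>x. e x * p x)"
    by (intro I01_diff bdd_meas_intros assms)
  finally have "I01 (\<lambda>x. e x * p x) = L2sq p" using assms(3) by simp
  then have "I01 (\<lambda>x. (e x - p x)\<^sup>2) = L2sq e - L2sq p"
    using I01_square_diff[OF assms(1,2)] by simp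
  then show "I01 (\<lambda>x. (e x - p x)\<^sup>2) \<le> L2sq e" "L2sq p \<le> L2sq e"
    using I01_square_nonneg[OF assms(2)] I01_square_nonneg[OF bdd_meas_diff[OF assms(1,2)]] by linarith+
qed

text \<open>Stability in \<open>H\<^sup>1\<close> is reduced to stability in \<open>L\<^sup>2\<close> by comparing with the nodal interpolant and
  applying the inverse estimate to the difference.\<close>

lemma L2_projection_energy_le:
  assumes e: "has_bdd_deriv e e'" and N: "N \<ge> 1" and e01: "e 0 = 0" "e 1 = 0"
    and y: "y 0 = 0" "y N = 0"
    and orth: "\<And>z. z 0 = 0 \<Longrightarrow> z N = 0 \<Longrightarrow> I01 (\<lambda>x. (pl N y x - e x) * pl N z x) = 0"
  shows "energy \<delta> (\<lambda>x. e x - pl N y x) (\<lambda>x. e' x - pl' N y x) \<le> 104 * energy \<delta> e e'"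
proof -
  define i where "i = nodal N e"
  define g where "g = (\<lambda>k. y k - i k)"
  note eb = has_bdd_derivD[OF e]
  note plb = has_bdd_derivD[OF has_bdd_deriv_pl[OF N]]
  have i0: "i 0 = 0" "i N = 0" using e01 N by (simp_all add: i_def)
  have L2: "I01 (\<lambda>x. (e x - pl N y x)\<^sup>2) \<le> L2sq e"
    using orth[of y] y by (intro L2_projection_le(1) eb plb) auto
  \<comment> \<open>The projection reproduces the interpolant, so \<open>pl N g\<close> is the
    projection of the interpolation error \<open>e - pl N i\<close>. That error carries a factor 1 /
    N in L2, which pays for the factor N of the inverse estimate.\<close>
  have "I01 (\<lambda>x. (pl N g x - (e x - pl N i x)) * pl N g x) = 0"
    using orth[of g] y i0 by (simp add: g_def pl_diff algebra_simps)
  then have "L2sq (pl N g) \<le> I01 (\<lambda>x. (e x - pl N i x)\<^sup>2)"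
    by (intro L2_projection_le(2) bdd_meas_diff eb plb)
  also have "\<dots> \<le> (1 / real N)\<^sup>2 * I01 (\<lambda>x. (e' x - pl' N i x)\<^sup>2)"
    unfolding i_def by (rule interp_error_L2[OF e N])
  finally have "12 * (real N)\<^sup>2 * L2sq (pl N g)
      \<le> 12 * (real N)\<^sup>2 * ((1 / real N)\<^sup>2 * I01 (\<lambda>x. (e' x - pl' N i x)\<^sup>2))"
    by (intro mult_left_mono) auto
  also have "\<dots> = 12 * I01 (\<lambda>x. (e' x - pl' N i x)\<^sup>2)" using N by (simp add: power_divide)
  finally have "L2sq (pl' N g) \<le> 12 * I01 (\<lambda>x. (e' x - pl' N i x)\<^sup>2)"
    using pl_inverse_estimate[OF N, of g] by linarith
  moreover have "I01 (\<lambda>x. (e' x - pl' N y x)\<^sup>2)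
      \<le> 2 * I01 (\<lambda>x. (e' x - pl' N i x)\<^sup>2) + 2 * L2sq (pl' N g)"
    using I01_square_diff_le[OF bdd_meas_diff[OF eb(2) plb(2)] plb(2), of i g] by (simp add: g_def pl'_diff)
  moreover have "I01 (\<lambda>x. (e' x - pl' N i x)\<^sup>2) \<le> 4 * L2sq e'"
    unfolding i_def by (rule interp_error_H1[OF e N])
  \<comment> \<open>The interpolation error is counted 2 + 2 * 12 = 26 times, and
    \<open>interp_error_H1\<close> contributes the factor 4, in total 104.\<close>
  ultimately have H1: "I01 (\<lambda>x. (e' x - pl' N y x)\<^sup>2) \<le> 104 * L2sq e'" by linarith
  have "\<delta>\<^sup>2 * I01 (\<lambda>x. (e' x - pl' N y x)\<^sup>2) \<le> \<delta>\<^sup>2 * (104 * L2sq e')"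
    using H1 by (intro mult_left_mono) auto
  moreover have "0 \<le> L2sq e" by (intro I01_square_nonneg eb)
  ultimately show ?thesis using L2 unfolding energy_def distrib_left by linarith
qed

section \<open>The tridiagonal system of the projection\<close>

abbreviation ind_vec :: "nat \<Rightarrow> nat \<Rightarrow> real" where
  "ind_vec i \<equiv> (\<lambda>k. if k = i then 1 else 0)"

lemma pl_mass:
  assumes "1 \<le> i" "i < N"
  shows "I01 (\<lambda>x. pl N y x * pl N (ind_vec i) x) = (y (i - 1) + 4 * y i + y (Suc i)) / (6 * real N)"
proof -
  have N: "N \<ge> 1" using assms by simp
  note plb = has_bdd_derivD(3)[OF has_bdd_deriv_pl[OF N]]
  let ?t = "\<lambda>j. (2 * y j * ind_vec i j + y j * ind_vec i (Suc j) + y (Suc j) * ind_vec i j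
      + 2 * y (Suc j) * ind_vec i (Suc j)) / (6 * real N)"
  have "I01 (\<lambda>x. pl N y x * pl N (ind_vec i) x) = (\<Sum>j<N. ?t j)"
    unfolding integral_elements[OF bdd_meas_mult[OF plb plb] N]
    by (intro sum.cong refl integral_pl_mult_element) simp
  also have "\<dots> = (\<Sum>j\<in>{i - 1, i}. ?t j)"
    by (rule sum.mono_neutral_right) (use assms in auto)
  also have "\<dots> = ?t (i - 1) + ?t i" using assms by simp
  also have "\<dots> = (y (i - 1) + 4 * y i + y (Suc i)) / (6 * real N)"
    using assms by (simp add: add_divide_distrib[symmetric])
  finally show ?thesis .
qed

lemma pl_ind_vec_expansion: "pl N z x = (\<Sum>i\<le>N. z i * pl N (ind_vec i) x)"
proof -
  have "pl N (ind_vec i) x = hat (x * real N - real i)" if "i \<le> N" for i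
    using that by (simp add: pl_def if_distrib[of "\<lambda>t. t * _"] cong: if_cong)
  then show ?thesis by (simp add: pl_def)
qed

text \<open>Shooting method for the mass matrix: the equations of the interior rows are solved
  forward from \<open>y 0 = a\<close> and the trial value \<open>y 1 = t\<close>, and
  \<open>t\<close> is later adjusted to meet the boundary value at the other end.\<close>

fun shoot :: "(nat \<Rightarrow> real) \<Rightarrow> real \<Rightarrow> real \<Rightarrow> nat \<Rightarrow> real" where
  "shoot b a t 0 = a"
| "shoot b a t (Suc 0) = t"
| "shoot b a t (Suc (Suc n)) = b (Suc n) - 4 * shoot b a t (Suc n) - shoot b a t n"

lemma shoot_affine: "shoot b a t n = shoot b a 0 n + t * shoot (\<lambda>_. 0) 0 1 n"
  by (induction n rule: induct_nat_012) (auto simp: algebra_simps)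

text \<open>The recurrence gives \<open>\<bar>s (n+2)\<bar> \<ge> 4 * \<bar>s (n+1)\<bar> - \<bar>s
  n\<bar> \<ge> 3 * \<bar>s (n+1)\<bar>\<close> for this homogeneous solution s. Hence it never
  vanishes after index 0, and the end value depends on the shooting parameter with nonzero
  slope.\<close>

lemma shoot_growth:
  "\<bar>shoot (\<lambda>_. 0) 0 1 n\<bar> \<le> \<bar>shoot (\<lambda>_. 0) 0 1 (Suc n)\<bar> \<and> 1 \<le> \<bar>shoot (\<lambda>_. 0) 0 1 (Suc n)\<bar>"
proof (induction n)
  case (Suc n)
  then show ?case by simp linarith
qed simp

lemma tridiagonal_solvable:
  assumes "N \<ge> 1"
  shows "\<exists>y :: nat \<Rightarrow> real. y 0 = a \<and> y N = d \<and> (\<forall>i\<in>{1..<N}. y (i - 1) + 4 * y i + y (Suc i) = b i)"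
proof -
  define s where "s = shoot (\<lambda>_. 0) 0 1 N"
  obtain M where M: "N = Suc M" using assms by (cases N) auto
  have s: "s \<noteq> 0" using shoot_growth[of M] unfolding s_def M by linarith
  define t where "t = (d - shoot b a 0 N) / s"
  have "shoot b a t N = d" using s by (subst shoot_affine) (simp add: s_def[symmetric] t_def)
  moreover have "shoot b a t (i - 1) + 4 * shoot b a t i + shoot b a t (Suc i) = b i" if "i \<ge> 1" for i
    using that by (cases i) auto
  ultimately show ?thesis by (intro exI[of _ "shoot b a t"]) simp
qed

lemma pl_projection_exists:
  assumes v: "bdd_meas v" and N: "N \<ge> 1"
  shows "\<exists>y. y 0 = a \<and> y N = d \<and>
     (\<forall>z. z 0 = 0 \<longrightarrow> z N = 0 \<longrightarrow> I01 (\<lambda>x. (pl N y x - v x) * pl N z x) = 0)"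
proof -
  note plb = has_bdd_derivD(3)[OF has_bdd_deriv_pl[OF N]]
  obtain y where y: "y 0 = a" "y N = d"
    "\<forall>i\<in>{1..<N}. y (i - 1) + 4 * y i + y (Suc i) = 6 * real N * I01 (\<lambda>x. v x * pl N (ind_vec i) x)"
    using tridiagonal_solvable[OF N, of a d "\<lambda>i. 6 * real N * I01 (\<lambda>x. v x * pl N (ind_vec i) x)"] by blast
  have hat: "I01 (\<lambda>x. (pl N y x - v x) * pl N (ind_vec i) x) = 0" if i: "i \<in> {1..<N}" for i
  proof -
    have "I01 (\<lambda>x. (pl N y x - v x) * pl N (ind_vec i) x)
        = I01 (\<lambda>x. pl N y x * pl N (ind_vec i) x - v x * pl N (ind_vec i) x)"
      by (simp add: left_diff_distrib)
    also have "\<dots> = I01 (\<lambda>x. pl N y x * pl N (ind_vec i) x) - I01 (\<lambda>x. v x * pl N (ind_vec i) x)"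
      by (intro I01_diff bdd_meas_mult plb v)
    also have "I01 (\<lambda>x. pl N y x * pl N (ind_vec i) x) = I01 (\<lambda>x. v x * pl N (ind_vec i) x)"
      using i y(3) N by (subst pl_mass) auto
    finally show ?thesis by simp
  qed
  have "I01 (\<lambda>x. (pl N y x - v x) * pl N z x) = 0" if z: "z 0 = 0" "z N = 0" for z
  proof -
    have "I01 (\<lambda>x. (pl N y x - v x) * pl N z x)
        = I01 (\<lambda>x. \<Sum>i\<le>N. z i * ((pl N y x - v x) * pl N (ind_vec i) x))"
    proof (rule integral_cong)
      fix x
      show "(pl N y x - v x) * pl N z x = (\<Sum>i\<le>N. z i * ((pl N y x - v x) * pl N (ind_vec i) x))"
        by (subst pl_ind_vec_expansion) (simp add: sum_distrib_left mult.left_commute)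
    qed
    also have "\<dots> = (\<Sum>i\<le>N. I01 (\<lambda>x. z i * ((pl N y x - v x) * pl N (ind_vec i) x)))"
      by (intro Henstock_Kurzweil_Integration.integral_sum bdd_meas_integrable' bdd_meas_intros plb v) simp
    also have "\<dots> = (\<Sum>i\<le>N. z i * I01 (\<lambda>x. (pl N y x - v x) * pl N (ind_vec i) x))" by simp
    also have "\<dots> = 0"
    proof (rule sum.neutral, rule ballI)
      fix i assume "i \<in> {..N}"
      then have "i = 0 \<or> i = N \<or> i \<in> {1..<N}" by auto
      then show "z i * I01 (\<lambda>x. (pl N y x - v x) * pl N (ind_vec i) x) = 0" using z hat by auto
    qed
    finally show ?thesis .
  qed
  then show ?thesis using y(1,2) by blast
qed

lemma element_cover:
  assumes "x \<in> {0..1}" "N \<ge> 1"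
  obtains j where "j < N" "x \<in> element N j"
proof (cases "x = 1")
  case True
  \<comment> \<open>The floor used below would give \<open>j = N\<close> at the right endpoint,
    which is no element.\<close>
  show ?thesis by (rule that[of "N - 1"]) (use assms True in \<open>auto simp: divide_simps\<close>)
next
  case False
  define j where "j = nat \<lfloor>x * real N\<rfloor>"
  have "0 \<le> x * real N" using assms by simp
  then have j: "real j \<le> x * real N" "x * real N < real (Suc j)" unfolding j_def by linarith+
  have "x * real N < 1 * real N" using assms False by (intro mult_strict_right_mono) auto
  then have "j < N" using j by simp
  then show ?thesis using j assms by (intro that[of j]) (auto simp: field_simps)
qed

section \<open>The low-order space and \<open>L2_proj\<close> in terms of nodal vectors\<close>

lemma length_T_grid: "length (T_grid L) = Suc (2 ^ L + 1)"
  by (simp add: T_grid_def)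

lemma nth_T_grid: "i \<le> 2 ^ L + 1 \<Longrightarrow> T_grid L ! i = real i / real (2 ^ L + 1)"
  by (simp add: T_grid_def nth_append add.commute del: upt_Suc)

lemma pl_in_pw_poly_space:
  "pl (2 ^ L + 1) y \<in> pw_poly_space 1 (T_grid L) (y 0) (y (2 ^ L + 1))"
proof -
  define N where "N = (2::nat) ^ L + 1"
  have N: "N \<ge> 1" by (simp add: N_def)
  have "\<exists>q :: real poly. degree q \<le> 1 \<and> (\<forall>x\<in>{T_grid L ! i..T_grid L ! Suc i}. pl N y x = poly q x)"
    if "Suc i < length (T_grid L)" for i
  proof -
    have i: "i < N" using that by (simp add: length_T_grid N_def)
    define m where "m = y (Suc i) - y i"
    have T: "{T_grid L ! i..T_grid L ! Suc i} = element N i"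
      using i nth_T_grid[of i L] nth_T_grid[of "Suc i" L] by (simp add: N_def)
    show ?thesis unfolding T
    proof (intro exI[of _ "[:y i - m * real i, m * real N:]"] conjI ballI)
      show "degree [:y i - m * real i, m * real N:] \<le> 1" by simp
      show "pl N y x = poly [:y i - m * real i, m * real N:] x"
        if "x \<in> element N i" for x
        unfolding pl_element[OF i that] m_def by (simp add: algebra_simps)
    qed
  qed
  then show ?thesis
    unfolding pw_poly_space_def N_def[symmetric]
    using has_bdd_derivD(1)[OF has_bdd_deriv_pl[OF N]] pl_0[OF N] pl_1[OF N] by auto
qed

lemma pw_poly_space_T_grid_eq_pl:
  assumes w: "w \<in> pw_poly_space 1 (T_grid L) a d" and x: "x \<in> {0..1}"
  shows "w x = pl (2 ^ L + 1) (nodal (2 ^ L + 1) w) x"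
proof -
  define N where "N = (2::nat) ^ L + 1"
  have N: "N \<ge> 1" by (simp add: N_def)
  obtain j where j: "j < N" "x \<in> element N j"
    using element_cover[OF x N] by blast
  have T: "{T_grid L ! j..T_grid L ! Suc j} = element N j"
    using j nth_T_grid[of j L] nth_T_grid[of "Suc j" L] by (simp add: N_def)
  have "Suc j < length (T_grid L)" using j(1) by (simp add: length_T_grid N_def)
  then obtain q :: "real poly" where q: "degree q \<le> 1"
    "\<And>x. x \<in> element N j \<Longrightarrow> w x = poly q x"
    using w unfolding pw_poly_space_def T[symmetric] by blast
  obtain q0 q1 where q01: "q = [:q0, q1:]" using degree_eq_zeroE q(1)
    by (metis degree_0 degree_pCons_eq_if le_Suc_eq le_zero_eq pCons_cases One_nat_def Suc_inject)
  have "real j / real N \<in> element N j"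
    "real (Suc j) / real N \<in> element N j"
    using node_less_Suc[OF j(1)] by auto
  then have "w (real j / real N) = q0 + real j / real N * q1"
    "w (real (Suc j) / real N) = q0 + real (Suc j) / real N * q1" "w x = q0 + x * q1"
    using q(2) j(2) unfolding q01 by simp_all
  then have "w x = pl N (nodal N w) x"
    unfolding pl_element[OF j] using N by (simp only:) (simp add: field_simps)
  then show ?thesis by (simp add: N_def)
qed

text \<open>Existence of a projection is what allows the choice in \<open>L2_proj\<close> to be
  unfolded. All that is used of \<open>L2_proj\<close> later is contained in these five facts: the
  first four feed the error estimate, the last one the recurrence.\<close>

lemma L2_proj_spec:
  fixes L :: nat and \<alpha>0 \<alpha>1 :: real
  assumes v: "continuous_on {0..1} v"
  defines "N \<equiv> (2::nat) ^ L + 1"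
  defines "w \<equiv> L2_proj \<alpha>0 \<alpha>1 L v"
  defines "y \<equiv> nodal N w"
  shows "y 0 = \<alpha>0" "y N = \<alpha>1" "\<And>x. x \<in> {0..1} \<Longrightarrow> w x = pl N y x"
    "\<And>z. z 0 = 0 \<Longrightarrow> z N = 0 \<Longrightarrow> I01 (\<lambda>x. (pl N y x - v x) * pl N z x) = 0"
    "\<And>i. 1 \<le> i \<Longrightarrow> i < N \<Longrightarrow> y (i - 1) + 4 * y i + y (Suc i) = 6 * real N * I01 (\<lambda>x. v x * pl N (ind_vec i) x)"
proof -
  have N: "N \<ge> 1" by (simp add: N_def)
  note plb = has_bdd_derivD(3)[OF has_bdd_deriv_pl[OF N]]
  note vb = bdd_meas_continuous[OF v]
  let ?P = "\<lambda>w. w \<in> pw_poly_space 1 (T_grid L) \<alpha>0 \<alpha>1 \<and>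
        (\<forall>z\<in>pw_poly_space 1 (T_grid L) 0 0. (LINT x:unit_I|lebesgue. (w x - v x) * z x) = 0)"
  obtain y0 where y0: "y0 0 = \<alpha>0" "y0 N = \<alpha>1"
     "\<And>z. z 0 = 0 \<Longrightarrow> z N = 0 \<Longrightarrow> I01 (\<lambda>x. (pl N y0 x - v x) * pl N z x) = 0"
    using pl_projection_exists[OF vb N] by blast
  have "?P (pl N y0)"
  proof (intro conjI ballI)
    show "pl N y0 \<in> pw_poly_space 1 (T_grid L) \<alpha>0 \<alpha>1"
      using pl_in_pw_poly_space[of L y0] y0 by (simp add: N_def)
    fix z assume z: "z \<in> pw_poly_space 1 (T_grid L) 0 0"
    have zc: "continuous_on {0..1} z" and z01: "z 0 = 0" "z 1 = 0"
      using z unfolding pw_poly_space_def by auto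
    have "(LINT x:unit_I|lebesgue. (pl N y0 x - v x) * z x) = I01 (\<lambda>x. (pl N y0 x - v x) * z x)"
      by (intro bdd_meas_lint bdd_meas_intros plb vb bdd_meas_continuous zc)
    also have "\<dots> = I01 (\<lambda>x. (pl N y0 x - v x) * pl N (nodal N z) x)"
      using pw_poly_space_T_grid_eq_pl[OF z] by (intro integral_cong) (simp add: N_def)
    also have "\<dots> = 0" using z01 N by (intro y0(3)) auto
    finally show "(LINT x:unit_I|lebesgue. (pl N y0 x - v x) * z x) = 0" .
  qed
  then have P: "?P w" unfolding w_def L2_proj_def by (rule someI[where P="?P"])
  show y01: "y 0 = \<alpha>0" "y N = \<alpha>1" using P N by (simp_all add: y_def pw_poly_space_def)
  show wy: "w x = pl N y x" if "x \<in> {0..1}" for x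
    using pw_poly_space_T_grid_eq_pl[of w] P that unfolding y_def N_def by blast
  show orth: "I01 (\<lambda>x. (pl N y x - v x) * pl N z x) = 0" if z: "z 0 = 0" "z N = 0" for z
  proof -
    have "I01 (\<lambda>x. (pl N y x - v x) * pl N z x)
        = (LINT x:unit_I|lebesgue. (pl N y x - v x) * pl N z x)"
      by (intro bdd_meas_lint[symmetric] bdd_meas_intros plb vb)
    also have "\<dots> = (LINT x:unit_I|lebesgue. (w x - v x) * pl N z x)"
      using wy by (intro set_lebesgue_integral_cong) auto
    also have "\<dots> = 0" using P pl_in_pw_poly_space[of L z] z by (simp add: N_def)
    finally show ?thesis .
  qed
  show "y (i - 1) + 4 * y i + y (Suc i) = 6 * real N * I01 (\<lambda>x. v x * pl N (ind_vec i) x)"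
    if i: "1 \<le> i" "i < N" for i
  proof -
    have "0 = I01 (\<lambda>x. pl N y x * pl N (ind_vec i) x - v x * pl N (ind_vec i) x)"
      using orth[of "ind_vec i"] i by (simp add: left_diff_distrib)
    also have "\<dots> = I01 (\<lambda>x. pl N y x * pl N (ind_vec i) x) - I01 (\<lambda>x. v x * pl N (ind_vec i) x)"
      by (intro I01_diff bdd_meas_mult plb vb)
    finally show ?thesis using pl_mass[OF i, of y] N by (simp add: field_simps)
  qed
qed

section \<open>Tensor trains of piecewise recurrent vectors\<close>

lemma bits_sum_less:
  assumes "\<forall>j\<in>{1..L}. d j \<in> {0,1::nat}" "k \<le> L"
  shows "(\<Sum>j=Suc k..L. 2 ^ (L - j) * d j) < (2::nat) ^ (L - k)"
  using assms(2)
proof (induction k rule: inc_induct)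
  case (step n)
  have "d (Suc n) \<in> {0,1}" using assms(1) step.hyps by simp
  then have "d (Suc n) \<le> 1" by auto
  then have "2 ^ (L - Suc n) * d (Suc n) \<le> 2 ^ (L - Suc n)" by (cases "d (Suc n)") auto
  moreover have "(\<Sum>j=Suc n..L. 2 ^ (L - j) * d j)
      = 2 ^ (L - Suc n) * d (Suc n) + (\<Sum>j=Suc (Suc n)..L. 2 ^ (L - j) * d j)"
    using step by (intro sum.atLeast_Suc_atMost) auto
  moreover have "(2::nat) ^ (L - n) = 2 ^ (L - Suc n) + 2 ^ (L - Suc n)"
    using step by (simp add: Suc_diff_Suc flip: power_Suc mult_2)
  ultimately show ?case using step by linarith
qed simp

text \<open>A tensor train is built from one finite family of functions per level such that halving a
  member of one level yields linear combinations of the next level; the coefficients are the cores.\<close>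

lemma qtt_of_refinable_families:
  assumes r: "r 0 = 1" "r L = 1" "\<And>j. 1 \<le> j \<Longrightarrow> j < L \<Longrightarrow> 1 \<le> r j"
    and ref: "\<And>j b k. 1 \<le> j \<Longrightarrow> j \<le> L \<Longrightarrow> b \<in> {0,1} \<Longrightarrow> k < r (j - 1) \<Longrightarrow>
      \<exists>a. \<forall>i<2 ^ (L - j). G (j - 1) k (b * 2 ^ (L - j) + i) = (\<Sum>l<r j. a l * G j l i)"
    and top: "\<And>i. i < 2 ^ L \<Longrightarrow> w i = G 0 0 i" and bot: "G L 0 0 = (1::real)"
  shows "\<exists>V. is_qtt L w r V"
proof -
  define A where "A j b k = (SOME a. \<forall>i<2 ^ (L - j).
      G (j - 1) k (b * 2 ^ (L - j) + i) = (\<Sum>l<r j. a l * G j l i))" for j b k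
  have A: "G (j - 1) k (b * 2 ^ (L - j) + i) = (\<Sum>l<r j. A j b k l * G j l i)"
    if "1 \<le> j" "j \<le> L" "b \<in> {0,1}" "k < r (j - 1)" "i < 2 ^ (L - j)" for j b k i
    using someI_ex[OF ref[OF that(1-4)]] that(5) unfolding A_def by simp
  define V where "V j b = mat (r (j - 1)) (r j) (\<lambda>(k, l). A j b k l)" for j b
  \<comment> \<open>Downward invariant: the product of the cores after position \<open>j\<close> is
    the column of all functions of level \<open>j\<close>, evaluated at the number formed by the
    remaining digits.\<close>
  have prod: "foldr (\<lambda>j A. V j (d j) * A) [Suc j..<L + 1] (1\<^sub>m 1)
      = mat (r j) 1 (\<lambda>(k, _). G j k (\<Sum>m=Suc j..L. 2 ^ (L - m) * d m))"
    if d: "\<forall>j\<in>{1..L}. d j \<in> {0,1}" and "j \<le> L" for d j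
    using that(2)
  proof (induction j rule: inc_induct)
    case base
    show ?case by (rule eq_matI) (auto simp: r bot)
  next
    case (step j)
    let ?s = "\<Sum>m=Suc (Suc j)..L. 2 ^ (L - m) * d m"
    have "[Suc j..<L + 1] = Suc j # [Suc (Suc j)..<L + 1]" using step by (simp add: upt_conv_Cons)
    then have "foldr (\<lambda>j A. V j (d j) * A) [Suc j..<L + 1] (1\<^sub>m 1)
      = V (Suc j) (d (Suc j)) * mat (r (Suc j)) 1 (\<lambda>(k, _). G (Suc j) k ?s)"
      using step.IH by simp
    also have "\<dots> = mat (r j) 1 (\<lambda>(k, _). G j k (\<Sum>m=Suc j..L. 2 ^ (L - m) * d m))"
    proof (rule eq_matI)
      fix k m assume "k < dim_row (mat (r j) 1 (\<lambda>(k, _). G j k (\<Sum>m=Suc j..L. 2 ^ (L - m) * d m)))"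
        "m < dim_col (mat (r j) 1 (\<lambda>(k, _). G j k (\<Sum>m=Suc j..L. 2 ^ (L - m) * d m)))"
      then have k: "k < r j" "m = 0" by auto
      have s: "?s < 2 ^ (L - Suc j)" using step by (intro bits_sum_less[OF d]) auto
      have dj: "d (Suc j) \<in> {0,1}" using d step by auto
      have "(V (Suc j) (d (Suc j)) * mat (r (Suc j)) 1 (\<lambda>(k, _). G (Suc j) k ?s)) $$ (k, m)
          = (\<Sum>l<r (Suc j). A (Suc j) (d (Suc j)) k l * G (Suc j) l ?s)"
        using k by (simp add: V_def scalar_prod_def atLeast0LessThan)
      also have "\<dots> = G j k (d (Suc j) * 2 ^ (L - Suc j) + ?s)"
        using A[of "Suc j" "d (Suc j)" k ?s] step dj k s by simp
      also have "d (Suc j) * 2 ^ (L - Suc j) + ?s = (\<Sum>m=Suc j..L. 2 ^ (L - m) * d m)"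
        using step by (subst (2) sum.atLeast_Suc_atMost) auto
      finally show "(V (Suc j) (d (Suc j)) * mat (r (Suc j)) 1 (\<lambda>(k, _). G (Suc j) k ?s)) $$ (k, m)
          = mat (r j) 1 (\<lambda>(k, _). G j k (\<Sum>m=Suc j..L. 2 ^ (L - m) * d m)) $$ (k, m)"
        using k by simp
    qed (auto simp: V_def)
    finally show ?case .
  qed
  have "is_qtt L w r V"
    unfolding is_qtt_def
  proof (intro conjI ballI allI impI)
    fix d :: "nat \<Rightarrow> nat" assume d: "\<forall>j\<in>{1..L}. d j \<in> {0,1}"
    have "(\<Sum>j=1..L. 2 ^ (L - j) * d j) < 2 ^ L" using bits_sum_less[OF d, of 0] by simp
    then show "w (\<Sum>j=1..L. 2 ^ (L - j) * d j) = foldr (\<lambda>j A. V j (d j) * A) [1..<L + 1] (1\<^sub>m 1) $$ (0, 0)"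
      using prod[OF d, of 0] r top by simp
  qed (use r in \<open>auto simp: V_def\<close>)
  then show ?thesis by blast
qed

text \<open>The \<open>a m\<close> are the lower coefficients of a monic characteristic polynomial
  of degree \<open>R\<close>, hence the minus sign; \<open>z\<close> holds the \<open>R\<close>
  initial values.\<close>

function lin_rec :: "(nat \<Rightarrow> real) \<Rightarrow> nat \<Rightarrow> (nat \<Rightarrow> real) \<Rightarrow> nat \<Rightarrow> real" where
  "lin_rec a R z n = (if n < R then z n else - (\<Sum>m<R. a m * lin_rec a R z (n - R + m)))"
  by pat_completeness auto
termination by (relation "Wellfounded.measure (\<lambda>(a, R, z, n). n)") auto

declare lin_rec.simps [simp del]

lemma lin_rec_step: "lin_rec a R z (i + R) = - (\<Sum>m<R. a m * lin_rec a R z (i + m))"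
  by (subst lin_rec.simps) simp

text \<open>A sequence that obeys the recurrence on a window is determined there by its first
  \<open>R\<close> values, so these are its coefficients in the fundamental solutions with unit
  initial data.\<close>

lemma lin_rec_expand:
  assumes "\<And>i. i + R < n \<Longrightarrow> w (i + R) = - (\<Sum>m<R. a m * w (i + m))" "i < n"
  shows "w i = (\<Sum>k<R. w k * lin_rec a R (ind_vec k) i)"
  using assms(2)
proof (induction i rule: less_induct)
  case (less i)
  show ?case
  proof (cases "i < R")
    case True
    then have "(\<Sum>k<R. w k * lin_rec a R (ind_vec k) i) = (\<Sum>k<R. if k = i then w k else 0)"
      by (intro sum.cong refl) (auto simp: lin_rec.simps)
    then show ?thesis using True by simp
  next
    case False
    define i' where "i' = i - R"
    have i: "i = i' + R" using False by (simp add: i'_def)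
    have IH: "w (i' + m) = (\<Sum>k<R. w k * lin_rec a R (ind_vec k) (i' + m))" if "m < R" for m
      using less that i by auto
    have "w i = - (\<Sum>m<R. a m * (\<Sum>k<R. w k * lin_rec a R (ind_vec k) (i' + m)))"
      using assms(1)[of i'] less.prems IH unfolding i by simp
    also have "(\<Sum>m<R. a m * (\<Sum>k<R. w k * lin_rec a R (ind_vec k) (i' + m)))
        = (\<Sum>k<R. \<Sum>m<R. w k * (a m * lin_rec a R (ind_vec k) (i' + m)))"
      unfolding sum_distrib_left by (subst sum.swap) (simp add: mult.left_commute)
    also have "- \<dots> = (\<Sum>k<R. w k * lin_rec a R (ind_vec k) i)"
      unfolding i lin_rec_step by (simp add: sum_distrib_left sum_negf)
    finally show ?thesis .
  qed
qed

text \<open>Why halving closes: a fundamental solution obeys the recurrence everywhere, so each of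
  its halves can be expanded again. A half of a block marked by \<open>q1\<close> or
  \<open>q2\<close> is either marked on the next level, or free of both indices, where
  \<open>rec\<close> applies. Marked blocks, on which nothing is assumed about \<open>w\<close>, are
  carried along as functions of their own; if both marks share a block the two extra functions
  coincide.\<close>

lemma qtt_of_recurrence:
  fixes w :: "nat \<Rightarrow> real"
  assumes L: "1 \<le> L" and q: "q1 < 2 ^ L" "q2 < 2 ^ L"
    and rec: "\<And>m n i. m + n \<le> 2 ^ L \<Longrightarrow> q1 \<notin> {m..<m + n} \<Longrightarrow> q2 \<notin> {m..<m + n} \<Longrightarrow> i + R < n \<Longrightarrow>
      w (m + (i + R)) = - (\<Sum>k<R. a k * w (m + (i + k)))"
  defines "r \<equiv> (\<lambda>j. if j = 0 \<or> j = L then 1 else R + 2)"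
  shows "\<exists>V. is_qtt L w r V"
proof -
  define g where "g k = lin_rec a R (ind_vec k)" for k
  define s where "s j = (2::nat) ^ (L - j)" for j
  define E where "E j = (\<lambda>l i. if l < R then g l i
      else if l = R then w (q1 div s j * s j + i) else w (q2 div s j * s j + i))" for j
  \<comment> \<open>At level 0 the only block is \<open>w\<close> itself, and at level
    \<open>L\<close> blocks have one entry, so the constant 1 is enough; this yields the end ranks
    1.\<close>
  define G where "G j = (if j = 0 then (\<lambda>_. w) else if j = L then (\<lambda>_ _. 1) else E j)" for j
  have spos: "s j > 0" for j by (simp add: s_def)
  have sL: "2 ^ L = 2 ^ j * s j" if "j \<le> L" for j
    using that by (simp add: s_def flip: power_add)
  have sSuc: "s (j - 1) = 2 * s j" if "1 \<le> j" "j \<le> L" for j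
  proof -
    have "L - (j - 1) = Suc (L - j)" using that by simp
    then show ?thesis by (simp add: s_def)
  qed
  have block: "\<exists>c. \<forall>i<s j. w (m * s j + i) = (\<Sum>l<R + 2. c l * E j l i)"
    if j: "j \<le> L" and m: "m < 2 ^ j" for j m
  proof -
    consider "q1 div s j = m" | "q2 div s j = m" | "q1 div s j \<noteq> m" "q2 div s j \<noteq> m" by blast
    then show ?thesis
    proof cases
      case 1
      have "(\<Sum>l<R + 2. ind_vec R l * E j l i) = E j R i" for i
        by (simp add: if_distrib[of "\<lambda>t. t * _"] cong: if_cong)
      then show ?thesis using 1 by (intro exI[of _ "ind_vec R"]) (simp add: E_def)
    next
      case 2
      have "(\<Sum>l<R + 2. ind_vec (Suc R) l * E j l i) = E j (Suc R) i" for i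
        by (simp add: if_distrib[of "\<lambda>t. t * _"] cong: if_cong)
      then show ?thesis using 2 by (intro exI[of _ "ind_vec (Suc R)"]) (simp add: E_def)
    next
      case 3
      have nq: "q \<notin> {m * s j..<m * s j + s j}" if "q div s j \<noteq> m" for q
      proof
        assume "q \<in> {m * s j..<m * s j + s j}"
        then have "q div s j = m" by (intro div_nat_eqI) (auto simp: algebra_simps)
        then show False using that by simp
      qed
      have "Suc m * s j \<le> 2 ^ j * s j" using m by (intro mult_le_mono1) simp
      then have le: "m * s j + s j \<le> 2 ^ L" using sL[OF j] by simp
      \<comment> \<open>For a block shorter than \<open>R\<close> this reads values of
        \<open>w\<close> beyond its end. They do not matter: the fundamental solutions they multiply
        are still zero on the block.\<close>
      define c where "c l = (if l < R then w (m * s j + l) else 0)" for l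
      have "w (m * s j + i) = (\<Sum>l<R + 2. c l * E j l i)" if i: "i < s j" for i
      proof -
        have "w (m * s j + i) = (\<Sum>k<R. w (m * s j + k) * lin_rec a R (ind_vec k) i)"
          by (rule lin_rec_expand[where w="\<lambda>i. w (m * s j + i)", OF rec[OF le nq[OF 3(1)] nq[OF 3(2)]] i]) simp
        also have "\<dots> = (\<Sum>l<R. c l * E j l i)" by (simp add: c_def E_def g_def)
        also have "\<dots> = (\<Sum>l<R + 2. c l * E j l i)" by (simp add: c_def)
        finally show ?thesis .
      qed
      then show ?thesis by blast
    qed
  qed
  show ?thesis
  proof (rule qtt_of_refinable_families[where G=G])
    fix j b k assume j: "1 \<le> j" "j \<le> L" and b: "b \<in> {0,1::nat}" and k: "k < r (j - 1)"
    show "\<exists>c. \<forall>i<2 ^ (L - j). G (j - 1) k (b * 2 ^ (L - j) + i) = (\<Sum>l<r j. c l * G j l i)"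
    proof (cases "j = L")
      case True
      \<comment> \<open>Each half is a single entry, which is itself the coefficient of the constant
        1.\<close>
      then show ?thesis using L by (intro exI[of _ "\<lambda>_. G (j - 1) k b"]) (simp add: r_def G_def)
    next
      case False
      then have Gj: "G j = E j" and rj: "r j = R + 2" using j by (simp_all add: G_def r_def)
      have "\<exists>c. \<forall>i<s j. G (j - 1) k (b * s j + i) = (\<Sum>l<R + 2. c l * E j l i)"
      proof (cases "j = 1")
        case True
        have "b < 2 ^ j" using True b by auto
        then show ?thesis using block[OF j(2), of b] True unfolding G_def by simp
      next
        case j1: False
        then have Gj1: "G (j - 1) = E (j - 1)" and rj1: "r (j - 1) = R + 2"
          using j False by (auto simp: G_def r_def)
        have sub: "\<exists>c. \<forall>i<s j. w (q div s (j - 1) * s (j - 1) + (b * s j + i)) = (\<Sum>l<R + 2. c l * E j l i)"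
          if "q < 2 ^ L" for q
        proof -
          \<comment> \<open>Number of the half \<open>b\<close> of the marked block among the blocks
            of level \<open>j\<close>.\<close>
          let ?m = "2 * (q div s (j - 1)) + b"
          have "q div s (j - 1) < 2 ^ (j - 1)"
            using that sL[of "j - 1"] j by (simp add: less_mult_imp_div_less)
          moreover have "(2::nat) ^ j = 2 * 2 ^ (j - 1)" using j by (simp flip: power_Suc)
          ultimately have "?m < 2 ^ j" using b by auto
          moreover have "q div s (j - 1) * s (j - 1) + (b * s j + i) = ?m * s j + i" for i
            unfolding sSuc[OF j] by (simp add: algebra_simps)
          ultimately show ?thesis using block[OF j(2)] by metis
        qed
        consider "k < R" | "k = R" | "k = Suc R" using k rj1 by linarith
        then show ?thesis
        proof cases
          case 1
          define c where "c l = (if l < R then g k (b * s j + l) else 0)" for l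
          have "g k (b * s j + i) = (\<Sum>l<R + 2. c l * E j l i)" if i: "i < s j" for i
          proof -
            have "g k (b * s j + i) = (\<Sum>l<R. g k (b * s j + l) * lin_rec a R (ind_vec l) i)"
            proof (rule lin_rec_expand[where w="\<lambda>i. g k (b * s j + i)", OF _ i])
              show "g k (b * s j + (i + R)) = - (\<Sum>m<R. a m * g k (b * s j + (i + m)))" for i
                using lin_rec_step[of a R "ind_vec k" "b * s j + i"] by (simp add: g_def add.assoc)
            qed
            also have "\<dots> = (\<Sum>l<R. c l * E j l i)" by (simp add: c_def E_def g_def)
            also have "\<dots> = (\<Sum>l<R + 2. c l * E j l i)" by (simp add: c_def)
            finally show ?thesis .
          qed
          then show ?thesis using 1 unfolding Gj1 by (intro exI[of _ c]) (simp add: E_def)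
        next
          case 2
          then show ?thesis using sub[OF q(1)] unfolding Gj1 by (simp add: E_def)
        next
          case 3
          then show ?thesis using sub[OF q(2)] unfolding Gj1 by (simp add: E_def)
        qed
      qed
      then show ?thesis unfolding Gj rj by (simp add: s_def)
    qed
  qed (use L in \<open>auto simp: r_def G_def\<close>)
qed

section \<open>Polynomials in the shift operator\<close>

definition apply_poly :: "real poly \<Rightarrow> (nat \<Rightarrow> real) \<Rightarrow> nat \<Rightarrow> real" where
  "apply_poly P w i = (\<Sum>k\<le>degree P. coeff P k * w (i + k))"

lemma apply_poly_bound:
  "degree P \<le> n \<Longrightarrow> apply_poly P w i = (\<Sum>k\<le>n. coeff P k * w (i + k))"
  unfolding apply_poly_def by (rule sum.mono_neutral_left) (auto simp: coeff_eq_0)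

text \<open>\<open>apply_poly P\<close> is P(S) for the shift S, so the factor X - 1 acts as the
  forward difference.\<close>

lemma apply_poly_shift_diff:
  "apply_poly ([:-1, 1:] * P) w i = apply_poly P w (Suc i) - apply_poly P w i"
proof -
  define n where "n = degree P"
  have eq: "[:-1, 1:] * P = pCons 0 P - P" by simp
  have "degree ([:-1, 1:] * P) \<le> Suc n"
    unfolding eq n_def by (intro degree_diff_le) (auto simp: degree_pCons_eq_if)
  then have "apply_poly ([:-1, 1:] * P) w i = (\<Sum>k\<le>Suc n. coeff (pCons 0 P - P) k * w (i + k))"
    unfolding eq by (rule apply_poly_bound)
  also have "\<dots> = (\<Sum>k\<le>Suc n. coeff (pCons 0 P) k * w (i + k)) - (\<Sum>k\<le>Suc n. coeff P k * w (i + k))"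
    by (simp add: left_diff_distrib sum_subtractf)
  also have "(\<Sum>k\<le>Suc n. coeff P k * w (i + k)) = apply_poly P w i"
    by (rule apply_poly_bound[symmetric]) (simp add: n_def)
  also have "(\<Sum>k\<le>Suc n. coeff (pCons 0 P) k * w (i + k)) = apply_poly P w (Suc i)"
    by (subst sum.atMost_Suc_shift) (simp add: apply_poly_def n_def)
  finally show ?thesis .
qed

definition fdiff :: "real poly \<Rightarrow> real poly" where
  "fdiff q = pcompose q [:1, 1:] - q"

lemma poly_fdiff: "poly (fdiff q) x = poly q (x + 1) - poly q x"
  by (simp add: fdiff_def poly_pcompose add.commute)

lemma fdiff_const: "degree q = 0 \<Longrightarrow> fdiff q = 0"
  by (metis degree_eq_zeroE diff_self fdiff_def pcompose_const)

text \<open>The shift preserves the leading coefficient, which therefore cancels. For constants the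
  truncated \<open>degree q - 1\<close> is 0, and \<open>fdiff q\<close> vanishes
  altogether.\<close>

lemma degree_fdiff: "degree (fdiff q) \<le> degree q - 1"
proof (cases "degree q = 0")
  case True
  then show ?thesis by (simp add: fdiff_const)
next
  case False
  have d: "degree (pcompose q [:1, 1:]) = degree q" by (subst degree_pcompose) simp
  have "lead_coeff (pcompose q [:1, 1:]) = lead_coeff q" by (subst lead_coeff_comp) auto
  then have "coeff (fdiff q) (degree q) = 0" unfolding fdiff_def d by simp
  moreover have "degree (fdiff q) \<le> degree q" unfolding fdiff_def by (intro degree_diff_le) (auto simp: d)
  ultimately have "fdiff q = 0 \<or> degree (fdiff q) < degree q" by (intro eq_zero_or_degree_less)
  then show ?thesis by auto
qed

text \<open>Each difference consumes one sample and lowers the degree by one. The disjunct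
  \<open>q = 0\<close> is the one that remains at \<open>n = 0\<close>, where no degree is below
  \<open>n\<close>.\<close>

lemma apply_power_shift_diff_eq_0:
  assumes "\<And>k. k \<le> n \<Longrightarrow> apply_poly P w (i + k) = poly q (real k)" "degree q < n \<or> q = 0"
  shows "apply_poly ([:-1, 1:] ^ n * P) w i = 0"
  using assms
proof (induction n arbitrary: P q)
  case 0
  then show ?case by simp
next
  case (Suc n)
  have "apply_poly ([:-1, 1:] ^ n * ([:-1, 1:] * P)) w i = 0"
  proof (rule Suc.IH)
    show "apply_poly ([:-1, 1:] * P) w (i + k) = poly (fdiff q) (real k)" if "k \<le> n" for k
      using Suc.prems(1)[of k] Suc.prems(1)[of "Suc k"] that
      unfolding apply_poly_shift_diff poly_fdiff by (simp add: add.commute)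
    show "degree (fdiff q) < n \<or> fdiff q = 0"
      using degree_fdiff[of q] fdiff_const[of q] Suc.prems(2) by (cases "degree q = 0") auto
  qed
  then show ?case by (simp only: power_Suc2 mult.assoc)
qed

lemma poly_antiderivative: "\<exists>Q :: real poly. pderiv Q = q \<and> degree Q \<le> Suc (degree q)"
proof (intro exI conjI)
  let ?Q = "\<Sum>k\<le>degree q. monom (coeff q k / real (Suc k)) (Suc k)"
  have "pderiv ?Q = (\<Sum>k\<le>degree q. monom (coeff q k) k)"
    using higher_pderiv_sum[of 1 "\<lambda>k. monom (coeff q k / real (Suc k)) (Suc k)" "{..degree q}"]
    by (simp add: pderiv_monom del: of_nat_Suc)
  then show "pderiv ?Q = q" by (simp add: poly_as_sum_of_monoms)
  show "degree ?Q \<le> Suc (degree q)"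
    by (intro degree_sum_le) (auto intro: order_trans[OF degree_monom_le])
qed

text \<open>The second derivative of a hat is \<open>N\<close> times the second difference of point
  masses, so two integrations by parts move it onto \<open>Q\<close>; the terms with
  \<open>pderiv Q\<close> at the middle node cancel. \<open>v\<close> is prescribed only on the
  support of the hat.\<close>

lemma hat_quadrature:
  assumes v: "bdd_meas v" and i: "1 \<le> i" "i < N"
    and q: "\<And>x. x \<in> {real (i - 1) / real N..real (Suc i) / real N} \<Longrightarrow> v x = poly (pderiv (pderiv Q)) x"
  shows "I01 (\<lambda>x. v x * pl N (ind_vec i) x)
    = real N * (poly Q (real (Suc i) / real N) - 2 * poly Q (real i / real N) + poly Q (real (i - 1) / real N))"
proof -
  have N: "N \<ge> 1" "real N > 0" using i by auto
  note plb = has_bdd_derivD(3)[OF has_bdd_deriv_pl[OF N(1)]]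
  let ?K = "\<lambda>j. element N j"
  let ?Q1 = "pderiv Q" and ?q = "pderiv (pderiv Q)"
  obtain m where m: "i = Suc m" using i by (cases i) auto
  have node: "real j / real N * real N = real j" for j using N by simp
  have le: "real j / real N \<le> real (Suc j) / real N" for j by (simp add: divide_right_mono)
  have zero: "integral (?K j) (\<lambda>x. v x * pl N (ind_vec i) x) = 0" if "j < N" "j \<notin> {m, i}" for j
  proof -
    have "integral (?K j) (\<lambda>x. v x * pl N (ind_vec i) x) = integral (?K j) (\<lambda>x. 0)"
      using that pl_element[OF that(1), of _ "ind_vec i"] m by (intro integral_cong) auto
    then show ?thesis by simp
  qed
  have left: "integral (?K m) (\<lambda>x. v x * pl N (ind_vec i) x)
      = poly ?Q1 (real i / real N) - real N * (poly Q (real i / real N) - poly Q (real m / real N))"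
  proof -
    define F where "F x = poly ?Q1 x * (x * real N - real m) - real N * poly Q x" for x
    have "((\<lambda>x. poly ?q x * (x * real N - real m)) has_integral (F (real (Suc m) / real N) - F (real m / real N))) (?K m)"
    proof (rule fundamental_theorem_of_calculus[OF le])
      fix x
      have "(F has_real_derivative (poly ?q x * (x * real N - real m) + (1 * real N - 0) * poly ?Q1 x - real N * poly ?Q1 x))
          (at x within ?K m)"
        unfolding F_def by (intro DERIV_diff DERIV_mult DERIV_cmult DERIV_cmult_right DERIV_ident DERIV_const
            has_field_derivative_at_within[OF poly_DERIV])
      then show "(F has_vector_derivative poly ?q x * (x * real N - real m)) (at x within ?K m)"
        by (simp add: has_real_derivative_iff_has_vector_derivative)
    qed
    moreover have "integral (?K m) (\<lambda>x. v x * pl N (ind_vec i) x) = integral (?K m) (\<lambda>x. poly ?q x * (x * real N - real m))"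
    proof (rule integral_cong)
      fix x assume x: "x \<in> ?K m"
      have "x \<in> {real (i - 1) / real N..real (Suc i) / real N}" using x le[of i] m by auto
      then show "v x * pl N (ind_vec i) x = poly ?q x * (x * real N - real m)"
        using q[of x] pl_element[of m N x "ind_vec i"] x i m by simp
    qed
    ultimately have "integral (?K m) (\<lambda>x. v x * pl N (ind_vec i) x) = F (real (Suc m) / real N) - F (real m / real N)"
      by (simp only: integral_unique)
    then show ?thesis unfolding F_def node m by (simp add: algebra_simps)
  qed
  have right: "integral (?K i) (\<lambda>x. v x * pl N (ind_vec i) x)
      = - poly ?Q1 (real i / real N) + real N * (poly Q (real (Suc i) / real N) - poly Q (real i / real N))"
  proof -
    define F where "F x = poly ?Q1 x * (real (Suc i) - x * real N) + real N * poly Q x" for x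
    have "((\<lambda>x. poly ?q x * (real (Suc i) - x * real N)) has_integral (F (real (Suc i) / real N) - F (real i / real N))) (?K i)"
    proof (rule fundamental_theorem_of_calculus[OF le])
      fix x
      have "(F has_real_derivative (poly ?q x * (real (Suc i) - x * real N) + (0 - 1 * real N) * poly ?Q1 x + real N * poly ?Q1 x))
          (at x within ?K i)"
        unfolding F_def by (intro DERIV_add DERIV_diff DERIV_mult DERIV_cmult DERIV_cmult_right DERIV_ident DERIV_const
            has_field_derivative_at_within[OF poly_DERIV])
      then show "(F has_vector_derivative poly ?q x * (real (Suc i) - x * real N)) (at x within ?K i)"
        by (simp add: has_real_derivative_iff_has_vector_derivative)
    qed
    moreover have "integral (?K i) (\<lambda>x. v x * pl N (ind_vec i) x) = integral (?K i) (\<lambda>x. poly ?q x * (real (Suc i) - x * real N))"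
    proof (rule integral_cong)
      fix x assume x: "x \<in> ?K i"
      have "x \<in> {real (i - 1) / real N..real (Suc i) / real N}" using x le[of m] m by auto
      moreover have "pl N (ind_vec i) x = real (Suc i) - x * real N"
        using pl_element[of i N x "ind_vec i"] x i by simp
      ultimately show "v x * pl N (ind_vec i) x = poly ?q x * (real (Suc i) - x * real N)"
        using q[of x] by simp
    qed
    ultimately have "integral (?K i) (\<lambda>x. v x * pl N (ind_vec i) x) = F (real (Suc i) / real N) - F (real i / real N)"
      by (simp only: integral_unique)
    then show ?thesis unfolding F_def node by (simp add: algebra_simps)
  qed
  have "I01 (\<lambda>x. v x * pl N (ind_vec i) x) = (\<Sum>j<N. integral (?K j) (\<lambda>x. v x * pl N (ind_vec i) x))"
    by (rule integral_elements[OF bdd_meas_mult[OF v plb] N(1)])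
  also have "\<dots> = (\<Sum>j\<in>{m, i}. integral (?K j) (\<lambda>x. v x * pl N (ind_vec i) x))"
    by (rule sum.mono_neutral_right) (use i m zero in auto)
  also have "\<dots> = integral (?K m) (\<lambda>x. v x * pl N (ind_vec i) x) + integral (?K i) (\<lambda>x. v x * pl N (ind_vec i) x)"
    using m by simp
  finally show ?thesis unfolding left right using m by (simp add: algebra_simps)
qed

text \<open>The characteristic polynomial of the recurrence for the nodal values: the factor \<open>X\<^sup>2 + 4X + 1\<close>
  is the mass matrix, the remaining one annihilates the right-hand side, a polynomial of degree at most \<open>p\<close>
  in the index.\<close>

definition char_poly_rec :: "nat \<Rightarrow> real poly" where
  "char_poly_rec p = [:-1, 1:] ^ Suc p * [:1, 4, 1:]"

lemma degree_char_poly_rec: "degree (char_poly_rec p) = p + 3"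
  and lead_coeff_char_poly_rec: "lead_coeff (char_poly_rec p) = 1"
proof -
  have "degree ([:-1, 1:] ^ Suc p :: real poly) = Suc p" by (rule degree_linear_power)
  moreover have "([:-1, 1:] ^ Suc p :: real poly) \<noteq> 0" by (rule power_not_zero) simp
  ultimately show "degree (char_poly_rec p) = p + 3"
    unfolding char_poly_rec_def by (subst degree_mult_eq) (auto simp del: power_Suc)
  show "lead_coeff (char_poly_rec p) = 1"
    unfolding char_poly_rec_def lead_coeff_mult lead_coeff_power by simp
qed

text \<open>By \<open>hat_quadrature\<close> the right-hand sides are second differences of a
  polynomial of degree at most p + 2 in the index, hence of degree at most p, and p + 1 further
  differences annihilate them. The nodes \<open>s\<close> to \<open>s + (p + 3)\<close> contain
  exactly the p + 2 rows that these differences need.\<close>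

lemma nodal_recurrence:
  assumes v: "bdd_meas v"
    and y: "\<And>i. 1 \<le> i \<Longrightarrow> i < N \<Longrightarrow> y (i - 1) + 4 * y i + y (Suc i) = 6 * real N * I01 (\<lambda>x. v x * pl N (ind_vec i) x)"
    and s: "s + (p + 3) \<le> N"
    and q: "degree q \<le> p" "\<And>x. x \<in> {real s / real N..real (s + (p + 3)) / real N} \<Longrightarrow> v x = poly q x"
  shows "y (s + (p + 3)) = - (\<Sum>k<p + 3. coeff (char_poly_rec p) k * y (s + k))"
proof -
  have N: "real N > 0" using s by simp
  obtain Q1 where Q1: "pderiv Q1 = q" "degree Q1 \<le> Suc p"
    using poly_antiderivative[of q] order_trans[OF _ Suc_le_mono[THEN iffD2, OF q(1)]] by blast
  obtain Q where Q: "pderiv Q = Q1" "degree Q \<le> Suc (Suc p)"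
    using poly_antiderivative[of Q1] order_trans[OF _ Suc_le_mono[THEN iffD2, OF Q1(2)]] by blast
  \<comment> \<open>\<open>Q\<close> as a polynomial in the node index counted from
    \<open>s\<close>, so that \<open>fdiff\<close> is the difference between neighbouring
    nodes.\<close>
  define T where "T = pcompose Q [:real s / real N, 1 / real N:]"
  have T: "poly T t = poly Q ((real s + t) / real N)" for t
    by (simp add: T_def poly_pcompose add_divide_distrib)
  have "degree T \<le> Suc (Suc p)"
    using Q(2) N unfolding T_def by (subst degree_pcompose) simp
  then have dT: "degree (fdiff (fdiff T)) < Suc p"
    using degree_fdiff[of T] degree_fdiff[of "fdiff T"] by linarith
  have mass: "apply_poly [:1, 4, 1:] y j = y j + 4 * y (Suc j) + y (Suc (Suc j))" for j
    by (simp add: apply_poly_def numeral_2_eq_2)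
  have "apply_poly ([:-1, 1:] ^ Suc p * [:1, 4, 1:]) y s = 0"
  proof (rule apply_power_shift_diff_eq_0)
    show "apply_poly [:1, 4, 1:] y (s + k) = poly ([:6 * (real N)\<^sup>2:] * fdiff (fdiff T)) (real k)"
      if k: "k \<le> Suc p" for k
    proof -
      let ?i = "Suc (s + k)"
      have i: "1 \<le> ?i" "?i < N" using k s by auto
      have "apply_poly [:1, 4, 1:] y (s + k) = y (?i - 1) + 4 * y ?i + y (Suc ?i)"
        unfolding mass by simp
      also have "\<dots> = 6 * real N * I01 (\<lambda>x. v x * pl N (ind_vec ?i) x)" by (rule y[OF i])
      also have "I01 (\<lambda>x. v x * pl N (ind_vec ?i) x)
        = real N * (poly Q (real (Suc ?i) / real N) - 2 * poly Q (real ?i / real N) + poly Q (real (?i - 1) / real N))"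
      proof (rule hat_quadrature[OF v i])
        fix x assume x: "x \<in> {real (?i - 1) / real N..real (Suc ?i) / real N}"
        have "real s / real N \<le> real (?i - 1) / real N" by (rule divide_right_mono) auto
        moreover have "real (Suc ?i) / real N \<le> real (s + (p + 3)) / real N"
          using k by (intro divide_right_mono) auto
        ultimately have "x \<in> {real s / real N..real (s + (p + 3)) / real N}" using x by auto
        then show "v x = poly (pderiv (pderiv Q)) x" using q(2) Q Q1 by simp
      qed
      also have "6 * real N * (real N * (poly Q (real (Suc ?i) / real N) - 2 * poly Q (real ?i / real N) + poly Q (real (?i - 1) / real N)))
         = poly ([:6 * (real N)\<^sup>2:] * fdiff (fdiff T)) (real k)"
        by (simp add: poly_fdiff T power2_eq_square algebra_simps)
      finally show ?thesis .
    qed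
    show "degree ([:6 * (real N)\<^sup>2:] * fdiff (fdiff T)) < Suc p \<or> [:6 * (real N)\<^sup>2:] * fdiff (fdiff T) = 0"
      using dT by (intro disjI1) (rule order_le_less_trans[OF degree_mult_le], simp)
  qed
  then have "(\<Sum>k\<le>p + 3. coeff (char_poly_rec p) k * y (s + k)) = 0"
    unfolding char_poly_rec_def[symmetric] apply_poly_def degree_char_poly_rec .
  moreover have "(\<Sum>k\<le>p + 3. coeff (char_poly_rec p) k * y (s + k))
      = (\<Sum>k<p + 3. coeff (char_poly_rec p) k * y (s + k)) + coeff (char_poly_rec p) (p + 3) * y (s + (p + 3))"
    by (simp only: lessThan_Suc_atMost[symmetric] sum.lessThan_Suc)
  moreover have "coeff (char_poly_rec p) (p + 3) = 1"
    using lead_coeff_char_poly_rec[of p] unfolding degree_char_poly_rec .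
  ultimately show ?thesis by simp
qed

section \<open>Regularity of analytic data up to the endpoints\<close>

lemma real_analytic_local_deriv:
  assumes "real_analytic_on g {0..1}" "x \<in> {0..1}"
  shows "\<exists>\<rho>>0. \<exists>D. \<forall>y\<in>{0..1}. \<bar>y - x\<bar> < \<rho> \<longrightarrow>
    (g has_real_derivative D y) (at y within {0..1}) \<and> isCont D y"
proof -
  obtain r a where r: "r > 0" "\<And>y. y \<in> {0..1} \<Longrightarrow> \<bar>y - x\<bar> < r \<Longrightarrow> (\<lambda>n. a n * (y - x) ^ n) sums g y"
    using assms unfolding real_analytic_on_def by blast
  define \<rho> where "\<rho> = min (r / 2) (1 / 2)"
  \<comment> \<open>The series is compared with \<open>g\<close> at points of [0,1] only.
    \<open>K\<close> is a step of length \<open>\<rho>\<close> that stays in [0,1], to the right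
    from the left half and to the left otherwise; convergence there implies convergence for all
    \<open>\<bar>t\<bar> < \<rho>\<close>, on both sides.\<close>
  define K where "K = (if x \<le> 1 / 2 then \<rho> else - \<rho>)"
  have \<rho>: "0 < \<rho>" "\<rho> < r" "\<rho> \<le> 1 / 2" using r(1) by (auto simp: \<rho>_def min_def)
  have "x + K \<in> {0..1}" "\<bar>(x + K) - x\<bar> < r" using assms(2) \<rho> by (auto simp: K_def)
  then have "summable (\<lambda>n. a n * ((x + K) - x) ^ n)" using r(2) sums_summable by blast
  then have sK: "summable (\<lambda>n. a n * K ^ n)" by simp
  have nK: "norm K = \<rho>" using \<rho>(1) by (simp add: K_def)
  define D where "D y = (\<Sum>n. diffs a n * (y - x) ^ n)" for y
  have "(g has_real_derivative D y) (at y within {0..1}) \<and> isCont D y" if y: "y \<in> {0..1}" "\<bar>y - x\<bar> < \<rho>" for y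
  proof
    have "((\<lambda>t. \<Sum>n. a n * t ^ n) has_real_derivative D y) (at (y - x))"
      unfolding D_def by (rule termdiffs_strong[OF sK]) (use nK y(2) in simp)
    moreover have "((\<lambda>y. y - x) has_real_derivative 1) (at y)" by (auto intro!: derivative_eq_intros)
    ultimately have "((\<lambda>y. \<Sum>n. a n * (y - x) ^ n) has_real_derivative D y * 1) (at y)"
      by (rule DERIV_chain2)
    then have "((\<lambda>y. \<Sum>n. a n * (y - x) ^ n) has_real_derivative D y) (at y within {0..1})"
      by (simp add: has_field_derivative_at_within)
    then show "(g has_real_derivative D y) (at y within {0..1})"
    proof (rule has_field_derivative_transform_within)
      show "0 < \<rho> - \<bar>y - x\<bar>" using y(2) by simp
      show "(\<Sum>n. a n * (z - x) ^ n) = g z" if "z \<in> {0..1}" "dist z y < \<rho> - \<bar>y - x\<bar>" for z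
      proof -
        have "\<bar>z - x\<bar> < r" using that(2) \<rho>(2) unfolding dist_real_def by linarith
        then show ?thesis using sums_unique[OF r(2)[OF that(1)]] by simp
      qed
    qed (use y in simp)
    \<comment> \<open>A radius strictly between \<open>\<bar>y - x\<bar>\<close> and
      \<open>\<rho>\<close>, at which the differentiated series still converges.\<close>
    define M where "M = (\<bar>y - x\<bar> + \<rho>) / 2"
    have M: "\<bar>y - x\<bar> < \<bar>M\<bar>" "\<bar>M\<bar> < \<rho>" using y(2) by (auto simp: M_def)
    have "summable (\<lambda>n. diffs a n * M ^ n)"
    proof (rule termdiff_converges)
      show "norm M < \<rho>" using M by simp
      show "summable (\<lambda>n. a n * t ^ n)" if "norm t < \<rho>" for t
        by (rule powser_inside[OF sK]) (use that nK in simp)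
    qed
    then have "isCont (\<lambda>t. \<Sum>n. diffs a n * t ^ n) (y - x)"
      by (rule isCont_powser) (use M in auto)
    moreover have "isCont (\<lambda>y. y - x) y" by (intro isCont_diff continuous_ident continuous_const)
    ultimately show "isCont D y"
      unfolding D_def[abs_def] by (rule isCont_o2[rotated])
  qed
  then show ?thesis using \<rho>(1) by blast
qed

text \<open>Derivatives found near different points come from different series. Uniqueness of the
  derivative within the nondegenerate interval [0,1] glues them, and continuity is then a local
  matter.\<close>

lemma real_analytic_C1:
  assumes "real_analytic_on g {0..1}"
  obtains g' where "continuous_on {0..1} g'"
    "\<And>x. x \<in> {0..1} \<Longrightarrow> (g has_real_derivative g' x) (at x within {0..1})"
proof -
  define g' where "g' x = (SOME d. (g has_real_derivative d) (at x within {0..1}))" for x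
  have ex: "(g has_real_derivative g' x) (at x within {0..1})" if "x \<in> {0..1}" for x
  proof -
    have "\<exists>d. (g has_real_derivative d) (at x within {0..1})"
      using real_analytic_local_deriv[OF assms that] that by (metis abs_zero diff_self)
    then show ?thesis unfolding g'_def by (rule someI_ex)
  qed
  have "continuous (at x within {0..1}) g'" if x: "x \<in> {0..1}" for x
  proof -
    obtain \<rho> D where D: "\<rho> > 0" "\<And>y. y \<in> {0..1} \<Longrightarrow> \<bar>y - x\<bar> < \<rho> \<Longrightarrow>
        (g has_real_derivative D y) (at y within {0..1}) \<and> isCont D y"
      using real_analytic_local_deriv[OF assms x] by blast
    have eq: "D y = g' y" if "y \<in> {0..1}" "\<bar>y - x\<bar> < \<rho>" for y
    proof (rule vector_derivative_unique_within_closed_interval[of 0 1 y g])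
      show "(g has_vector_derivative D y) (at y within cbox 0 1)"
        using D(2)[OF that] by (simp add: has_real_derivative_iff_has_vector_derivative)
      show "(g has_vector_derivative g' y) (at y within cbox 0 1)"
        using ex[OF that(1)] by (simp add: has_real_derivative_iff_has_vector_derivative)
    qed (use that in auto)
    have "isCont D x" using D(2)[OF x] D(1) by simp
    then have "continuous (at x within {0..1}) D" by (rule continuous_at_imp_continuous_at_within)
    then show ?thesis
      by (rule continuous_transform_within[OF _ D(1) x]) (use eq in \<open>auto simp: dist_real_def\<close>)
  qed
  then have "continuous_on {0..1} g'" by (simp add: continuous_on_eq_continuous_within)
  then show thesis using ex by (rule that)
qed

lemma has_bdd_deriv_within:
  assumes "continuous_on {0..1} g'" "\<And>x. x \<in> {0..1} \<Longrightarrow> (g has_real_derivative g' x) (at x within {0..1})"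
  shows "has_bdd_deriv g g'"
proof (rule has_bdd_deriv_C1[OF _ DERIV_continuous_on[OF assms(2)] assms(1)])
  fix x :: real assume x: "x \<in> unit_I"
  have "(g has_real_derivative g' x) (at x within {0..1})" using x by (intro assms(2)) auto
  then have "(g has_real_derivative g' x) (at x within unit_I)" by (rule DERIV_subset) auto
  moreover have "at x within unit_I = at x" using x by (intro at_within_open) auto
  ultimately show "(g has_real_derivative g' x) (at x)" by (simp only:)
qed

section \<open>Piecewise polynomials on the hp mesh and their projections\<close>

lemma bdd_meas_if:
  assumes "bdd_meas f" "bdd_meas g"
  shows "bdd_meas (\<lambda>x. if x < m then f x else g x)"
proof -
  obtain B C where B: "\<forall>x\<in>{0..1}. \<bar>f x\<bar> \<le> B" "\<forall>x\<in>{0..1}. \<bar>g x\<bar> \<le> C"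
    using assms unfolding bdd_meas_def by blast
  have "Measurable.pred (lebesgue_on {0..1}) (\<lambda>x. x < m)"
    by (intro measurable_restrict_space1 measurable_completion) simp
  then have "(\<lambda>x. if x < m then f x else g x) \<in> borel_measurable (lebesgue_on {0..1})"
    using assms unfolding bdd_meas_def pred_def by (intro measurable_If) blast+
  moreover have "\<forall>x\<in>{0..1}. \<bar>if x < m then f x else g x\<bar> \<le> max B C" using B by fastforce
  ultimately show ?thesis unfolding bdd_meas_def by blast
qed

lemma T_hp_pieces:
  assumes v: "v \<in> pw_poly_space p (T_hp \<kappa>) a b" and \<kappa>: "\<kappa> > 0"
  obtains m q0 q1 q2 where "0 < m" "m \<le> 1 / 4"
    "degree q0 \<le> p" "degree q1 \<le> p" "degree q2 \<le> p"
    "\<And>x. x \<in> {0..m} \<Longrightarrow> v x = poly q0 x" "\<And>x. x \<in> {m..1 - m} \<Longrightarrow> v x = poly q1 x"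
    "\<And>x. x \<in> {1 - m..1} \<Longrightarrow> v x = poly q2 x"
proof -
  define m where "m = min (1 / 4) \<kappa>"
  have T: "T_hp \<kappa> = [0, m, 1 - m, 1]" by (simp add: T_hp_def m_def)
  have *: "\<exists>q :: real poly. degree q \<le> p \<and> (\<forall>x\<in>{T_hp \<kappa> ! i..T_hp \<kappa> ! Suc i}. v x = poly q x)" if "i < 3" for i
    using v that unfolding pw_poly_space_def T by auto
  obtain q0 where "degree q0 \<le> p" "\<forall>x\<in>{0..m}. v x = poly q0 x" using *[of 0] unfolding T by auto
  moreover obtain q1 where "degree q1 \<le> p" "\<forall>x\<in>{m..1 - m}. v x = poly q1 x" using *[of 1] unfolding T by auto
  moreover obtain q2 where "degree q2 \<le> p" "\<forall>x\<in>{1 - m..1}. v x = poly q2 x" using *[of 2] unfolding T by auto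
  moreover have "0 < m" "m \<le> 1 / 4" using \<kappa> by (auto simp: m_def)
  ultimately show thesis by (intro that[of m q0 q1 q2]) auto
qed

lemma T_hp_has_bdd_deriv:
  assumes v: "v \<in> pw_poly_space p (T_hp \<kappa>) a b" and \<kappa>: "\<kappa> > 0"
  shows "\<exists>v'. has_bdd_deriv v v'"
proof -
  obtain m q0 q1 q2 where m: "0 < m" "m \<le> 1 / 4" 
    and q0: "\<And>x. x \<in> {0..m} \<Longrightarrow> v x = poly q0 x" and q1: "\<And>x. x \<in> {m..1 - m} \<Longrightarrow> v x = poly q1 x"
    and q2: "\<And>x. x \<in> {1 - m..1} \<Longrightarrow> v x = poly q2 x"
    using T_hp_pieces[OF v \<kappa>] by metis
  define v' where "v' x = (if x < m then poly (pderiv q0) x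
      else if x < 1 - m then poly (pderiv q1) x else poly (pderiv q2) x)" for x
  have "bdd_meas v'"
    unfolding v'_def by (intro bdd_meas_if bdd_meas_continuous continuous_intros)
  moreover have "(v has_real_derivative v' x) (at x)" if x: "x \<in> unit_I - {m, 1 - m}" for x
  proof -
    have piece: "(v has_real_derivative poly (pderiv q) x) (at x)"
      if "lo < x" "x < hi" "\<And>x. x \<in> {lo..hi} \<Longrightarrow> v x = poly q x" for lo hi q
      by (rule has_field_derivative_transform_within_open[OF poly_DERIV, of "{lo<..<hi}"]) (use that in auto)
    consider "x < m" | "m < x" "x < 1 - m" | "1 - m < x" using x by force
    then show ?thesis
    proof cases
      case 1
      then show ?thesis using piece[of 0 m q0] q0 x by (simp add: v'_def)
    next
      case 2
      then show ?thesis using piece[of m "1 - m" q1] q1 by (simp add: v'_def)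
    next
      case 3
      then show ?thesis using piece[of "1 - m" 1 q2] q2 x m by (simp add: v'_def)
    qed
  qed
  moreover have "continuous_on {0..1} v" using v unfolding pw_poly_space_def by blast
  ultimately have "has_bdd_deriv v v'"
    unfolding has_bdd_deriv_def by (intro conjI exI[of _ "{m, 1 - m}"]) auto
  then show ?thesis by blast
qed

text \<open>If \<open>\<xi>\<close> lay strictly inside a stencil of nodes, the last node not
  exceeding \<open>\<xi>\<close> would belong to the stencil without being its end; so avoiding one
  index keeps all stencils of the window on one side of \<open>\<xi>\<close>.\<close>

lemma breakpoint_index:
  fixes \<xi> :: real
  assumes "0 < \<xi>" "\<xi> < 1"
  obtains q where "q < 2 ^ L"
    "\<And>m n i R. q \<notin> {m..<m + n} \<Longrightarrow> i + R < n \<Longrightarrow>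
      \<xi> \<le> real (m + i + 1) / real (2 ^ L + 1) \<or> real (m + i + 1 + R) / real (2 ^ L + 1) \<le> \<xi>"
proof -
  define N where "N = (2::nat) ^ L + 1"
  have N: "real N > 0" unfolding N_def by (simp only: of_nat_0_less_iff)
  define k where "k = nat \<lfloor>\<xi> * real N\<rfloor>"
  have "0 \<le> \<xi> * real N" using assms N by simp
  then have k: "real k \<le> \<xi> * real N" "\<xi> * real N < real k + 1" unfolding k_def by linarith+
  have "\<xi> * real N < 1 * real N" using assms N by (intro mult_strict_right_mono) auto
  then have kN: "k < N" using k by simp
  \<comment> \<open>Entry \<open>i\<close> of the vector belongs to node \<open>i + 1\<close>, so
    node \<open>k\<close> is entry \<open>k - 1\<close>. For \<open>k = 0\<close> the truncated
    value 0 is harmless, since every stencil starts at node 1 or later.\<close>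
  show thesis
  proof (rule that[of "k - 1"])
    show "k - 1 < 2 ^ L" using kN by (cases k) (auto simp: N_def)
    fix m n i R assume q: "k - 1 \<notin> {m..<m + n}" and i: "i + R < n"
    have "\<xi> \<le> real (m + i + 1) / real N \<or> real (m + i + 1 + R) / real N \<le> \<xi>"
    proof (rule ccontr)
      assume "\<not> ?thesis"
      then have "real (m + i + 1) < \<xi> * real N" "\<xi> * real N < real (m + i + 1 + R)"
        using N by (auto simp: field_simps)
      then have "real (m + i + 1) < real (k + 1)" "real k < real (m + i + 1 + R)" using k by simp_all
      then have "m + i + 1 \<le> k" "k < m + i + 1 + R" unfolding of_nat_less_iff by simp_all
      then show False using q i by auto
    qed
    then show "\<xi> \<le> real (m + i + 1) / real (2 ^ L + 1) \<or> real (m + i + 1 + R) / real (2 ^ L + 1) \<le> \<xi>"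
      by (simp add: N_def)
  qed
qed

lemma qtt_L2_proj:
  assumes L: "1 \<le> L" and v: "v \<in> pw_poly_space p (T_hp \<kappa>) a b" and \<kappa>: "\<kappa> > 0"
  defines "r \<equiv> (\<lambda>j. if j = 0 \<or> j = L then 1 else p + 5)"
  shows "\<exists>V. is_qtt_wrt L (T_int L) (L2_proj \<alpha>0 \<alpha>1 L v) r V"
proof -
  define N where "N = (2::nat) ^ L + 1"
  obtain m q0 q1 q2 where m: "0 < m" "m \<le> 1 / 4"
    and deg: "degree q0 \<le> p" "degree q1 \<le> p" "degree q2 \<le> p"
    and vq: "\<And>x. x \<in> {0..m} \<Longrightarrow> v x = poly q0 x" "\<And>x. x \<in> {m..1 - m} \<Longrightarrow> v x = poly q1 x"
    "\<And>x. x \<in> {1 - m..1} \<Longrightarrow> v x = poly q2 x"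
    using T_hp_pieces[OF v \<kappa>] by metis
  have vc: "continuous_on {0..1} v" using v unfolding pw_poly_space_def by blast
  define P where "P = L2_proj \<alpha>0 \<alpha>1 L v"
  define y where "y = nodal N P"
  have eqn: "y (i - 1) + 4 * y i + y (Suc i) = 6 * real N * I01 (\<lambda>x. v x * pl N (ind_vec i) x)"
    if "1 \<le> i" "i < N" for i
    unfolding y_def P_def N_def by (rule L2_proj_spec(5)[OF vc]) (use that in \<open>simp_all add: N_def\<close>)
  obtain k1 where k1: "k1 < 2 ^ L" "\<And>m' n i R. k1 \<notin> {m'..<m' + n} \<Longrightarrow> i + R < n \<Longrightarrow>
      m \<le> real (m' + i + 1) / real N \<or> real (m' + i + 1 + R) / real N \<le> m"
    using breakpoint_index[of m L] m unfolding N_def by auto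
  obtain k2 where k2: "k2 < 2 ^ L" "\<And>m' n i R. k2 \<notin> {m'..<m' + n} \<Longrightarrow> i + R < n \<Longrightarrow>
      1 - m \<le> real (m' + i + 1) / real N \<or> real (m' + i + 1 + R) / real N \<le> 1 - m"
    using breakpoint_index[of "1 - m" L] m unfolding N_def by auto
  let ?R = "p + 3"
  \<comment> \<open>The interior grid starts at node 1, which shifts entries against nodes by
    one.\<close>
  define w where "w i = y (Suc i)" for i
  have r: "r = (\<lambda>j. if j = 0 \<or> j = L then 1 else ?R + 2)" unfolding r_def by auto
  have "\<exists>V. is_qtt L w r V" unfolding r
  proof (rule qtt_of_recurrence[OF L k1(1) k2(1)])
    fix m' n i
    assume n: "m' + n \<le> 2 ^ L" and k: "k1 \<notin> {m'..<m' + n}" "k2 \<notin> {m'..<m' + n}" and i: "i + ?R < n"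
    define s where "s = m' + i + 1"
    have s: "s + ?R \<le> N" using n i by (simp add: s_def N_def)
    have bp1: "m \<le> real s / real N \<or> real (s + ?R) / real N \<le> m"
      using k1(2)[OF k(1) i] by (simp add: s_def)
    have bp2: "1 - m \<le> real s / real N \<or> real (s + ?R) / real N \<le> 1 - m"
      using k2(2)[OF k(2) i] by (simp add: s_def)
    have rng: "0 \<le> real s / real N" by simp
    have rng': "real (s + ?R) / real N \<le> 1" using s by (simp del: of_nat_add)
    obtain q where q: "degree q \<le> p" "\<And>x. x \<in> {real s / real N..real (s + ?R) / real N} \<Longrightarrow> v x = poly q x"
    proof -
      consider "real (s + ?R) / real N \<le> m" | "m \<le> real s / real N" "real (s + ?R) / real N \<le> 1 - m"
        | "1 - m \<le> real s / real N" using bp1 bp2 m by linarith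
      then show thesis
      proof cases
        case 1
        show thesis by (rule that[OF deg(1)], rule vq(1), unfold atLeastAtMost_iff) (use 1 rng rng' in linarith)
      next
        case 2
        show thesis by (rule that[OF deg(2)], rule vq(2), unfold atLeastAtMost_iff) (use 2 rng rng' in linarith)
      next
        case 3
        show thesis by (rule that[OF deg(3)], rule vq(3), unfold atLeastAtMost_iff) (use 3 rng rng' in linarith)
      qed
    qed
    have "y (s + ?R) = - (\<Sum>k<?R. coeff (char_poly_rec p) k * y (s + k))"
      by (rule nodal_recurrence[OF bdd_meas_continuous[OF vc] eqn s q])
    then show "w (m' + (i + ?R)) = - (\<Sum>k<?R. coeff (char_poly_rec p) k * w (m' + (i + k)))"
      by (simp add: w_def s_def add_ac)
  qed
  then obtain V where V: "is_qtt L w r V" by blast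
  have T: "T_int L ! i = real (Suc i) / real N" if "i < 2 ^ L" for i
    using that by (simp add: T_int_def N_def add.commute del: upt_Suc)
  have len: "length (T_int L) = 2 ^ L" by (simp add: T_int_def)
  have wP: "P (T_int L ! i) = w i" if "i < 2 ^ L" for i
    using T[OF that] by (simp add: w_def y_def)
  have "is_qtt L (\<lambda>i. P (T_int L ! i)) r V"
  proof -
    have "(\<Sum>j=1..L. 2 ^ (L - j) * d j) < (2::nat) ^ L" if "\<forall>j\<in>{1..L}. d j \<in> {0,1}" for d
      using bits_sum_less[OF that, of 0] by simp
    then show ?thesis using V unfolding is_qtt_def by (simp add: wP)
  qed
  moreover have "sorted_wrt (<) (T_int L)"
  proof -
    have "real i / (2 ^ L + 1) < real j / (2 ^ L + 1)" if "i < j" for i j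
      using that by (intro divide_strict_right_mono) (auto simp: add_pos_pos)
    then show ?thesis
      unfolding T_int_def sorted_wrt_map by (intro sorted_wrt_mono_rel[OF _ sorted_wrt_upt]) auto
  qed
  ultimately show ?thesis using len unfolding is_qtt_wrt_def P_def by blast
qed

section \<open>Energy estimates\<close>

lemma has_bdd_deriv_cong:
  assumes "has_bdd_deriv w w'" "\<And>x. x \<in> {0..1} \<Longrightarrow> v x = w x"
  shows "has_bdd_deriv v w'"
proof -
  obtain S where S: "finite S" "\<forall>x\<in>unit_I - S. (w has_real_derivative w' x) (at x)"
    using assms(1) unfolding has_bdd_deriv_def by blast
  have "(v has_real_derivative w' x) (at x)" if "x \<in> unit_I - S" for x
  proof (rule has_field_derivative_transform_within_open[of w _ _ unit_I])
    show "(w has_real_derivative w' x) (at x)" using S(2) that by blast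
  qed (use that assms(2) in auto)
  moreover have "continuous_on {0..1} v"
    by (rule continuous_on_eq[OF has_bdd_derivD(1)[OF assms(1)]]) (simp add: assms(2))
  ultimately show ?thesis
    using S(1) has_bdd_derivD(2)[OF assms(1)] unfolding has_bdd_deriv_def by blast
qed

lemma energy_add_le:
  assumes "has_bdd_deriv v v'" "has_bdd_deriv w w'"
  shows "energy \<delta> (\<lambda>x. v x + w x) (\<lambda>x. v' x + w' x) \<le> 2 * energy \<delta> v v' + 2 * energy \<delta> w w'"
proof -
  note b = has_bdd_derivD[OF assms(1)] has_bdd_derivD[OF assms(2)]
  have "I01 (\<lambda>x. (v x + w x)\<^sup>2) \<le> 2 * L2sq v + 2 * L2sq w"
    by (intro I01_square_add_le b)
  moreover have "\<delta>\<^sup>2 * I01 (\<lambda>x. (v' x + w' x)\<^sup>2) \<le> \<delta>\<^sup>2 * (2 * L2sq v' + 2 * L2sq w')"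
    by (intro mult_left_mono I01_square_add_le b) simp
  ultimately show ?thesis unfolding energy_def distrib_left by (simp add: algebra_simps)
qed

lemma energy_uminus: "energy \<delta> (\<lambda>x. - v x) (\<lambda>x. - v' x) = energy \<delta> v v'"
  by (simp add: energy_def)

lemma energy_nonneg: "has_bdd_deriv v v' \<Longrightarrow> 0 \<le> energy \<delta> v v'"
  unfolding energy_def by (intro add_nonneg_nonneg mult_nonneg_nonneg I01_square_nonneg has_bdd_derivD zero_le_power2)

lemma I01_le_on_subinterval:
  assumes f: "bdd_meas f" and ab: "0 \<le> a" "a \<le> b" "b \<le> 1"
    and le: "\<And>x. x \<in> {0..1} \<Longrightarrow> f x \<le> (if x \<in> {a..b} then M else 0)"
  shows "I01 f \<le> M * (b - a)"
proof -
  have Int: "{a..b} \<inter> {0..1} = {a..b}" using ab by auto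
  have "I01 f \<le> I01 (\<lambda>x. if x \<in> {a..b} then M else 0)"
  proof (rule integral_le[OF bdd_meas_integrable'[OF f] _ le])
    show "(\<lambda>x. if x \<in> {a..b} then M else 0) integrable_on {0..1}"
      unfolding integrable_restrict_Int Int by (rule integrable_const_ivl)
  qed
  also have "\<dots> = integral {a..b} (\<lambda>_. M)" unfolding integral_restrict_Int Int ..
  also have "\<dots> = M * (b - a)" using ab by simp
  finally show ?thesis .
qed

section \<open>Boundary correctors\<close>

lemma hat_bounds: "0 \<le> hat t" "hat t \<le> 1" "1 \<le> \<bar>t\<bar> \<Longrightarrow> hat t = 0"
  by (auto simp: hat_def)

lemma hat'_bounds: "(hat' t)\<^sup>2 \<le> 1" "1 \<le> \<bar>t\<bar> \<Longrightarrow> hat' t = 0"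
  by (auto simp: hat'_def)

lemma end_hat_norms:
  assumes k: "k \<ge> 1" and b: "b = 0 \<or> b = k"
  shows "I01 (\<lambda>x. (hat (x * k - b))\<^sup>2) \<le> 1 / k" "I01 (\<lambda>x. (k * hat' (x * k - b))\<^sup>2) \<le> k"
proof -
  define lo where "lo = (if b = 0 then 0 else 1 - 1 / k)"
  define hi where "hi = (if b = 0 then 1 / k else 1)"
  have lohi: "0 \<le> lo" "lo \<le> hi" "hi \<le> 1" "hi - lo = 1 / k"
    using k by (auto simp: lo_def hi_def field_simps)
  have out: "1 \<le> \<bar>x * k - b\<bar>" if "x \<in> {0..1}" "x \<notin> {lo..hi}" for x
    using that b k by (auto simp: lo_def hi_def field_simps split: if_splits)
  have k0: "k > 0" using k by simp
  note bm = has_bdd_derivD[OF has_bdd_deriv_hat[OF k0, of b]]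
  have "I01 (\<lambda>x. (hat (x * k - b))\<^sup>2) \<le> 1 * (hi - lo)"
  proof (rule I01_le_on_subinterval[OF bdd_meas_power2[OF bm(3)] lohi(1-3)])
    show "(hat (x * k - b))\<^sup>2 \<le> (if x \<in> {lo..hi} then 1 else 0)" if "x \<in> {0..1}" for x
      using out[OF that] hat_bounds[of "x * k - b"] by (simp add: power_le_one)
  qed
  then show "I01 (\<lambda>x. (hat (x * k - b))\<^sup>2) \<le> 1 / k" using lohi by simp
  have "I01 (\<lambda>x. (k * hat' (x * k - b))\<^sup>2) \<le> k\<^sup>2 * (hi - lo)"
  proof (rule I01_le_on_subinterval[OF bdd_meas_power2[OF bm(2)] lohi(1-3)])
    show "(k * hat' (x * k - b))\<^sup>2 \<le> (if x \<in> {lo..hi} then k\<^sup>2 else 0)" if "x \<in> {0..1}" for x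
      using out[OF that] hat'_bounds[of "x * k - b"] by (simp add: power_mult_distrib mult_left_le)
  qed
  then show "I01 (\<lambda>x. (k * hat' (x * k - b))\<^sup>2) \<le> k" using lohi k by (simp add: power2_eq_square)
qed

text \<open>\<open>k\<close> is the inverse width of the two hats. The \<open>- 0\<close> gives both
  of them the shape required by \<open>has_bdd_deriv_hat\<close> and
  \<open>end_hat_norms\<close>.\<close>

definition layer :: "real \<Rightarrow> real \<Rightarrow> real \<Rightarrow> real \<Rightarrow> real" where
  "layer \<beta>0 \<beta>1 k x = \<beta>0 * hat (x * k - 0) + \<beta>1 * hat (x * k - k)"

definition layer' :: "real \<Rightarrow> real \<Rightarrow> real \<Rightarrow> real \<Rightarrow> real" where
  "layer' \<beta>0 \<beta>1 k x = \<beta>0 * (k * hat' (x * k - 0)) + \<beta>1 * (k * hat' (x * k - k))"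

lemma has_bdd_deriv_layer: "k \<ge> 1 \<Longrightarrow> has_bdd_deriv (layer \<beta>0 \<beta>1 k) (layer' \<beta>0 \<beta>1 k)"
  unfolding layer_def[abs_def] layer'_def[abs_def]
  by (intro has_bdd_deriv_add has_bdd_deriv_cmult has_bdd_deriv_hat) auto

lemma layer_ends: "k \<ge> 1 \<Longrightarrow> layer \<beta>0 \<beta>1 k 0 = \<beta>0" "k \<ge> 1 \<Longrightarrow> layer \<beta>0 \<beta>1 k 1 = \<beta>1"
  by (auto simp: layer_def hat_def)

lemma layer_norms:
  assumes k: "k \<ge> 1"
  shows "L2sq (layer \<beta>0 \<beta>1 k) \<le> 2 * (\<beta>0\<^sup>2 + \<beta>1\<^sup>2) / k"
    "L2sq (layer' \<beta>0 \<beta>1 k) \<le> 2 * (\<beta>0\<^sup>2 + \<beta>1\<^sup>2) * k"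
proof -
  have k0: "k > 0" using k by simp
  note b0 = has_bdd_derivD[OF has_bdd_deriv_hat[OF k0, of 0]]
  note b1 = has_bdd_derivD[OF has_bdd_deriv_hat[OF k0, of k]]
  note n0 = end_hat_norms[OF k, of 0] and n1 = end_hat_norms[OF k, of k]
  have "L2sq (layer \<beta>0 \<beta>1 k)
     \<le> 2 * I01 (\<lambda>x. (\<beta>0 * hat (x * k - 0))\<^sup>2) + 2 * I01 (\<lambda>x. (\<beta>1 * hat (x * k - k))\<^sup>2)"
    unfolding layer_def by (intro I01_square_add_le bdd_meas_cmult b0 b1)
  also have "\<dots> = 2 * (\<beta>0\<^sup>2 * I01 (\<lambda>x. (hat (x * k - 0))\<^sup>2)) + 2 * (\<beta>1\<^sup>2 * I01 (\<lambda>x. (hat (x * k - k))\<^sup>2))"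
    by (simp only: power_mult_distrib I01_cmult)
  also have "\<dots> \<le> 2 * (\<beta>0\<^sup>2 * (1 / k)) + 2 * (\<beta>1\<^sup>2 * (1 / k))"
    by (intro add_mono mult_left_mono n0 n1) auto
  finally show "L2sq (layer \<beta>0 \<beta>1 k) \<le> 2 * (\<beta>0\<^sup>2 + \<beta>1\<^sup>2) / k"
    by (simp add: add_divide_distrib algebra_simps)
  have "L2sq (layer' \<beta>0 \<beta>1 k)
     \<le> 2 * I01 (\<lambda>x. (\<beta>0 * (k * hat' (x * k - 0)))\<^sup>2) + 2 * I01 (\<lambda>x. (\<beta>1 * (k * hat' (x * k - k)))\<^sup>2)"
    unfolding layer'_def by (intro I01_square_add_le bdd_meas_cmult b0 b1)
  also have "\<dots> = 2 * (\<beta>0\<^sup>2 * I01 (\<lambda>x. (k * hat' (x * k - 0))\<^sup>2)) + 2 * (\<beta>1\<^sup>2 * I01 (\<lambda>x. (k * hat' (x * k - k))\<^sup>2))"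
    by (simp only: power_mult_distrib[of \<beta>0] power_mult_distrib[of \<beta>1] I01_cmult)
  also have "\<dots> \<le> 2 * (\<beta>0\<^sup>2 * k) + 2 * (\<beta>1\<^sup>2 * k)"
    by (intro add_mono mult_left_mono n0 n1) auto
  finally show "L2sq (layer' \<beta>0 \<beta>1 k) \<le> 2 * (\<beta>0\<^sup>2 + \<beta>1\<^sup>2) * k"
    by (simp add: algebra_simps)
qed

text \<open>At width 1 / N the corrector is a discrete function, so it adds no approximation error
  when \<open>\<delta> \<le> h\<close>.\<close>

lemma pl_layer:
  assumes "N \<ge> 1"
  shows "pl N (\<lambda>i. \<beta>0 * ind_vec 0 i + \<beta>1 * ind_vec N i) x = layer \<beta>0 \<beta>1 (real N) x"
    "pl' N (\<lambda>i. \<beta>0 * ind_vec 0 i + \<beta>1 * ind_vec N i) x = layer' \<beta>0 \<beta>1 (real N) x"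
proof -
  have s: "(\<Sum>i\<le>N. (\<beta>0 * ind_vec 0 i + \<beta>1 * ind_vec N i) * t i) = \<beta>0 * t 0 + \<beta>1 * t N" for t :: "nat \<Rightarrow> real"
  proof -
    have "(\<Sum>i\<le>N. (\<beta>0 * ind_vec 0 i + \<beta>1 * ind_vec N i) * t i)
        = (\<Sum>i\<le>N. (if i = 0 then \<beta>0 * t i else 0) + (if i = N then \<beta>1 * t i else 0))"
      using assms by (intro sum.cong refl) auto
    also have "\<dots> = \<beta>0 * t 0 + \<beta>1 * t N" unfolding sum.distrib using assms by simp
    finally show ?thesis .
  qed
  show "pl N (\<lambda>i. \<beta>0 * ind_vec 0 i + \<beta>1 * ind_vec N i) x = layer \<beta>0 \<beta>1 (real N) x"
    unfolding pl_def s layer_def by simp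
  show "pl' N (\<lambda>i. \<beta>0 * ind_vec 0 i + \<beta>1 * ind_vec N i) x = layer' \<beta>0 \<beta>1 (real N) x"
    unfolding pl'_def s layer'_def by simp
qed

text \<open>Energy argument for \<open>z = u - w - B\<close>, where \<open>w = f / c\<close> solves the reduced problem and \<open>B\<close>
  corrects the boundary values.\<close>

lemma energy_corrected_le:
  assumes \<delta>: "\<delta> > 0" and u: "has_bdd_deriv u u'" "has_bdd_deriv u' (\<lambda>x. (c x * u x - f x) / \<delta>\<^sup>2)"
    and c: "continuous_on {0..1} c" and f: "continuous_on {0..1} f"
    and cb: "\<And>x. x \<in> {0..1} \<Longrightarrow> cmin \<le> c x" "\<And>x. x \<in> {0..1} \<Longrightarrow> c x \<le> cmax" and cmin: "cmin > 0"
    and w: "has_bdd_deriv w w'" and cw: "\<And>x. x \<in> {0..1} \<Longrightarrow> c x * w x = f x"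
    and B: "has_bdd_deriv B B'" and B01: "B 0 = u 0 - w 0" "B 1 = u 1 - w 1"
  shows "\<delta>\<^sup>2 * I01 (\<lambda>x. (u' x - w' x - B' x)\<^sup>2) + cmin * I01 (\<lambda>x. (u x - w x - B x)\<^sup>2)
    \<le> \<delta>\<^sup>2 * (2 * L2sq w' + 2 * L2sq B') + cmax * L2sq B"
proof -
  define z where "z x = u x - w x - B x" for x
  define z' where "z' x = u' x - w' x - B' x" for x
  define u2 where "u2 x = (c x * u x - f x) / \<delta>\<^sup>2" for x
  define g where "g x = w' x + B' x" for x
  have z: "has_bdd_deriv z z'" unfolding z_def[abs_def] z'_def[abs_def] by (intro has_bdd_deriv_diff u w B)
  have u2: "has_bdd_deriv u' u2" using u(2) unfolding u2_def[abs_def] .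
  note bz = has_bdd_derivD[OF z] and bu = has_bdd_derivD[OF u(1)] and bu2 = has_bdd_derivD[OF u2]
    and bw = has_bdd_derivD[OF w] and bB = has_bdd_derivD[OF B]
  note bc = bdd_meas_continuous[OF c]
  have bg: "bdd_meas g" unfolding g_def[abs_def] by (intro bdd_meas_add bw bB)
  \<comment> \<open>The equation tested with \<open>z\<close>: the integrand is the derivative of
    \<open>u' * z\<close>, and \<open>z\<close> vanishes at both ends.\<close>
  have zero: "I01 (\<lambda>x. u2 x * z x + z' x * u' x) = 0"
  proof -
    have "I01 (\<lambda>x. u2 x * z x) + I01 (\<lambda>x. z' x * u' x) = 0"
      using integration_by_parts_bdd_deriv[OF u2 z] B01 by (simp add: z_def)
    then show ?thesis by (subst I01_add) (intro bdd_meas_mult bz bu bu2 | simp)+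
  qed
  have "I01 (\<lambda>x. \<delta>\<^sup>2 * (z' x)\<^sup>2 + cmin * (z x)\<^sup>2)
    \<le> I01 (\<lambda>x. 2 * \<delta>\<^sup>2 * (u2 x * z x + z' x * u' x) + (\<delta>\<^sup>2 * (g x)\<^sup>2 + cmax * (B x)\<^sup>2))"
  proof (rule I01_mono)
    fix x :: real assume x: "x \<in> {0..1}"
    have cpos: "0 < c x" using cb(1)[OF x] cmin by simp
    have u2x: "\<delta>\<^sup>2 * u2 x = c x * u x - c x * w x" using \<delta> cw[OF x] by (simp add: u2_def)
    \<comment> \<open>The energy identity and Young's inequality in one pointwise formula, with
      \<open>u' = z' + g\<close> and \<open>\<delta>^2 * u2 = c * (z + B)\<close>. The squares on
      the right are non-negative, and the first term on the left integrates to zero.\<close>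
    have eq: "2 * \<delta>\<^sup>2 * (u2 x * z x + z' x * u' x) + (\<delta>\<^sup>2 * (g x)\<^sup>2 + c x * (B x)\<^sup>2)
        - (\<delta>\<^sup>2 * (z' x)\<^sup>2 + c x * (z x)\<^sup>2) = \<delta>\<^sup>2 * (z' x + g x)\<^sup>2 + c x * (z x + B x)\<^sup>2"
    proof -
      have "2 * \<delta>\<^sup>2 * (u2 x * z x + z' x * u' x) = 2 * ((\<delta>\<^sup>2 * u2 x) * z x) + 2 * \<delta>\<^sup>2 * (z' x * u' x)"
        by (simp add: algebra_simps)
      also have "\<dots> = 2 * (c x * (z x + B x) * z x) + 2 * \<delta>\<^sup>2 * (z' x * (z' x + g x))"
        unfolding u2x by (simp add: z_def z'_def g_def algebra_simps)
      finally show ?thesis by (simp add: power2_eq_square algebra_simps)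
    qed
    have "0 \<le> \<delta>\<^sup>2 * (z' x + g x)\<^sup>2 + c x * (z x + B x)\<^sup>2" using cpos by simp
    moreover have "cmin * (z x)\<^sup>2 \<le> c x * (z x)\<^sup>2" "c x * (B x)\<^sup>2 \<le> cmax * (B x)\<^sup>2"
      using cb x by (auto intro!: mult_right_mono)
    ultimately show "\<delta>\<^sup>2 * (z' x)\<^sup>2 + cmin * (z x)\<^sup>2
      \<le> 2 * \<delta>\<^sup>2 * (u2 x * z x + z' x * u' x) + (\<delta>\<^sup>2 * (g x)\<^sup>2 + cmax * (B x)\<^sup>2)"
      using eq by linarith
  qed (intro bdd_meas_intros bz bu bu2 bg bB)+
  also have "\<dots> = I01 (\<lambda>x. 2 * \<delta>\<^sup>2 * (u2 x * z x + z' x * u' x)) + I01 (\<lambda>x. \<delta>\<^sup>2 * (g x)\<^sup>2 + cmax * (B x)\<^sup>2)"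
    by (intro I01_add bdd_meas_intros bz bu bu2 bg bB)
  also have "\<dots> = I01 (\<lambda>x. \<delta>\<^sup>2 * (g x)\<^sup>2 + cmax * (B x)\<^sup>2)" unfolding I01_cmult zero by simp
  also have "\<dots> = \<delta>\<^sup>2 * L2sq g + cmax * L2sq B"
    by (subst I01_add) (intro bdd_meas_intros bg bB | simp)+
  also have "I01 (\<lambda>x. \<delta>\<^sup>2 * (z' x)\<^sup>2 + cmin * (z x)\<^sup>2) = \<delta>\<^sup>2 * L2sq z' + cmin * L2sq z"
    by (subst I01_add) (intro bdd_meas_intros bz | simp)+
  finally have "\<delta>\<^sup>2 * L2sq z' + cmin * L2sq z
    \<le> \<delta>\<^sup>2 * L2sq g + cmax * L2sq B" .
  moreover have "\<delta>\<^sup>2 * L2sq g \<le> \<delta>\<^sup>2 * (2 * L2sq w' + 2 * L2sq B')"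
    unfolding g_def by (intro mult_left_mono I01_square_add_le bw bB) simp
  ultimately show ?thesis unfolding z_def z'_def by linarith
qed

text \<open>By the mean value theorem the slope of the interpolant on an element is
  \<open>u' \<xi>\<close> for some interior point, and \<open>u' x - u' \<xi>\<close> is an integral
  of \<open>u''\<close> over a part of that element.\<close>

lemma interp_error_H1_smooth:
  assumes u: "has_bdd_deriv u u'" "has_bdd_deriv u' u''"
    and d: "\<And>x. x \<in> unit_I \<Longrightarrow> (u has_real_derivative u' x) (at x)" and N: "N \<ge> 1"
  shows "I01 (\<lambda>x. (u' x - pl' N (nodal N u) x)\<^sup>2) \<le> (1 / real N)\<^sup>2 * L2sq u''"
proof (rule I01_le_elements[OF _ _ N])
  note bu = has_bdd_derivD[OF u(1)] and bu' = has_bdd_derivD[OF u(2)]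
  fix j assume j: "j < N"
  define a where "a = real j / real N"
  define b where "b = real (Suc j) / real N"
  have ab: "0 \<le> a" "a < b" "b \<le> 1" unfolding a_def b_def using node_less_Suc[OF j] node_Suc_le[OF j] by simp_all
  have ba: "b - a = 1 / real N" by (simp add: a_def b_def diff_divide_distrib[symmetric])
  let ?S = "integral {a..b} (\<lambda>x. (u'' x)\<^sup>2)"
  have i: "h integrable_on {lo..hi}" if "bdd_meas h" "a \<le> lo" "hi \<le> b" for h lo hi
    using that ab by (intro bdd_meas_integrable) auto
  obtain \<xi> where \<xi>: "a < \<xi>" "\<xi> < b" "u b - u a = (b - a) * u' \<xi>"
  proof -
    have "\<exists>l z. a < z \<and> z < b \<and> (u has_real_derivative l) (at z) \<and> u b - u a = (b - a) * l"
    proof (rule MVT[OF ab(2)])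
      show "continuous_on {a..b} u" using bu(1) ab by (auto intro: continuous_on_subset)
      show "u differentiable (at x)" if "a < x" "x < b" for x
        using d[of x] that ab by (auto simp: real_differentiable_def)
    qed
    then obtain l z where lz: "a < z" "z < b" "(u has_real_derivative l) (at z)" "u b - u a = (b - a) * l" by blast
    have "l = u' z" using DERIV_unique[OF lz(3) d[of z]] lz ab by auto
    then show thesis using that lz by blast
  qed
  have slope: "real N * (u b - u a) = u' \<xi>" using \<xi>(3) ba N by simp
  have pt: "(u' x - u' \<xi>)\<^sup>2 \<le> (b - a) * ?S" if x: "x \<in> {a..b}" for x
  proof -
    define lo where "lo = min x \<xi>"
    define hi where "hi = max x \<xi>"
    have lh: "a \<le> lo" "lo \<le> hi" "hi \<le> b" using x \<xi> by (auto simp: lo_def hi_def)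
    have S0: "0 \<le> ?S" by (intro integral_nonneg i bdd_meas_power2 bu' order_refl) simp
    have eq: "(u' x - u' \<xi>)\<^sup>2 = (u' hi - u' lo)\<^sup>2"
      by (cases "x \<le> \<xi>") (auto simp: lo_def hi_def max_def min_def power2_commute)
    show ?thesis
    proof (cases "lo = hi")
      case True
      then show ?thesis unfolding eq using S0 ab by simp
    next
      case False
      then have lt: "lo < hi" using lh by simp
      have "(u'' has_integral (u' hi - u' lo)) {lo..hi}"
        using lh ab by (intro has_bdd_deriv_FTC[OF u(2)]) auto
      then have "(u' hi - u' lo)\<^sup>2 = (integral {lo..hi} u'')\<^sup>2" by (simp add: integral_unique)
      also have "\<dots> \<le> (hi - lo) * integral {lo..hi} (\<lambda>x. (u'' x)\<^sup>2)"
        using lt lh ab by (intro integral_Cauchy_Schwarz bu') auto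
      also have "\<dots> \<le> (b - a) * ?S"
      proof (rule mult_mono)
        show "integral {lo..hi} (\<lambda>x. (u'' x)\<^sup>2) \<le> ?S"
          using lh by (intro integral_subset_le i bdd_meas_power2 bu') auto
        show "0 \<le> integral {lo..hi} (\<lambda>x. (u'' x)\<^sup>2)"
          using lh by (intro integral_nonneg i bdd_meas_power2 bu') auto
      qed (use lh ab in auto)
      finally show ?thesis unfolding eq .
    qed
  qed
  have "integral {a..b} (\<lambda>x. (u' x - pl' N (nodal N u) x)\<^sup>2) = integral {a..b} (\<lambda>x. (u' x - u' \<xi>)\<^sup>2)"
  proof (rule integral_spike[of "{a, b}"])
    show "(u' x - u' \<xi>)\<^sup>2 = (u' x - pl' N (nodal N u) x)\<^sup>2" if "x \<in> {a..b} - {a, b}" for x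
      using that pl'_element[OF j, of x "nodal N u"] slope by (auto simp: a_def b_def)
  qed simp
  also have "\<dots> \<le> integral {a..b} (\<lambda>x. (b - a) * ?S)"
    by (intro integral_le i bdd_meas_intros bu' order_refl pt)
  also have "\<dots> = (1 / real N)\<^sup>2 * ?S" using ab(2) ba by (simp add: power2_eq_square)
  finally show "integral (element N j) (\<lambda>x. (u' x - pl' N (nodal N u) x)\<^sup>2)
    \<le> (1 / real N)\<^sup>2 * integral (element N j) (\<lambda>x. (u'' x)\<^sup>2)"
    unfolding a_def b_def .
qed (intro bdd_meas_intros has_bdd_derivD[OF u(2)] has_bdd_derivD[OF has_bdd_deriv_pl[OF N]])+

text \<open>The constant is assembled from \<open>W\<close>, \<open>\<beta>\<close>,
  \<open>cmin\<close> and \<open>cmax\<close> before \<open>\<delta>\<close>, \<open>u\<close> and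
  \<open>N\<close> are introduced, which makes the bound uniform. The approximant has the exact
  boundary values so that it can be compared with the projection.\<close>

lemma solution_pl_approximation:
  assumes c: "continuous_on {0..1} c" and f: "continuous_on {0..1} f"
    and cb: "\<And>x. x \<in> {0..1} \<Longrightarrow> cmin \<le> c x" and cmin: "cmin > 0"
    and w: "has_bdd_deriv w w'" and cw: "\<And>x. x \<in> {0..1} \<Longrightarrow> c x * w x = f x"
  shows "\<exists>C>0. \<forall>\<delta>\<in>{0<..<1}. \<forall>u. weak_solution \<delta> c f \<alpha>0 \<alpha>1 u \<longrightarrow>
    (\<exists>u'. has_bdd_deriv u u' \<and> (\<forall>N\<ge>1. \<exists>y. y 0 = \<alpha>0 \<and> y N = \<alpha>1 \<and>
      energy \<delta> (\<lambda>x. u x - pl N y x) (\<lambda>x. u' x - pl' N y x) \<le> C * min (1 / real N) ((1 / real N)\<^sup>2 / \<delta>)))"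
proof -
  obtain cmax where cmax: "\<And>x. x \<in> {0..1} \<Longrightarrow> c x \<le> cmax"
    using bdd_meas_continuous[OF c] unfolding bdd_meas_def by (meson abs_le_D1)
  have cmax0: "cmax > 0" using cb[of 0] cmax[of 0] cmin by simp
  note bw = has_bdd_derivD[OF w]
  define W where "W = L2sq w'"
  have W0: "W \<ge> 0" unfolding W_def by (intro I01_square_nonneg bw)
  define \<beta>0 where "\<beta>0 = \<alpha>0 - w 0"
  define \<beta>1 where "\<beta>1 = \<alpha>1 - w 1"
  define \<beta> where "\<beta> = \<beta>0\<^sup>2 + \<beta>1\<^sup>2"
  have \<beta>: "\<beta> \<ge> 0" by (simp add: \<beta>_def)
  \<comment> \<open>Coefficient of 1 / k in the bound for \<open>z\<close>: \<open>2 * W\<close>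
    from \<open>w'\<close>, \<open>4 * \<beta>\<close> from the derivative of the corrector and
    \<open>2 * cmax * \<beta>\<close> from its mass.\<close>
  define M where "M = 2 * W + 4 * \<beta> + 2 * cmax * \<beta>"
  have M0: "M \<ge> 0" unfolding M_def using W0 \<beta> cmax0 by simp
  define \<mu> where "\<mu> = min 1 cmin"
  have \<mu>: "0 < \<mu>" "\<mu> \<le> 1" "\<mu> \<le> cmin" using cmin by (auto simp: \<mu>_def)
  define Cz where "Cz = M / \<mu>"
  have Cz0: "Cz \<ge> 0" unfolding Cz_def using M0 \<mu> by simp
  \<comment> \<open>\<open>C1\<close> serves \<open>\<delta> \<le> h\<close>: \<open>Cz\<close> from
    \<open>z\<close> and \<open>8 * W\<close> from interpolating \<open>w\<close>, doubled by the
    triangle inequality. \<open>C2\<close> serves \<open>h \<le> \<delta>\<close>: half of it bounds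
    \<open>\<delta> ^ 3 * L2sq u2\<close>, and the factor 2 accounts for the two parts of the
    energy.\<close>
  define C1 where "C1 = 2 * Cz + 16 * W"
  define C2 where "C2 = 2 * (cmax\<^sup>2 * (2 * Cz + 4 * \<beta>))"
  have C12: "C1 \<ge> 0" "C2 \<ge> 0" unfolding C1_def C2_def using Cz0 W0 \<beta> by auto
  show ?thesis
  proof (intro exI[of _ "C1 + C2 + 1"] conjI ballI allI impI)
    show "0 < C1 + C2 + 1" using C12 by simp
    fix \<delta> u assume \<delta>01: "\<delta> \<in> {0<..<1::real}" and sol: "weak_solution \<delta> c f \<alpha>0 \<alpha>1 u"
    have \<delta>: "0 < \<delta>" "\<delta> < 1" using \<delta>01 by auto
    define u2 where "u2 x = (c x * u x - f x) / \<delta>\<^sup>2" for x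
    obtain u' where u: "has_bdd_deriv u u'" and du: "\<And>x. x \<in> unit_I \<Longrightarrow> (u has_real_derivative u' x) (at x)"
      and u2: "has_bdd_deriv u' (\<lambda>x. (c x * u x - f x) / \<delta>\<^sup>2)"
      using weak_solution_classical[OF sol \<delta>(1) c f] by blast
    have u2': "has_bdd_deriv u' u2" using u2 unfolding u2_def[abs_def] .
    have u01: "u 0 = \<alpha>0" "u 1 = \<alpha>1" using sol unfolding weak_solution_def by auto
    note bu = has_bdd_derivD[OF u]
    define z where "z k = (\<lambda>x. u x - w x - layer \<beta>0 \<beta>1 k x)" for k
    define z' where "z' k = (\<lambda>x. u' x - w' x - layer' \<beta>0 \<beta>1 k x)" for k
    have hz: "has_bdd_deriv (z k) (z' k)" if "k \<ge> 1" for k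
      unfolding z_def z'_def by (intro has_bdd_deriv_diff u w has_bdd_deriv_layer that)
    \<comment> \<open>\<open>k\<close> is the inverse of the width s, and
      \<open>\<delta> * k \<le> 1\<close> says \<open>\<delta> \<le> s\<close>; both
      \<open>\<delta>^2\<close> and \<open>\<delta>^2 * k\<close> are then at most 1 / k.\<close>
    have zbound: "energy \<delta> (z k) (z' k) \<le> Cz / k" if k: "k \<ge> 1" "\<delta> * k \<le> 1" for k
    proof -
      note bz = has_bdd_derivD[OF hz[OF k(1)]]
      have k0: "k > 0" using k by simp
      have \<delta>k: "\<delta> \<le> 1 / k" using k(2) k0 by (simp add: field_simps)
      have "\<delta>\<^sup>2 \<le> \<delta> * 1" unfolding power2_eq_square using \<delta> by (intro mult_left_mono) auto
      then have d2: "\<delta>\<^sup>2 \<le> 1 / k" using \<delta>k by simp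
      have "(\<delta> * k)\<^sup>2 \<le> 1" using \<delta> k0 k(2) by (intro power_le_one) auto
      then have d2k: "\<delta>\<^sup>2 * k \<le> 1 / k" using k0 by (simp add: field_simps power2_eq_square)
      have "\<mu> * energy \<delta> (z k) (z' k) \<le> \<delta>\<^sup>2 * L2sq (z' k) + cmin * L2sq (z k)"
        unfolding energy_def distrib_left
        using mult_right_mono[OF \<mu>(2), of "\<delta>\<^sup>2 * L2sq (z' k)"] I01_square_nonneg[OF bz(2)]
          mult_right_mono[OF \<mu>(3) I01_square_nonneg[OF bz(3)]] by simp
      also have "\<dots> \<le> \<delta>\<^sup>2 * (2 * L2sq w' + 2 * L2sq (layer' \<beta>0 \<beta>1 k)) + cmax * L2sq (layer \<beta>0 \<beta>1 k)"
        unfolding z_def z'_def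
        by (rule energy_corrected_le[OF \<delta>(1) u u2 c f cb cmax cmin w cw has_bdd_deriv_layer[OF k(1)]])
           (use layer_ends[OF k(1)] u01 in \<open>auto simp: \<beta>0_def \<beta>1_def\<close>)
      also have "\<dots> \<le> \<delta>\<^sup>2 * (2 * W + 2 * (2 * \<beta> * k)) + cmax * (2 * \<beta> / k)"
        using layer_norms[OF k(1), of \<beta>0 \<beta>1] cmax0 unfolding W_def \<beta>_def
        by (intro add_mono mult_left_mono) auto
      also have "\<dots> = \<delta>\<^sup>2 * (2 * W) + (\<delta>\<^sup>2 * k) * (4 * \<beta>) + (2 * cmax * \<beta>) * (1 / k)"
        by (simp add: algebra_simps)
      also have "\<dots> \<le> (1 / k) * (2 * W) + (1 / k) * (4 * \<beta>) + (2 * cmax * \<beta>) * (1 / k)"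
        using d2 d2k W0 \<beta> by (intro add_mono mult_right_mono order_refl) auto
      also have "\<dots> = M * (1 / k)" unfolding M_def by (simp only: algebra_simps)
      finally have "\<mu> * energy \<delta> (z k) (z' k) \<le> M * (1 / k)" .
      then have "energy \<delta> (z k) (z' k) \<le> M * (1 / k) / \<mu>"
        using \<mu>(1) by (simp only: pos_le_divide_eq mult.commute)
      then show ?thesis by (simp add: Cz_def mult.commute)
    qed
    show "\<exists>u'. has_bdd_deriv u u' \<and> (\<forall>N\<ge>1. \<exists>y. y 0 = \<alpha>0 \<and> y N = \<alpha>1 \<and>
      energy \<delta> (\<lambda>x. u x - pl N y x) (\<lambda>x. u' x - pl' N y x)
        \<le> (C1 + C2 + 1) * min (1 / real N) ((1 / real N)\<^sup>2 / \<delta>))"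
    proof (intro exI[of _ u'] conjI u allI impI)
      fix N :: nat assume N: "N \<ge> 1"
      define h where "h = 1 / real N"
      have h: "0 < h" "h \<le> 1" using N by (auto simp: h_def)
      have hN: "1 / h = real N" by (simp add: h_def)
      show "\<exists>y. y 0 = \<alpha>0 \<and> y N = \<alpha>1 \<and> energy \<delta> (\<lambda>x. u x - pl N y x) (\<lambda>x. u' x - pl' N y x)
        \<le> (C1 + C2 + 1) * min (1 / real N) ((1 / real N)\<^sup>2 / \<delta>)"
      proof (cases "\<delta> \<le> h")
        case True
        define bv where "bv = (\<lambda>i. \<beta>0 * ind_vec 0 i + \<beta>1 * ind_vec N i)"
        define y where "y = (\<lambda>i. nodal N w i + bv i)"
        define v where "v x = w x - pl N (nodal N w) x" for x
        define v' where "v' x = w' x - pl' N (nodal N w) x" for x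
        have hv: "has_bdd_deriv v v'" unfolding v_def v'_def by (intro has_bdd_deriv_diff w has_bdd_deriv_pl N)
        have pl': "pl' N (\<lambda>i. a i + b i) x = pl' N a x + pl' N b x" for a b x
          by (simp add: pl'_def sum.distrib algebra_simps)
        have e1: "u x - pl N y x = z (real N) x + v x" for x
        proof -
          have "pl N y x = pl N (nodal N w) x + pl N bv x" unfolding y_def by (rule pl_add)
          also have "pl N bv x = layer \<beta>0 \<beta>1 (real N) x" unfolding bv_def by (rule pl_layer[OF N])
          finally show ?thesis by (simp add: z_def v_def)
        qed
        have e2: "u' x - pl' N y x = z' (real N) x + v' x" for x
        proof -
          have "pl' N y x = pl' N (nodal N w) x + pl' N bv x" unfolding y_def by (rule pl')
          also have "pl' N bv x = layer' \<beta>0 \<beta>1 (real N) x" unfolding bv_def by (rule pl_layer[OF N])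
          finally show ?thesis by (simp add: z'_def v'_def)
        qed
        have kN: "real N \<ge> 1" "\<delta> * real N \<le> 1" using True N by (auto simp: h_def field_simps)
        have "energy \<delta> (\<lambda>x. u x - pl N y x) (\<lambda>x. u' x - pl' N y x)
          \<le> 2 * energy \<delta> (z (real N)) (z' (real N)) + 2 * energy \<delta> v v'"
          unfolding e1 e2 by (rule energy_add_le[OF hz[OF kN(1)] hv])
        moreover have "energy \<delta> (z (real N)) (z' (real N)) \<le> Cz * h"
          using zbound[OF kN] by (simp add: h_def)
        moreover have "energy \<delta> v v' \<le> 8 * W * h"
        proof -
          have H1: "L2sq v' \<le> 4 * W"
            unfolding v'_def W_def by (rule interp_error_H1[OF w N])
          have L2: "L2sq v \<le> h\<^sup>2 * L2sq v'"
            unfolding v_def v'_def h_def by (rule interp_error_L2[OF w N])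
          have nn: "0 \<le> L2sq v'" by (intro I01_square_nonneg has_bdd_derivD[OF hv])
          have "h\<^sup>2 \<le> h * 1" unfolding power2_eq_square using h by (intro mult_left_mono) auto
          moreover have "\<delta>\<^sup>2 \<le> h\<^sup>2" using True \<delta> by (intro power_mono) auto
          ultimately have hh: "h\<^sup>2 \<le> h" "\<delta>\<^sup>2 \<le> h" by simp_all
          have "energy \<delta> v v' \<le> h * (4 * W) + h * (4 * W)"
            unfolding energy_def
          proof (rule add_mono)
            show "\<delta>\<^sup>2 * L2sq v' \<le> h * (4 * W)"
              using hh(2) H1 nn h by (intro mult_mono) auto
            have "h\<^sup>2 * L2sq v' \<le> h * (4 * W)"
              using hh(1) H1 nn h by (intro mult_mono) auto
            then show "L2sq v \<le> h * (4 * W)" using L2 by simp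
          qed
          then show ?thesis by (simp add: algebra_simps)
        qed
        ultimately have "energy \<delta> (\<lambda>x. u x - pl N y x) (\<lambda>x. u' x - pl' N y x) \<le> C1 * h"
          unfolding C1_def distrib_right by linarith
        also have "\<dots> \<le> (C1 + C2 + 1) * h" using C12 h by (intro mult_right_mono) auto
        also have "h = min (1 / real N) ((1 / real N)\<^sup>2 / \<delta>)"
        proof -
          have "h * \<delta> \<le> h * h" using True h by (intro mult_left_mono) auto
          then have "h \<le> h\<^sup>2 / \<delta>" using \<delta> by (simp add: field_simps power2_eq_square)
          then show ?thesis by (simp add: h_def)
        qed
        finally have "energy \<delta> (\<lambda>x. u x - pl N y x) (\<lambda>x. u' x - pl' N y x)
          \<le> (C1 + C2 + 1) * min (1 / real N) ((1 / real N)\<^sup>2 / \<delta>)" .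
        moreover have "y 0 = \<alpha>0" "y N = \<alpha>1" using N by (auto simp: y_def bv_def \<beta>0_def \<beta>1_def)
        ultimately show ?thesis by blast
      next
        case False
        then have h\<delta>: "h \<le> \<delta>" by simp
        define k where "k = 1 / \<delta>"
        have k: "k \<ge> 1" "\<delta> * k \<le> 1" using \<delta> by (auto simp: k_def)
        define y where "y = nodal N u"
        define v where "v x = u x - pl N y x" for x
        define v' where "v' x = u' x - pl' N y x" for x
        have hv: "has_bdd_deriv v v'" unfolding v_def v'_def by (intro has_bdd_deriv_diff u has_bdd_deriv_pl N)
        have "0 \<le> \<delta>\<^sup>2 * L2sq (z' k)"
          by (intro mult_nonneg_nonneg zero_le_power2 I01_square_nonneg has_bdd_derivD[OF hz[OF k(1)]])
        then have zL2: "L2sq (z k) \<le> Cz * \<delta>"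
          using zbound[OF k] \<delta> unfolding energy_def by (simp add: k_def)
        have BL2: "L2sq (layer \<beta>0 \<beta>1 k) \<le> 2 * \<beta> * \<delta>"
          using layer_norms(1)[OF k(1), of \<beta>0 \<beta>1] by (simp add: k_def \<beta>_def)
        have "I01 (\<lambda>x. (u x - w x)\<^sup>2) = I01 (\<lambda>x. (z k x + layer \<beta>0 \<beta>1 k x)\<^sup>2)" by (simp add: z_def)
        also have "\<dots> \<le> 2 * L2sq (z k) + 2 * L2sq (layer \<beta>0 \<beta>1 k)"
          by (intro I01_square_add_le has_bdd_derivD[OF hz[OF k(1)]] has_bdd_derivD[OF has_bdd_deriv_layer[OF k(1)]])
        finally have uw: "I01 (\<lambda>x. (u x - w x)\<^sup>2) \<le> (2 * Cz + 4 * \<beta>) * \<delta>"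
          using zL2 BL2 unfolding distrib_right by linarith
        have "L2sq u2 \<le> I01 (\<lambda>x. (cmax / \<delta>\<^sup>2)\<^sup>2 * (u x - w x)\<^sup>2)"
        proof (rule I01_mono)
          fix x :: real assume x: "x \<in> {0..1}"
          have "u2 x = (c x / \<delta>\<^sup>2) * (u x - w x)" unfolding u2_def cw[OF x, symmetric] by (simp add: algebra_simps diff_divide_distrib)
          moreover have "(c x / \<delta>\<^sup>2)\<^sup>2 \<le> (cmax / \<delta>\<^sup>2)\<^sup>2"
            using cb[OF x] cmax[OF x] cmin by (intro power_mono divide_right_mono) auto
          ultimately show "(u2 x)\<^sup>2 \<le> (cmax / \<delta>\<^sup>2)\<^sup>2 * (u x - w x)\<^sup>2"
            by (simp only: power_mult_distrib) (rule mult_right_mono, auto)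
        qed (intro bdd_meas_intros bu bw has_bdd_derivD[OF u2'])+
        also have "\<dots> = (cmax / \<delta>\<^sup>2)\<^sup>2 * I01 (\<lambda>x. (u x - w x)\<^sup>2)" by simp
        also have "\<dots> \<le> (cmax / \<delta>\<^sup>2)\<^sup>2 * ((2 * Cz + 4 * \<beta>) * \<delta>)" by (intro mult_left_mono uw) simp
        also have "\<dots> = (C2 / 2) / \<delta> ^ 3"
          using \<delta> by (simp add: C2_def field_simps power2_eq_square power3_eq_cube)
        finally have u2b: "L2sq u2 \<le> (C2 / 2) / \<delta> ^ 3" .
        have H1: "L2sq v' \<le> h\<^sup>2 * L2sq u2"
          unfolding v'_def h_def y_def by (rule interp_error_H1_smooth[OF u u2' du N])
        have L2: "L2sq v \<le> h\<^sup>2 * L2sq v'"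
          unfolding v_def v'_def h_def y_def by (rule interp_error_L2[OF u N])
        have nn: "0 \<le> L2sq v'" by (intro I01_square_nonneg has_bdd_derivD[OF hv])
        have "h\<^sup>2 \<le> \<delta>\<^sup>2" using h\<delta> h by (intro power_mono) auto
        then have "h\<^sup>2 * L2sq v' \<le> \<delta>\<^sup>2 * L2sq v'" by (intro mult_right_mono nn)
        \<comment> \<open>The mesh resolves the layer, so the L2 part of the energy is dominated by
          the derivative part.\<close>
        then have "energy \<delta> v v' \<le> 2 * \<delta>\<^sup>2 * L2sq v'" using L2 unfolding energy_def by linarith
        also have "\<dots> \<le> 2 * \<delta>\<^sup>2 * (h\<^sup>2 * ((C2 / 2) / \<delta> ^ 3))"
          using H1 mult_left_mono[OF u2b, of "h\<^sup>2"] by (intro mult_left_mono) auto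
        also have "\<dots> = C2 * (h\<^sup>2 / \<delta>)"
          using \<delta> by (simp add: field_simps power2_eq_square power3_eq_cube)
        also have "\<dots> \<le> (C1 + C2 + 1) * (h\<^sup>2 / \<delta>)" using C12 \<delta> by (intro mult_right_mono) auto
        also have "h\<^sup>2 / \<delta> = min (1 / real N) ((1 / real N)\<^sup>2 / \<delta>)"
        proof -
          have "h * h \<le> h * \<delta>" using h\<delta> h by (intro mult_left_mono) auto
          then have "h\<^sup>2 / \<delta> \<le> h" using \<delta> by (simp add: field_simps power2_eq_square)
          then show ?thesis by (simp add: h_def)
        qed
        finally have "energy \<delta> (\<lambda>x. u x - pl N y x) (\<lambda>x. u' x - pl' N y x)
          \<le> (C1 + C2 + 1) * min (1 / real N) ((1 / real N)\<^sup>2 / \<delta>)" unfolding v_def v'_def .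
        moreover have "y 0 = \<alpha>0" "y N = \<alpha>1" using N u01 by (auto simp: y_def)
        ultimately show ?thesis by blast
      qed
    qed
  qed
qed

text \<open>The projection maps onto an affine space. Subtracting a comparison function
  \<open>pl N y\<close> with the same boundary values leads to zero boundary values, where the
  stability estimate applies; triangle inequalities then return to \<open>u\<close>.\<close>

lemma projection_error_le:
  assumes \<delta>: "0 < \<delta>" and u: "has_bdd_deriv u u'" and v: "has_bdd_deriv v v'" and v01: "v 0 = \<alpha>0" "v 1 = \<alpha>1"
    and y: "y 0 = \<alpha>0" "y (2 ^ L + 1) = \<alpha>1"
  defines "N \<equiv> (2::nat) ^ L + 1"
  shows "(delta_norm \<delta> (\<lambda>x. L2_proj \<alpha>0 \<alpha>1 L v x - u x))\<^sup>2
    \<le> 418 * (delta_norm \<delta> (\<lambda>x. u x - v x))\<^sup>2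
      + 416 * energy \<delta> (\<lambda>x. u x - pl N y x) (\<lambda>x. u' x - pl' N y x)"
proof -
  have N: "N \<ge> 1" by (simp add: N_def)
  define P where "P = L2_proj \<alpha>0 \<alpha>1 L v"
  define p where "p = nodal N P"
  note vc = has_bdd_derivD(1)[OF v]
  have p01: "p 0 = \<alpha>0" "p N = \<alpha>1"
    unfolding p_def P_def N_def by (rule L2_proj_spec(1)[OF vc], rule L2_proj_spec(2)[OF vc])
  have Pp: "P x = pl N p x" if "x \<in> {0..1}" for x
    unfolding p_def P_def N_def by (rule L2_proj_spec(3)[OF vc that])
  have orth: "I01 (\<lambda>x. (pl N p x - v x) * pl N z x) = 0" if "z 0 = 0" "z N = 0" for z
    unfolding p_def P_def N_def by (rule L2_proj_spec(4)[OF vc]) (use that in \<open>simp_all add: N_def\<close>)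
  note hpl = has_bdd_deriv_pl[OF N]
  define e where "e x = v x - pl N y x" for x
  define e' where "e' x = v' x - pl' N y x" for x
  have he: "has_bdd_deriv e e'" unfolding e_def e'_def by (intro has_bdd_deriv_diff v hpl)
  \<comment> \<open>Nodal vector of the projection of \<open>e\<close> onto the space with zero
    boundary values.\<close>
  define d where "d = (\<lambda>i. p i - y i)"
  have pld: "pl N d x = pl N p x - pl N y x" "pl' N d x = pl' N p x - pl' N y x" for x
    unfolding d_def by (rule pl_diff pl'_diff)+
  have "energy \<delta> (\<lambda>x. e x - pl N d x) (\<lambda>x. e' x - pl' N d x) \<le> 104 * energy \<delta> e e'"
  proof (rule L2_projection_energy_le[OF he N])
    show "e 0 = 0" "e 1 = 0" using v01 y pl_0[OF N] pl_1[OF N] by (simp_all add: e_def N_def)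
    show "d 0 = 0" "d N = 0" using p01 y by (simp_all add: d_def N_def)
    show "I01 (\<lambda>x. (pl N d x - e x) * pl N z x) = 0" if "z 0 = 0" "z N = 0" for z
      using orth[OF that] by (simp add: e_def pld)
  qed
  moreover have "(\<lambda>x. e x - pl N d x) = (\<lambda>x. v x - pl N p x)" "(\<lambda>x. e' x - pl' N d x) = (\<lambda>x. v' x - pl' N p x)"
    by (simp_all add: e_def e'_def pld)
  ultimately have proj: "energy \<delta> (\<lambda>x. v x - pl N p x) (\<lambda>x. v' x - pl' N p x) \<le> 104 * energy \<delta> e e'" by simp
  have huv: "has_bdd_deriv (\<lambda>x. u x - v x) (\<lambda>x. u' x - v' x)" by (intro has_bdd_deriv_diff u v)
  have hvu: "has_bdd_deriv (\<lambda>x. v x - u x) (\<lambda>x. v' x - u' x)" by (intro has_bdd_deriv_diff u v)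
  have sym: "energy \<delta> (\<lambda>x. v x - u x) (\<lambda>x. v' x - u' x) = energy \<delta> (\<lambda>x. u x - v x) (\<lambda>x. u' x - v' x)"
    using energy_uminus[of \<delta> "\<lambda>x. v x - u x" "\<lambda>x. v' x - u' x"] by simp
  have "energy \<delta> (\<lambda>x. (v x - u x) + (u x - pl N y x)) (\<lambda>x. (v' x - u' x) + (u' x - pl' N y x))
    \<le> 2 * energy \<delta> (\<lambda>x. v x - u x) (\<lambda>x. v' x - u' x) + 2 * energy \<delta> (\<lambda>x. u x - pl N y x) (\<lambda>x. u' x - pl' N y x)"
    by (rule energy_add_le[OF hvu has_bdd_deriv_diff[OF u hpl]])
  then have ee: "energy \<delta> e e' \<le> 2 * energy \<delta> (\<lambda>x. u x - v x) (\<lambda>x. u' x - v' x)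
      + 2 * energy \<delta> (\<lambda>x. u x - pl N y x) (\<lambda>x. u' x - pl' N y x)"
    using sym by (simp add: e_def[abs_def] e'_def[abs_def])
  have "energy \<delta> (\<lambda>x. (u x - v x) + (v x - pl N p x)) (\<lambda>x. (u' x - v' x) + (v' x - pl' N p x))
    \<le> 2 * energy \<delta> (\<lambda>x. u x - v x) (\<lambda>x. u' x - v' x) + 2 * energy \<delta> (\<lambda>x. v x - pl N p x) (\<lambda>x. v' x - pl' N p x)"
    by (rule energy_add_le[OF huv has_bdd_deriv_diff[OF v hpl]])
  \<comment> \<open>Here 418 = 2 + 2 * 104 * 2 and 416 = 2 * 104 * 2.\<close>
  then have tot: "energy \<delta> (\<lambda>x. u x - pl N p x) (\<lambda>x. u' x - pl' N p x)
    \<le> 418 * energy \<delta> (\<lambda>x. u x - v x) (\<lambda>x. u' x - v' x) + 416 * energy \<delta> (\<lambda>x. u x - pl N y x) (\<lambda>x. u' x - pl' N y x)"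
    using proj ee by simp
  \<comment> \<open>\<open>L2_proj\<close> is determined on [0,1] only, so its derivative is taken
    from the piecewise linear function that agrees with it there.\<close>
  have hP: "has_bdd_deriv (\<lambda>x. P x - u x) (\<lambda>x. pl' N p x - u' x)"
    by (rule has_bdd_deriv_cong[OF has_bdd_deriv_diff[OF hpl[of p] u]]) (simp add: Pp)
  have "energy \<delta> (\<lambda>x. P x - u x) (\<lambda>x. pl' N p x - u' x) = energy \<delta> (\<lambda>x. pl N p x - u x) (\<lambda>x. pl' N p x - u' x)"
  proof -
    have "I01 (\<lambda>x. (P x - u x)\<^sup>2) = I01 (\<lambda>x. (pl N p x - u x)\<^sup>2)" by (intro integral_cong) (simp add: Pp)
    then show ?thesis unfolding energy_def by simp
  qed
  also have "\<dots> = energy \<delta> (\<lambda>x. u x - pl N p x) (\<lambda>x. u' x - pl' N p x)"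
    using energy_uminus[of \<delta> "\<lambda>x. pl N p x - u x" "\<lambda>x. pl' N p x - u' x"] by simp
  finally have "(delta_norm \<delta> (\<lambda>x. P x - u x))\<^sup>2 = energy \<delta> (\<lambda>x. u x - pl N p x) (\<lambda>x. u' x - pl' N p x)"
    unfolding delta_norm_eq[OF hP] using energy_nonneg[OF hP, of \<delta>] by simp
  moreover have "(delta_norm \<delta> (\<lambda>x. u x - v x))\<^sup>2 = energy \<delta> (\<lambda>x. u x - v x) (\<lambda>x. u' x - v' x)"
    unfolding delta_norm_eq[OF huv] using energy_nonneg[OF huv] by simp
  ultimately show ?thesis using tot unfolding P_def by simp
qed

text \<open>21^2 = 441 exceeds both 418 and 416, and the cross term in the square of the sum is
  non-negative.\<close>

lemma sqrt_le_from_squares: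
  assumes "x\<^sup>2 \<le> 418 * a\<^sup>2 + 416 * (C * m)" "0 \<le> a" "0 \<le> C" "0 \<le> m"
  shows "x \<le> 21 * a + 21 * sqrt C * sqrt m"
proof (rule power2_le_imp_le)
  have "418 * a\<^sup>2 \<le> 441 * a\<^sup>2" by (intro mult_right_mono) auto
  then have "418 * a\<^sup>2 \<le> (21 * a)\<^sup>2" by (simp add: power_mult_distrib)
  moreover have "416 * (C * m) \<le> (21 * sqrt C * sqrt m)\<^sup>2"
  proof -
    have "416 * (C * m) \<le> 441 * (C * m)" using assms by (intro mult_right_mono) auto
    then show ?thesis using assms by (simp add: power_mult_distrib)
  qed
  moreover have "0 \<le> 2 * (21 * a) * (21 * sqrt C * sqrt m)" using assms by simp
  moreover have "(21 * a + 21 * sqrt C * sqrt m)\<^sup>2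
      = (21 * a)\<^sup>2 + 2 * (21 * a) * (21 * sqrt C * sqrt m) + (21 * sqrt C * sqrt m)\<^sup>2"
    by (simp add: power2_sum)
  ultimately show "x\<^sup>2 \<le> (21 * a + 21 * sqrt C * sqrt m)\<^sup>2" using assms(1) by linarith
  show "0 \<le> 21 * a + 21 * sqrt C * sqrt m" using assms by simp
qed

theorem theorem1:
  fixes \<alpha>0 \<alpha>1 c_min lam C0 b0 :: real
    and f c :: "real \<Rightarrow> real"
    and u :: "real \<Rightarrow> real \<Rightarrow> real"
    and U :: "real \<Rightarrow> nat \<Rightarrow> real \<Rightarrow> real"
  assumes f_analytic: "real_analytic_on f {0..1}"
    and c_analytic: "real_analytic_on c {0..1}"
    and c_min: "c_min > 0" "\<forall>x\<in>{0<..<1}. c x \<ge> c_min"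
    and u_solution: "\<forall>\<delta>\<in>{0<..<1}. weak_solution \<delta> c f \<alpha>0 \<alpha>1 (u \<delta>)"
    and hp_constants: "lam > 0" "C0 > 0" "b0 > 0"
    and hp_space: "\<forall>\<delta>\<in>{0<..<1}. \<forall>p\<ge>1. U \<delta> p \<in> pw_poly_space p (T_hp (lam * real p * \<delta>)) \<alpha>0 \<alpha>1"
    and hp_error: "\<forall>\<delta>\<in>{0<..<1}. \<forall>p\<ge>1.
      delta_norm \<delta> (\<lambda>x. u \<delta> x - U \<delta> p x) \<le> C0 * exp (- b0 * real p)"
  shows "\<exists>C1>0. \<exists>b1>0. \<exists>C2>0. \<exists>b2>0. \<exists>Kr>0. \<exists>Kn>0. \<forall>\<delta>\<in>{0<..<1}. \<forall>L\<ge>1.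
    delta_norm \<delta> (\<lambda>x. L2_proj \<alpha>0 \<alpha>1 L (U \<delta> L) x - u \<delta> x)
      \<le> C1 * (exp (- b1 * real L) + min (sqrt (mesh_h L)) (mesh_h L / sqrt \<delta>)) \<and>
    (\<exists>r V. is_qtt_wrt L (T_int L) (L2_proj \<alpha>0 \<alpha>1 L (U \<delta> L)) r V \<and>
       (\<forall>j\<in>{1..<L}. real (r j) \<le> Kr * real L) \<and>
       real (qtt_params L r) \<le> Kn * real L ^ 3 \<and>
       delta_norm \<delta> (\<lambda>x. L2_proj \<alpha>0 \<alpha>1 L (U \<delta> L) x - u \<delta> x)
         \<le> C2 * exp (- b2 * real (qtt_params L r) powr (1 / 3)))"
proof -
  let ?err = "\<lambda>\<delta> L. delta_norm \<delta> (\<lambda>x. L2_proj \<alpha>0 \<alpha>1 L (U \<delta> L) x - u \<delta> x)"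
  obtain f' where f': "continuous_on {0..1} f'" "\<And>x. x \<in> {0..1} \<Longrightarrow> (f has_real_derivative f' x) (at x within {0..1})"
    using real_analytic_C1[OF f_analytic] by blast
  obtain c' where c': "continuous_on {0..1} c'" "\<And>x. x \<in> {0..1} \<Longrightarrow> (c has_real_derivative c' x) (at x within {0..1})"
    using real_analytic_C1[OF c_analytic] by blast
  have fc: "continuous_on {0..1} f" by (rule DERIV_continuous_on[OF f'(2)])
  have cc: "continuous_on {0..1} c" by (rule DERIV_continuous_on[OF c'(2)])
  \<comment> \<open>The lower bound is given on the open interval; continuity carries it to the
    endpoints, where \<open>f / c\<close> is evaluated as well.\<close>
  have cb: "c_min \<le> c x" if "x \<in> {0..1}" for x
  proof (rule continuous_ge_on_closure[where f=c and S=unit_I])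
    show "continuous_on (closure unit_I) c" using cc by simp
    show "x \<in> closure unit_I" using that by simp
    show "c_min \<le> c x" if "x \<in> unit_I" for x using c_min(2) that by blast
  qed
  have cnz: "c x \<noteq> 0" if "x \<in> {0..1}" for x using cb[OF that] c_min(1) by auto
  have w: "has_bdd_deriv (\<lambda>x. f x / c x) (\<lambda>x. (f' x * c x - f x * c' x) / (c x * c x))"
  proof (rule has_bdd_deriv_within)
    show "continuous_on {0..1} (\<lambda>x. (f' x * c x - f x * c' x) / (c x * c x))"
      using cnz by (intro continuous_intros f' c' fc cc) auto
    show "((\<lambda>x. f x / c x) has_real_derivative (f' x * c x - f x * c' x) / (c x * c x)) (at x within {0..1})"
      if "x \<in> {0..1}" for x by (intro DERIV_divide f'(2) c'(2) cnz that)
  qed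
  have cw: "c x * (f x / c x) = f x" if "x \<in> {0..1}" for x using cnz[OF that] by simp
  obtain C where C: "C > 0" and approx: "\<forall>\<delta>\<in>{0<..<1}. \<forall>u. weak_solution \<delta> c f \<alpha>0 \<alpha>1 u \<longrightarrow>
    (\<exists>u'. has_bdd_deriv u u' \<and> (\<forall>N\<ge>1. \<exists>y. y 0 = \<alpha>0 \<and> y N = \<alpha>1 \<and>
      energy \<delta> (\<lambda>x. u x - pl N y x) (\<lambda>x. u' x - pl' N y x) \<le> C * min (1 / real N) ((1 / real N)\<^sup>2 / \<delta>)))"
    using solution_pl_approximation[OF cc fc cb c_min(1) w cw] by blast
  define C1 where "C1 = 21 * C0 + 21 * sqrt C"
  have C1: "C1 > 0" unfolding C1_def using hp_constants C by (intro add_pos_pos) auto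
  \<comment> \<open>\<open>ln 2 / 2\<close> is the decay rate in \<open>L\<close> of sqrt h, which
    is at most 2^(-L/2); \<open>b\<close> is the slower of the two rates.\<close>
  define b where "b = min b0 (ln 2 / 2)"
  have b: "0 < b" "b \<le> b0" "b \<le> ln 2 / 2" using hp_constants(3) by (auto simp: b_def)
  have err: "?err \<delta> L
      \<le> C1 * (exp (- b0 * real L) + min (sqrt (mesh_h L)) (mesh_h L / sqrt \<delta>))"
    if \<delta>: "\<delta> \<in> {0<..<1}" and L: "L \<ge> 1" for \<delta> L
  proof -
    define N where "N = (2::nat) ^ L + 1"
    have N: "N \<ge> 1" by (simp add: N_def)
    have h: "mesh_h L = 1 / real N" by (simp add: mesh_h_def N_def)
    have h0: "mesh_h L > 0" using N by (simp add: h)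
    have \<delta>0: "\<delta> > 0" using \<delta> by simp
    obtain u' y where u': "has_bdd_deriv (u \<delta>) u'" and y: "y 0 = \<alpha>0" "y N = \<alpha>1"
      and E: "energy \<delta> (\<lambda>x. u \<delta> x - pl N y x) (\<lambda>x. u' x - pl' N y x) \<le> C * min (1 / real N) ((1 / real N)\<^sup>2 / \<delta>)"
      using approx \<delta> u_solution N by meson
    have V: "U \<delta> L \<in> pw_poly_space L (T_hp (lam * real L * \<delta>)) \<alpha>0 \<alpha>1" using hp_space \<delta> L by blast
    have "lam * real L * \<delta> > 0" using hp_constants L \<delta>0 by simp
    then obtain v' where v': "has_bdd_deriv (U \<delta> L) v'" using T_hp_has_bdd_deriv[OF V] by blast
    have v01: "U \<delta> L 0 = \<alpha>0" "U \<delta> L 1 = \<alpha>1" using V unfolding pw_poly_space_def by auto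
    define m where "m = min (mesh_h L) ((mesh_h L)\<^sup>2 / \<delta>)"
    define a where "a = C0 * exp (- b0 * real L)"
    have a0: "a \<ge> 0" using hp_constants by (simp add: a_def)
    have m0: "m \<ge> 0" using h0 \<delta>0 by (simp add: m_def)
    have "0 \<le> delta_norm \<delta> (\<lambda>x. u \<delta> x - U \<delta> L x)"
      unfolding delta_norm_eq[OF has_bdd_deriv_diff[OF u' v']]
      using energy_nonneg[OF has_bdd_deriv_diff[OF u' v']] by simp
    then have hp2: "(delta_norm \<delta> (\<lambda>x. u \<delta> x - U \<delta> L x))\<^sup>2 \<le> a\<^sup>2"
      using hp_error \<delta> L unfolding a_def by (intro power_mono) auto
    have "(?err \<delta> L)\<^sup>2 \<le> 418 * a\<^sup>2 + 416 * (C * m)"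
      using projection_error_le[OF \<delta>0 u' v' v01, of y L] y E hp2 unfolding N_def[symmetric] m_def h by simp
    then have "?err \<delta> L \<le> 21 * a + 21 * sqrt C * sqrt m"
      using sqrt_le_from_squares[OF _ a0 _ m0] C by simp
    \<comment> \<open>Return from squares to norms: sqrt is monotone and so commutes with
      min.\<close>
    also have "sqrt m = min (sqrt (mesh_h L)) (mesh_h L / sqrt \<delta>)"
    proof -
      have "sqrt ((mesh_h L)\<^sup>2 / \<delta>) = mesh_h L / sqrt \<delta>" using h0 by (simp add: real_sqrt_divide)
      moreover have "sqrt m = min (sqrt (mesh_h L)) (sqrt ((mesh_h L)\<^sup>2 / \<delta>))"
        unfolding m_def by (rule min_of_mono[symmetric]) (simp add: mono_def)
      ultimately show ?thesis by simp
    qed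
    also have "21 * a + 21 * sqrt C * min (sqrt (mesh_h L)) (mesh_h L / sqrt \<delta>)
      \<le> C1 * exp (- b0 * real L) + C1 * min (sqrt (mesh_h L)) (mesh_h L / sqrt \<delta>)"
    proof (rule add_mono)
      have "21 * C0 \<le> C1" using C by (simp add: C1_def)
      from mult_right_mono[OF this, of "exp (- b0 * real L)"]
      show "21 * a \<le> C1 * exp (- b0 * real L)" by (simp add: a_def mult.assoc)
      have "21 * sqrt C \<le> C1" using hp_constants by (simp add: C1_def)
      then show "21 * sqrt C * min (sqrt (mesh_h L)) (mesh_h L / sqrt \<delta>) \<le> C1 * min (sqrt (mesh_h L)) (mesh_h L / sqrt \<delta>)"
        using h0 \<delta>0 by (intro mult_right_mono) auto
    qed
    finally show ?thesis unfolding distrib_left .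
  qed
  have qtt: "\<exists>r V. is_qtt_wrt L (T_int L) (L2_proj \<alpha>0 \<alpha>1 L (U \<delta> L)) r V \<and>
       (\<forall>j\<in>{1..<L}. real (r j) \<le> 6 * real L) \<and> real (qtt_params L r) \<le> 72 * real L ^ 3 \<and>
       ?err \<delta> L
         \<le> (2 * C1) * exp (- (b / 5) * real (qtt_params L r) powr (1 / 3))"
    if \<delta>: "\<delta> \<in> {0<..<1}" and L: "L \<ge> 1" for \<delta> L
  proof -
    define r where "r = (\<lambda>j. if j = 0 \<or> j = L then 1 else L + 5 :: nat)"
    have V: "U \<delta> L \<in> pw_poly_space L (T_hp (lam * real L * \<delta>)) \<alpha>0 \<alpha>1" using hp_space \<delta> L by blast
    have "lam * real L * \<delta> > 0" using hp_constants L \<delta> by simp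
    then obtain W where W: "is_qtt_wrt L (T_int L) (L2_proj \<alpha>0 \<alpha>1 L (U \<delta> L)) r W"
      using qtt_L2_proj[OF L V] unfolding r_def by blast
    \<comment> \<open>\<open>L + 5 \<le> 6 * L\<close> because \<open>L \<ge> 1\<close>. Each of the
      \<open>L\<close> cores then has at most 2 * 6 * 6 = 72 times \<open>L^2\<close>
      entries.\<close>
    have r6: "r j \<le> 6 * L" for j using L by (auto simp: r_def)
    have "qtt_params L r \<le> (\<Sum>j=1..L. 2 * (6 * L) * (6 * L))"
      unfolding qtt_params_def by (intro sum_mono mult_le_mono r6 order_refl)
    also have "\<dots> = 72 * L ^ 3" by (simp add: power3_eq_cube)
    finally have params: "qtt_params L r \<le> 72 * L ^ 3" .
    have p3: "real (qtt_params L r) \<le> 72 * real L ^ 3"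
      using params by (metis of_nat_le_iff of_nat_mult of_nat_numeral of_nat_power)
    \<comment> \<open>72 is rounded up to the cube 125 = 5^3, so the cube root of the number of
      parameters is at most \<open>5 * L\<close>; hence the rate \<open>b / 5\<close>.\<close>
    have "real (qtt_params L r) \<le> (5 * real L) ^ 3"
    proof -
      have "72 * real L ^ 3 \<le> 125 * real L ^ 3" by (intro mult_right_mono) auto
      then show ?thesis using p3 by (simp add: power_mult_distrib)
    qed
    then have "real (qtt_params L r) powr (1 / 3) \<le> ((5 * real L) ^ 3) powr (1 / 3)"
      by (intro powr_mono2) auto
    also have "\<dots> = 5 * real L"
    proof -
      have "(5 * real L) ^ 3 = (5 * real L) powr 3" using L by (simp add: powr_numeral)
      then have "((5 * real L) ^ 3) powr (1 / 3) = (5 * real L) powr (3 * (1 / 3))"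
        by (simp only: powr_powr)
      then show ?thesis using L by (simp del: power_mult_distrib)
    qed
    finally have "b / 5 * real (qtt_params L r) powr (1 / 3) \<le> b / 5 * (5 * real L)"
      using b by (intro mult_left_mono) auto
    then have e1: "exp (- b * real L) \<le> exp (- (b / 5) * real (qtt_params L r) powr (1 / 3))" by simp
    have hL: "sqrt (mesh_h L) \<le> exp (- b * real L)"
    proof (rule real_le_lsqrt)
      have "mesh_h L \<le> 1 / 2 ^ L" unfolding mesh_h_def by (intro divide_left_mono mult_pos_pos add_pos_pos) auto
      also have "1 / 2 ^ L = exp (- ln 2 * real L)"
        by (simp add: exp_minus exp_of_nat2_mult inverse_eq_divide)
      also have "\<dots> \<le> exp (- (2 * b) * real L)"
        using b(3) by (simp add: mult_right_mono)
      also have "\<dots> = (exp (- b * real L))\<^sup>2" by (simp add: power2_eq_square exp_add[symmetric])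
      finally show "mesh_h L \<le> (exp (- b * real L))\<^sup>2" .
    qed auto
    have "?err \<delta> L
      \<le> C1 * (exp (- b0 * real L) + min (sqrt (mesh_h L)) (mesh_h L / sqrt \<delta>))" by (rule err[OF \<delta> L])
    also have "\<dots> \<le> C1 * (exp (- b * real L) + exp (- b * real L))"
    proof (intro mult_left_mono add_mono)
      show "exp (- b0 * real L) \<le> exp (- b * real L)" using b(2) by (simp add: mult_right_mono)
      \<comment> \<open>The branch of the minimum without \<open>\<delta>\<close> gives a rate that
        is uniform in \<open>\<delta>\<close>.\<close>
      show "min (sqrt (mesh_h L)) (mesh_h L / sqrt \<delta>) \<le> exp (- b * real L)" using hL by linarith
    qed (use C1 in simp)
    also have "\<dots> = (2 * C1) * exp (- b * real L)" by simp
    also have "\<dots> \<le> (2 * C1) * exp (- (b / 5) * real (qtt_params L r) powr (1 / 3))"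
      using C1 by (intro mult_left_mono e1) simp
    finally have fin: "?err \<delta> L
        \<le> (2 * C1) * exp (- (b / 5) * real (qtt_params L r) powr (1 / 3))" .
    have "\<forall>j\<in>{1..<L}. real (r j) \<le> 6 * real L"
      using r6 by (metis of_nat_le_iff of_nat_mult of_nat_numeral)
    then show ?thesis using W p3 fin by blast
  qed
  show ?thesis
  proof (rule exI[of _ C1], intro conjI C1, rule exI[of _ b0], intro conjI hp_constants(3),
      rule exI[of _ "2 * C1"], intro conjI, simp add: C1, rule exI[of _ "b / 5"], intro conjI, simp add: b,
      rule exI[of _ 6], intro conjI, simp, rule exI[of _ 72], intro conjI, simp, intro ballI allI impI conjI)
  qed (rule err qtt; assumption)+
qed

end
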